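(* Let $\alpha\in(0,1)$, let $T>0$ be fixed and $h_n=T/n$. Let the observations be generated by model $m$ on $[0,T]$ with true parameter $\theta_{m,0}\in\Theta_m$, and let $m^*$ be a model number whose covariance structure is to be tested. Assume: (a) each drift $B\in\{B_{1,m},B_{2,m},B_{3,m},B_{4,m}\}$ is globally Lipschitz and belongs to $C^4_{\uparrow}$, and each process $Y\in\{\xi_m,\delta_m,\varepsilon_m,\zeta_m\}$ satisfies $\sup_t \mathbb{E}[|Y_t|^{\ell}]<\infty$ for all $\ell\ge 0$; (b) for $\mu\in\{m,m^*\}$ and all $\theta_\mu\in\Theta_\mu$: $\Sigma_{\delta\delta,\mu}>0$, $\Sigma_{\varepsilon\varepsilon,\mu}>0$, $\Psi_\mu$ is non-singular, and $\operatorname{rank}\Lambda_{x_1,\mu}=k_{1,\mu}$; (c) the minimizer $\bar\theta_{m^*}$ of $\mathbb{U}_{m^*}$ over $\Theta_{m^*}$ is unique: for $\theta\in\Theta_{m^*}$, $\mathbb{U}_{m^*}(\theta)=\mathbb{U}_{m^*}(\bar\theta_{m^*})$ implies $\theta=\bar\theta_{m^*}$; (d) the alternative $H_1$ holds: $\Sigma_m(\theta_{m,0})\neq\Sigma_{m^*}(\theta)$ for all $\theta\in\Theta_{m^*}$. Then, as $h_n\to0$ (i.e. $n\to\infty$), $$\mathbb{P}\bigl(\mathbb{T}_{m^*,n}>\chi^2_{\bar p-q_{m^*}}(\alpha)\bigr)\longrightarrow1,$$ where $\chi^2_r(\alpha)$ is the upper $\alpha$ point of the chi-squared distribution with $r$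 degrees of freedom.
   Context: Notation. $p=p_1+p_2$, $\bar p=p(p+1)/2$. $|\cdot|$ is the Euclidean norm; $A>0$ means positive definite. For symmetric $A\in\mathbb{R}^{p\times p}$, $\operatorname{vec}A$ and $\operatorname{vech}A$ are the vectorization and half-vectorization, $\mathbb{D}_p$ is the $p^2\times\bar p$ duplication matrix ($\operatorname{vec}A=\mathbb{D}_p\operatorname{vech}A$). $C^4_{\uparrow}(\mathbb{R}^d)$ is the set of functions on $\mathbb{R}^d$ that are four times continuously differentiable and which, together with all these derivatives, are of polynomial growth. Model ($m$ is a model number). $p_1,p_2\ge1$, $k_{1,m}\le p_1$, $k_{2,m}\le p_2$ are fixed integers independent of $n$; $p_1,p_2$ do not depend on the model number. The observable process is $X_t=(X_{1,t}^\top,X_{2,t}^\top)^\top\in\mathbb{R}^{p_1+p_2}$ with $$X_{1,t}=\Lambda_{x_1,m}\xi_{m,t}+\delta_{m,t},\quad X_{2,t}=\Lambda_{x_2,m}\eta_{m,t}+\varepsilon_{m,t},\quad \eta_{m,t}=B_{0,m}\eta_{m,t}+\Gamma_m\xi_{m,t}+\zeta_{m,t},$$ where $\Lambda_{x_1,m}\in\mathbb{R}^{p_1\times k_{1,m}}$, $\Lambda_{x_2,m}\in\mathbb{R}^{p_2\times k_{2,m}}$, $\Gamma_m\in\mathbb{R}^{k_{2,m}\times k_{1,m}}$, $B_{0,m}\in\mathbb{R}^{k_{2,m}\times k_{2,m}}$ (zero diagonal) are constant, and $\Psi_m=\mathbb{I}_{k_{2,m}}-B_{0,m}$. The latent processes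 (dimensions $k_{1,m},p_1,p_2,k_{2,m}$) solve $$d\xi_{m,t}=B_{1,m}(\xi_{m,t})dt+S_{1,m}dW_{1,t},\quad d\delta_{m,t}=B_{2,m}(\delta_{m,t})dt+S_{2,m}dW_{2,t},$$ $$d\varepsilon_{m,t}=B_{3,m}(\varepsilon_{m,t})dt+S_{3,m}dW_{3,t},\quad d\zeta_{m,t}=B_{4,m}(\zeta_{m,t})dt+S_{4,m}dW_{4,t},$$ with deterministic initial values, constant matrices $S_{i,m}$, and independent standard Wiener processes $W_1,\dots,W_4$ of dimensions $r_1,\dots,r_4$. Put $\Sigma_{\xi\xi,m}=S_{1,m}S_{1,m}^\top$, $\Sigma_{\delta\delta,m}=S_{2,m}S_{2,m}^\top$, $\Sigma_{\varepsilon\varepsilon,m}=S_{3,m}S_{3,m}^\top$, $\Sigma_{\zeta\zeta,m}=S_{4,m}S_{4,m}^\top$. Parameter. $\theta_m\in\Theta_m$, with $\Theta_m\subset\mathbb{R}^{q_m}$ convex and compact, collects the unknown, non-duplicated entries of $\Lambda_{x_1,m},\Lambda_{x_2,m},\Gamma_m,\Psi_m,\Sigma_{\xi\xi,m},\Sigma_{\delta\delta,m},\Sigma_{\varepsilon\varepsilon,m},\Sigma_{\zeta\zeta,m}$ (all other entries are known constants or equal to other entries), so these matrices are functions of $\theta_m$. The covariance structure is $$\Sigma_m(\theta_m)=\begin{pmatrix}\Sigma_{X_1X_1,m}&\Sigma_{X_1X_2,m}\\ \Sigma_{X_1X_2,m}^\top&\Sigma_{X_2X_2,m}\end{pmatrix},$$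 $\Sigma_{X_1X_1,m}=\Lambda_{x_1,m}\Sigma_{\xi\xi,m}\Lambda_{x_1,m}^\top+\Sigma_{\delta\delta,m}$, $\Sigma_{X_1X_2,m}=\Lambda_{x_1,m}\Sigma_{\xi\xi,m}\Gamma_m^\top\Psi_m^{-1\top}\Lambda_{x_2,m}^\top$, $\Sigma_{X_2X_2,m}=\Lambda_{x_2,m}\Psi_m^{-1}(\Gamma_m\Sigma_{\xi\xi,m}\Gamma_m^\top+\Sigma_{\zeta\zeta,m})\Psi_m^{-1\top}\Lambda_{x_2,m}^\top+\Sigma_{\varepsilon\varepsilon,m}$. The model $m^*$ has its own dimensions $k_{1,m^*},k_{2,m^*}$, matrices, parameter set $\Theta_{m^*}\subset\mathbb{R}^{q_{m^*}}$ (convex compact) and covariance structure $\Sigma_{m^*}(\theta_{m^*})$, defined in the same way with $m$ replaced by $m^*$. Observations. $X_{t_i^n}$ with $t_i^n=ih_n$, $0\le i\le n$, $T=nh_n$, and $Q_{XX}=\frac1T\sum_{i=1}^n(X_{t_i^n}-X_{t_{i-1}^n})(X_{t_i^n}-X_{t_{i-1}^n})^\top$. Further definitions. For positive definite $X,Y\in\mathbb{R}^{p\times p}$, $F(X,Y)=\log\det Y-\log\det X+\operatorname{tr}\{Y^{-1}X\}-p$ and $$V(X,Y)=\mathbb{D}_p^\top\int_0^1\!\!\int_0^1\lambda_2\,(Y+\lambda_1\lambda_2(X-Y))^{-1}\otimes(Y+\lambda_1\lambda_2(X-Y))^{-1}\,d\lambda_1d\lambda_2\,\mathbb{D}_p,$$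 so that $F(X,Y)=(\operatorname{vech}X-\operatorname{vech}Y)^\top V(X,Y)(\operatorname{vech}X-\operatorname{vech}Y)$. Set $\tilde V(Q_{XX},\Sigma)=V(Q_{XX},\Sigma)$ if $Q_{XX}$ is non-singular and $\mathbb{I}_{\bar p}$ otherwise, and $$\mathbb{F}_{m^*,n}(\theta)=(\operatorname{vech}Q_{XX}-\operatorname{vech}\Sigma_{m^*}(\theta))^\top\tilde V(Q_{XX},\Sigma_{m^*}(\theta))(\operatorname{vech}Q_{XX}-\operatorname{vech}\Sigma_{m^*}(\theta)),\quad\theta\in\Theta_{m^*}.$$ The estimator $\hat\theta_{m^*,n}\in\Theta_{m^*}$ satisfies $\mathbb{F}_{m^*,n}(\hat\theta_{m^*,n})=\inf_{\theta\in\Theta_{m^*}}\mathbb{F}_{m^*,n}(\theta)$, and $\mathbb{T}_{m^*,n}=n\,\mathbb{F}_{m^*,n}(\hat\theta_{m^*,n})$. Finally $\mathbb{U}_{m^*}(\theta)=F(\Sigma_m(\theta_{m,0}),\Sigma_{m^*}(\theta))$ and $\bar\theta_{m^*}\in\Theta_{m^*}$ satisfies $\mathbb{U}_{m^*}(\bar\theta_{m^*})=\inf_{\theta\in\Theta_{m^*}}\mathbb{U}_{m^*}(\theta)$. *)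

theory Defs
  imports "HOL-Probability.Probability" "HOL-Library.Uprod"
begin

section \<open>Matrices\<close>

definition pos_def :: "real^'n^'n \<Rightarrow> bool" where
  "pos_def A \<longleftrightarrow> transpose A = A \<and> (\<forall>x. x \<noteq> 0 \<longrightarrow> 0 < x \<bullet> (A *v x))"

definition outer_product :: "real^'n \<Rightarrow> real^'m \<Rightarrow> real^'m^'n" where
  "outer_product x y = (\<chi> i j. x $ i * y $ j)"

definition kronecker :: "real^'n^'m \<Rightarrow> real^'l^'k \<Rightarrow> real^('n \<times> 'l)^('m \<times> 'k)" where
  "kronecker A B = (\<chi> a b. A $ fst a $ fst b * B $ snd a $ snd b)"

definition join_vec :: "real^'a \<Rightarrow> real^'b \<Rightarrow> real^('a + 'b)" where
  "join_vec x y = (\<chi> i. case i of Inl a \<Rightarrow> x $ a | Inr b \<Rightarrow> y $ b)"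

definition block_matrix ::
  "real^'c^'a \<Rightarrow> real^'d^'a \<Rightarrow> real^'c^'b \<Rightarrow> real^'d^'b \<Rightarrow> real^('c + 'd)^('a + 'b)" where
  "block_matrix A B C D = (\<chi> i. case i of
      Inl a \<Rightarrow> join_vec (A $ a) (B $ a)
    | Inr b \<Rightarrow> join_vec (C $ b) (D $ b))"

instance uprod :: (finite) finite
  by standard simp

text \<open>
  A symmetric matrix is determined by one entry for every unordered pair of indices, so the
  half-vectorization is indexed by the type of unordered pairs, which has
  \<open>p (p + 1) / 2\<close> elements (lemma \<open>CARD_uprod\<close>). On matrices that are not
  symmetric \<open>vech\<close> is not meaningful. The index \<open>(j, i)\<close> of
  \<open>vec_mat\<close> is the row \<open>i\<close> in the column \<open>j\<close>.
\<close>

definition vec_mat :: "real^'n^'n \<Rightarrow> real^('n \<times> 'n)" where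
  "vec_mat A = (\<chi> a. A $ snd a $ fst a)"

definition vech :: "real^'n^'n \<Rightarrow> real^('n uprod)" where
  "vech A = (\<chi> u. THE r. \<exists>i j. u = Upair i j \<and> r = A $ i $ j)"

definition duplication_matrix :: "real^(('n::finite) uprod)^('n \<times> 'n)" where
  "duplication_matrix = (\<chi> a u. if u = Upair (fst a) (snd a) then 1 else 0)"

lemma CARD_uprod: "CARD('n::finite uprod) = CARD('n) * (CARD('n) + 1) div 2"
  by (simp add: card_UNIV_uprod algebra_simps)

lemma vech_Upair:
  fixes A :: "real^'n^'n"
  assumes "transpose A = A"
  shows "vech A $ Upair i j = A $ i $ j"
proof -
  have "A $ k $ l = A $ l $ k" for k l
    using assms by (metis transpose_def vec_lambda_beta)
  then show ?thesis
    unfolding vech_def by (auto intro!: the_equality)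
qed

lemma vec_mat_duplication:
  fixes A :: "real^'n^'n"
  assumes "transpose A = A"
  shows "vec_mat A = duplication_matrix *v vech A"
proof -
  have "A $ k $ l = A $ l $ k" for k l
    using assms by (metis transpose_def vec_lambda_beta)
  then show ?thesis
    by (simp add: vec_eq_iff vec_mat_def duplication_matrix_def matrix_vector_mult_def
        vech_Upair[OF assms] if_distrib if_distribR cong: if_cong)
qed


section \<open>Contrast function\<close>

definition F_fun :: "real^'n^'n \<Rightarrow> real^'n^'n \<Rightarrow> real" where
  "F_fun X Y = ln (det Y) - ln (det X) + trace (matrix_inv Y ** X) - real CARD('n)"

definition V_fun :: "real^'n^'n \<Rightarrow> real^'n^'n \<Rightarrow> real^('n uprod)^('n uprod)" where
  "V_fun X Y =
     transpose duplication_matrix **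
     integral {0..1} (\<lambda>l2. integral {0..1} (\<lambda>l1.
       l2 *\<^sub>R kronecker (matrix_inv (Y + (l1 * l2) *\<^sub>R (X - Y)))
                     (matrix_inv (Y + (l1 * l2) *\<^sub>R (X - Y))))) **
     duplication_matrix"

definition V_tilde :: "real^'n^'n \<Rightarrow> real^'n^'n \<Rightarrow> real^('n uprod)^('n uprod)" where
  "V_tilde Q S = (if invertible Q then V_fun Q S else mat 1)"

definition contrast :: "real^'n^'n \<Rightarrow> real^'n^'n \<Rightarrow> real" where
  "contrast Q S = (vech Q - vech S) \<bullet> (V_tilde Q S *v (vech Q - vech S))"

definition realized_cov :: "real \<Rightarrow> nat \<Rightarrow> (real \<Rightarrow> real^'n) \<Rightarrow> real^'n^'n" where
  "realized_cov T n x = (let t = (\<lambda>i::nat. real i * (T / real n)) in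
     (1 / T) *\<^sub>R (\<Sum>i=1..n. outer_product (x (t i) - x (t (i - 1))) (x (t i) - x (t (i - 1)))))"


section \<open>Structural equation models\<close>

text \<open>
  Every entry of a parameter matrix is either a known constant or one coordinate of the parameter
  vector; entries that are equal to each other carry the same coordinate.
\<close>

datatype 'q entry = Known real | Param 'q

primrec entry_val :: "real^'q \<Rightarrow> 'q entry \<Rightarrow> real" where
  "entry_val \<theta> (Known c) = c"
| "entry_val \<theta> (Param l) = \<theta> $ l"

definition mat_val :: "'q entry^'n^'m \<Rightarrow> real^'q \<Rightarrow> real^'n^'m" where
  "mat_val E \<theta> = (\<chi> i j. entry_val \<theta> (E $ i $ j))"

definition entries :: "'a^'n^'m \<Rightarrow> 'a set" where
  "entries E = {E $ i $ j | i j. True}"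

text \<open>
  The fields ending in \<open>spec\<close> give the patterns of the loading matrices, of the matrices
  \<open>\<Gamma>\<close> and \<open>\<Psi>\<close>, and of the covariances of the four latent processes. The
  diffusion matrices \<open>S1\<close>, \<dots>, \<open>S4\<close> are functions of the parameter because
  the parameter contains the entries of \<open>S S\<^sup>T\<close>, not those of \<open>S\<close>.
\<close>

record ('p1, 'p2, 'k1, 'k2, 'q, 'r1, 'r2, 'r3, 'r4) sem =
  Theta :: "(real^('q::finite)) set"
  Lx1_spec :: "'q entry^('k1::finite)^('p1::finite)"
  Lx2_spec :: "'q entry^('k2::finite)^('p2::finite)"
  Gamma_spec :: "'q entry^'k1^'k2"
  Psi_spec :: "'q entry^'k2^'k2"
  xi_spec :: "'q entry^'k1^'k1"
  delta_spec :: "'q entry^'p1^'p1"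
  eps_spec :: "'q entry^'p2^'p2"
  zeta_spec :: "'q entry^'k2^'k2"
  S1 :: "real^'q \<Rightarrow> real^('r1::finite)^'k1"
  S2 :: "real^'q \<Rightarrow> real^('r2::finite)^'p1"
  S3 :: "real^'q \<Rightarrow> real^('r3::finite)^'p2"
  S4 :: "real^'q \<Rightarrow> real^('r4::finite)^'k2"

definition "Lx1 m = mat_val (Lx1_spec m)"
definition "Lx2 m = mat_val (Lx2_spec m)"
definition "Gamma_mat m = mat_val (Gamma_spec m)"
definition "Psi m = mat_val (Psi_spec m)"
definition "B0 m \<theta> = mat 1 - Psi m \<theta>"
definition "Sigma_xi m = mat_val (xi_spec m)"
definition "Sigma_delta m = mat_val (delta_spec m)"
definition "Sigma_eps m = mat_val (eps_spec m)"
definition "Sigma_zeta m = mat_val (zeta_spec m)"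

definition is_sem ::
  "('p1::finite, 'p2::finite, 'k1::finite, 'k2::finite, 'q::finite,
    'r1::finite, 'r2::finite, 'r3::finite, 'r4::finite) sem \<Rightarrow> bool" where
  "is_sem m \<longleftrightarrow>
     CARD('k1) \<le> CARD('p1) \<and> CARD('k2) \<le> CARD('p2) \<and>
     convex (Theta m) \<and> compact (Theta m) \<and>
     transpose (xi_spec m) = xi_spec m \<and> transpose (delta_spec m) = delta_spec m \<and>
     transpose (eps_spec m) = eps_spec m \<and> transpose (zeta_spec m) = zeta_spec m \<and>
     range Param \<subseteq>
       entries (Lx1_spec m) \<union> entries (Lx2_spec m) \<union> entries (Gamma_spec m) \<union> entries (Psi_spec m) \<union>
       entries (xi_spec m) \<union> entries (delta_spec m) \<union> entries (eps_spec m) \<union> entries (zeta_spec m) \<and>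
     (\<forall>\<theta>\<in>Theta m.
        (\<forall>i. B0 m \<theta> $ i $ i = 0) \<and>
        Sigma_xi m \<theta> = S1 m \<theta> ** transpose (S1 m \<theta>) \<and>
        Sigma_delta m \<theta> = S2 m \<theta> ** transpose (S2 m \<theta>) \<and>
        Sigma_eps m \<theta> = S3 m \<theta> ** transpose (S3 m \<theta>) \<and>
        Sigma_zeta m \<theta> = S4 m \<theta> ** transpose (S4 m \<theta>))"

definition Sigma_11 where
  "Sigma_11 m \<theta> = Lx1 m \<theta> ** Sigma_xi m \<theta> ** transpose (Lx1 m \<theta>) + Sigma_delta m \<theta>"

definition Sigma_12 where
  "Sigma_12 m \<theta> = Lx1 m \<theta> ** Sigma_xi m \<theta> ** transpose (Gamma_mat m \<theta>)
     ** transpose (matrix_inv (Psi m \<theta>)) ** transpose (Lx2 m \<theta>)"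

definition Sigma_22 where
  "Sigma_22 m \<theta> = Lx2 m \<theta> ** matrix_inv (Psi m \<theta>)
     ** (Gamma_mat m \<theta> ** Sigma_xi m \<theta> ** transpose (Gamma_mat m \<theta>) + Sigma_zeta m \<theta>)
     ** transpose (matrix_inv (Psi m \<theta>)) ** transpose (Lx2 m \<theta>) + Sigma_eps m \<theta>"

definition Sigma_cov ::
  "('p1::finite, 'p2::finite, 'k1::finite, 'k2::finite, 'q::finite,
    'r1::finite, 'r2::finite, 'r3::finite, 'r4::finite) sem
   \<Rightarrow> real^'q \<Rightarrow> real^('p1 + 'p2)^('p1 + 'p2)" where
  "Sigma_cov m \<theta> =
     block_matrix (Sigma_11 m \<theta>) (Sigma_12 m \<theta>) (transpose (Sigma_12 m \<theta>)) (Sigma_22 m \<theta>)"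

definition regular_sem ::
  "('p1::finite, 'p2::finite, 'k1::finite, 'k2::finite, 'q::finite,
    'r1::finite, 'r2::finite, 'r3::finite, 'r4::finite) sem \<Rightarrow> bool" where
  "regular_sem m \<longleftrightarrow> (\<forall>\<theta>\<in>Theta m.
     pos_def (Sigma_delta m \<theta>) \<and> pos_def (Sigma_eps m \<theta>) \<and>
     invertible (Psi m \<theta>) \<and> rank (Lx1 m \<theta>) = CARD('k1))"


section \<open>Stochastic processes\<close>

definition poly_growth :: "('a::real_normed_vector \<Rightarrow> 'b::real_normed_vector) \<Rightarrow> bool" where
  "poly_growth f \<longleftrightarrow> (\<exists>C k. \<forall>x. norm (f x) \<le> C * (1 + norm x ^ k))"

text \<open>
  \<open>C_up k\<close> holds of the functions that are \<open>k\<close> times continuously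
  differentiable and have, together with all partial derivatives up to order \<open>k\<close>,
  polynomial growth.
\<close>

primrec C_up :: "nat \<Rightarrow> ('a::euclidean_space \<Rightarrow> 'b::real_normed_vector) \<Rightarrow> bool" where
  "C_up 0 f \<longleftrightarrow> continuous_on UNIV f \<and> poly_growth f"
| "C_up (Suc k) f \<longleftrightarrow> (\<forall>x. f differentiable (at x)) \<and> poly_growth f \<and>
     (\<forall>b\<in>Basis. C_up k (\<lambda>x. frechet_derivative f (at x) b))"

definition wiener_process :: "'w measure \<Rightarrow> real \<Rightarrow> (real \<Rightarrow> 'w \<Rightarrow> real^'r) \<Rightarrow> bool" where
  "wiener_process M T W \<longleftrightarrow>
     (\<forall>t\<in>{0..T}. W t \<in> borel_measurable M) \<and>
     (AE \<omega> in M. W 0 \<omega> = 0) \<and>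
     (AE \<omega> in M. continuous_on {0..T} (\<lambda>t. W t \<omega>)) \<and>
     (\<forall>n (t :: nat \<Rightarrow> real). mono_on {..n} t \<and> t ` {..n} \<subseteq> {0..T} \<longrightarrow>
        prob_space.indep_vars M (\<lambda>_. borel) (\<lambda>i \<omega>. W (t (Suc i)) \<omega> - W (t i) \<omega>) {..<n}) \<and>
     (\<forall>s t. 0 \<le> s \<and> s < t \<and> t \<le> T \<longrightarrow>
        distributed M lborel (\<lambda>\<omega>. W t \<omega> - W s \<omega>)
          (\<lambda>x. ennreal (\<Prod>i\<in>UNIV. normal_density 0 (sqrt (t - s)) (x $ i))))"

definition process_events ::
  "'w measure \<Rightarrow> real \<Rightarrow> (real \<Rightarrow> 'w \<Rightarrow> 'b::topological_space) \<Rightarrow> 'w set set" where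
  "process_events M T W =
     sigma_sets (space M) {W t -` A \<inter> space M | t A. t \<in> {0..T} \<and> A \<in> sets borel}"

text \<open>
  \<open>dY\<^sub>t = b(Y\<^sub>t) dt + S dW\<^sub>t\<close>, \<open>Y\<^sub>0 = y0\<close>, on \<open>[0, T]\<close>. As \<open>S\<close> is
  constant, the stochastic integral is \<open>S W\<^sub>t\<close> and the equation is a pathwise integral equation.
  For Lipschitz \<open>b\<close> its solution is a functional of the path of \<open>W\<close>, so
  adaptedness needs no separate requirement.
\<close>

definition solves_sde ::
  "'w measure \<Rightarrow> real \<Rightarrow> (real^'d \<Rightarrow> real^'d) \<Rightarrow> real^'r^'d \<Rightarrow> (real \<Rightarrow> 'w \<Rightarrow> real^'r)
   \<Rightarrow> real^'d \<Rightarrow> (real \<Rightarrow> 'w \<Rightarrow> real^'d) \<Rightarrow> bool" where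
  "solves_sde M T b S W y0 Y \<longleftrightarrow>
     (\<forall>t\<in>{0..T}. Y t \<in> borel_measurable M) \<and>
     (AE \<omega> in M. continuous_on {0..T} (\<lambda>t. Y t \<omega>) \<and>
        (\<forall>t\<in>{0..T}. Y t \<omega> = y0 + integral {0..t} (\<lambda>s. b (Y s \<omega>)) + S *v W t \<omega>))"

definition bounded_moments :: "'w measure \<Rightarrow> real \<Rightarrow> (real \<Rightarrow> 'w \<Rightarrow> real^'d) \<Rightarrow> bool" where
  "bounded_moments M T Y \<longleftrightarrow>
     (\<forall>l\<ge>0::real. (SUP t\<in>{0..T}. \<integral>\<^sup>+\<omega>. ennreal (norm (Y t \<omega>) powr l) \<partial>M) < \<infinity>)"


section \<open>Chi-squared distribution\<close>

definition chi_squared :: "nat \<Rightarrow> real measure" where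
  "chi_squared r = distr (\<Pi>\<^sub>M i\<in>{..<r}. density lborel (\<lambda>x. ennreal (std_normal_density x)))
     borel (\<lambda>x. \<Sum>i<r. (x i)\<^sup>2)"

text \<open>There is exactly one such point if \<open>1 \<le> r\<close> and \<open>0 < \<alpha> < 1\<close>; for \<open>r = 0\<close> there is none.\<close>

definition chi_squared_upper :: "nat \<Rightarrow> real \<Rightarrow> real" where
  "chi_squared_upper r \<alpha> = (THE c. measure (chi_squared r) {c<..} = \<alpha>)"

end

theory Submission
  imports Defs
begin

text \<open>
  Under the alternative the minimum of \<open>F (\<Sigma>\<^sub>m (\<theta>\<^sub>0), \<cdot>)\<close> over the covariance matrices of the model \<open>m\<^sup>*\<close> is a number
  \<open>u > 0\<close>: it is attained, and \<open>F\<close> vanishes only for equal arguments (\<open>F_fun_pos\<close>). If the realised covariance \<open>Q\<close>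
  is close to the true \<open>\<Sigma>\<^sub>m (\<theta>\<^sub>0)\<close>, the minimal contrast is still at least \<open>u / 4\<close>, so the test statistic is at least
  \<open>n u / 4\<close> and exceeds every constant critical value from some \<open>n\<close> on. As \<open>Q\<close> converges in probability to
  \<open>\<Sigma>\<^sub>m (\<theta>\<^sub>0)\<close>, this happens with probability tending to one.

  The contrast. Two positive definite matrices \<open>X\<close>, \<open>Y\<close> can be diagonalised simultaneously by a congruence that takes
  \<open>Y\<close> to the identity (\<open>simultaneous_diagonalisation\<close>). In the generalised eigenvalues \<open>l\<^sub>i > 0\<close> of \<open>X\<close> relative to \<open>Y\<close>
  one has \<open>F (X, Y) = \<Sum>\<^sub>i (l\<^sub>i - 1 - ln l\<^sub>i)\<close>, which gives positivity, and the quadratic form with weight \<open>V\<close> becomes a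
  sum of scalar Taylor remainders, which gives \<open>contrast_eq_F_fun\<close>. The lower bound is stable because \<open>tr (Y\<^sup>-\<^sup>1 X)\<close>, the
  only way in which \<open>Y\<close> enters a perturbation of \<open>X\<close>, is bounded by a multiple of \<open>F (X, Y)\<close> plus a constant
  (\<open>F_fun_lower_bound_stable\<close>).

  The realised covariance. The observed process is \<open>A + G W\<close>, where \<open>W\<close> stacks the four Wiener processes, \<open>G\<close> is a
  constant matrix with \<open>G G\<^sup>T = \<Sigma>\<^sub>m (\<theta>\<^sub>0)\<close> (\<open>Sigma_cov_eq_gram\<close>), and the paths of \<open>A\<close> are Lipschitz because the diffusion
  coefficients are constant. The part \<open>A\<close> is negligible path by path (\<open>realized_cov_add_lipschitz\<close>). The realised
  covariance of \<open>W\<close> tends to the identity in probability by Chebyshev's inequality: the centred products of increments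
  are orthogonal, by independence over disjoint intervals and between the four processes
  (\<open>wiener_variation\<close>, \<open>independent_wiener_variation\<close>).

  The test statistic is defined through an estimator that may fail to be measurable. Its value is nevertheless
  measurable, since it is an infimum of functions of \<open>Q\<close> whose strict sublevel sets are, on the singular and on the
  nonsingular matrices separately, traces of open sets (\<open>minimal_contrast_measurable\<close>).
\<close>

section \<open>Simultaneous diagonalisation\<close>

lemma inner_symmetric_matrix:
  fixes A :: "real^'n^'n"
  assumes "transpose A = A"
  shows "x \<bullet> (A *v y) = y \<bullet> (A *v x)"
  by (metis assms dot_lmul_matrix inner_commute vector_transpose_matrix)

lemma quadratic_form_continuous:
  fixes A :: "real^'n^'n"
  shows "continuous_on S (\<lambda>x. x \<bullet> (A *v x))"
  by (intro continuous_intros)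

lemma pos_def_coercive:
  fixes A :: "real^'n^'n"
  assumes "pos_def A"
  obtains c where "c > 0" "\<And>x. c * (x \<bullet> x) \<le> x \<bullet> (A *v x)"
proof -
  have "sphere (0::real^'n) 1 \<noteq> {}" by simp
  then obtain z where z: "z \<in> sphere 0 1"
    and zmin: "\<And>x. x \<in> sphere 0 1 \<Longrightarrow> z \<bullet> (A *v z) \<le> x \<bullet> (A *v x)"
    using continuous_attains_inf[OF compact_sphere _ quadratic_form_continuous[of _ A]] by metis
  let ?c = "z \<bullet> (A *v z)"
  have "z \<noteq> 0" using z by auto
  then have "?c > 0" using assms by (auto simp: pos_def_def)
  moreover have "?c * (x \<bullet> x) \<le> x \<bullet> (A *v x)" for x
  proof (cases "x = 0")
    case False
    let ?y = "(1 / norm x) *\<^sub>R x"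
    have "?y \<in> sphere 0 1" using False by simp
    then have "?c \<le> ?y \<bullet> (A *v ?y)" by (rule zmin)
    also have "\<dots> = (x \<bullet> (A *v x)) / (x \<bullet> x)"
      by (simp add: matrix_vector_mult_scaleR dot_square_norm power2_eq_square)
    finally show ?thesis using False by (simp add: field_simps)
  qed simp
  ultimately show thesis using that by blast
qed

text \<open>This replaces the derivative in the first order condition at a maximum: on a line through the maximiser
  of a quadratic form, the deficit is such a polynomial in the line parameter \<open>t\<close>.\<close>

lemma linear_coefficient_eq_0:
  fixes a b :: real
  assumes "\<And>t. 0 \<le> 2 * t * b + t\<^sup>2 * a"
  shows "b = 0"
proof (rule ccontr)
  assume "b \<noteq> 0"
  define d where "d = \<bar>a\<bar> + 1"
  have d: "d > 0" "a - 2 * d < 0" by (auto simp: d_def)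
  have "0 \<le> 2 * (- b / d) * b + (- b / d)\<^sup>2 * a" by (rule assms)
  also have "\<dots> = (b / d)\<^sup>2 * (a - 2 * d)"
    using d by (simp add: field_simps power2_eq_square)
  finally have "0 \<le> (b / d)\<^sup>2 * (a - 2 * d)" .
  moreover have "(b / d)\<^sup>2 > 0" using \<open>b \<noteq> 0\<close> d by simp
  ultimately show False using d by (simp add: zero_le_mult_iff)
qed

text \<open>The maximiser of \<open>z \<bullet> X z\<close> on the compact set \<open>z \<bullet> Y z = 1\<close> is a generalised eigenvector of the
  pencil \<open>(X, Y)\<close> within \<open>W\<close>, and the maximum is the eigenvalue.\<close>

lemma generalised_eigenvector_on_subspace:
  fixes X Y :: "real^'n^'n"
  assumes Y: "pos_def Y" and X: "transpose X = X"
    and W: "subspace W" "z0 \<in> W" "z0 \<noteq> 0"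
  obtains w l where "w \<in> W" "w \<bullet> (Y *v w) = 1"
    "\<And>u. u \<in> W \<Longrightarrow> u \<bullet> (X *v w) = l * (u \<bullet> (Y *v w))"
proof -
  let ?q = "\<lambda>A::real^'n^'n. \<lambda>z. z \<bullet> (A *v z)"
  have Ysym: "transpose Y = Y" and Ypos: "\<And>x. x \<noteq> 0 \<Longrightarrow> 0 < ?q Y x"
    using Y by (auto simp: pos_def_def)
  have scale: "?q A (c *\<^sub>R z) = c\<^sup>2 * ?q A z" for A c z
    by (simp add: matrix_vector_mult_scaleR power2_eq_square)
  define K where "K = {z \<in> W. ?q Y z = 1}"
  obtain c where c: "c > 0" "\<And>x. c * (x \<bullet> x) \<le> ?q Y x"
    using pos_def_coercive[OF Y] by blast
  have normalised: "(1 / sqrt (?q Y z)) *\<^sub>R z \<in> K" if "z \<in> W" "z \<noteq> 0" for z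
    using that Ypos[of z] W(1)
    by (simp only: K_def mem_Collect_eq scale)
       (auto simp: subspace_scale power_divide)
  have "closed K"
  proof -
    have "K = W \<inter> (UNIV \<inter> ?q Y -` {1})" by (auto simp: K_def)
    moreover have "closed (UNIV \<inter> ?q Y -` {1})"
      by (rule continuous_closed_preimage) (auto intro: quadratic_form_continuous)
    ultimately show ?thesis using closed_subspace[OF W(1)] by auto
  qed
  moreover have "bounded K"
  proof -
    have "norm z \<le> sqrt (1 / c)" if "z \<in> K" for z
    proof -
      have "c * (norm z)\<^sup>2 \<le> 1"
        using c(2)[of z] that by (simp add: K_def dot_square_norm)
      then show ?thesis using c(1) by (intro real_le_rsqrt) (simp add: field_simps)
    qed
    then show ?thesis by (auto simp: bounded_iff)
  qed
  ultimately have "compact K" by (simp add: compact_eq_bounded_closed)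
  moreover have "K \<noteq> {}" using normalised[OF W(2,3)] by blast
  ultimately obtain w where w: "w \<in> K" and wmax: "\<And>z. z \<in> K \<Longrightarrow> ?q X z \<le> ?q X w"
    using continuous_attains_sup[OF _ _ quadratic_form_continuous[of _ X]] by metis
  let ?l = "?q X w"
  have le: "?q X z \<le> ?l * ?q Y z" if "z \<in> W" for z
  proof (cases "z = 0")
    case False
    have "?q X ((1 / sqrt (?q Y z)) *\<^sub>R z) \<le> ?l" by (rule wmax[OF normalised[OF that False]])
    then show ?thesis using Ypos[OF False] by (simp only: scale) (simp add: power_divide field_simps)
  qed simp
  have "u \<bullet> (X *v w) = ?l * (u \<bullet> (Y *v w))" if "u \<in> W" for u
  proof -
    have expand: "?q A (w + t *\<^sub>R u) = ?q A w + 2 * t * (u \<bullet> (A *v w)) + t\<^sup>2 * ?q A u"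
      if "transpose A = A" for A t
      using inner_symmetric_matrix[OF that, of w u]
      by (simp add: matrix_vector_right_distrib matrix_vector_mult_scaleR inner_add_left
          inner_add_right power2_eq_square algebra_simps)
    have "?l * (u \<bullet> (Y *v w)) - u \<bullet> (X *v w) = 0"
    proof (rule linear_coefficient_eq_0[where a = "?l * ?q Y u - ?q X u"])
      fix t
      have "w + t *\<^sub>R u \<in> W"
        using w that W(1) by (auto simp: K_def intro: subspace_add subspace_scale)
      from le[OF this] show "0 \<le> 2 * t * (?l * (u \<bullet> (Y *v w)) - u \<bullet> (X *v w)) + t\<^sup>2 * (?l * ?q Y u - ?q X u)"
        using w by (simp only: expand[OF X] expand[OF Ysym]) (simp add: K_def algebra_simps)
    qed
    then show ?thesis by simp
  qed
  moreover have "w \<in> W" "?q Y w = 1" using w by (auto simp: K_def)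
  ultimately show thesis using that by blast
qed

text \<open>The eigenvectors are found one at a time: the next one lies in the \<open>Y\<close>-orthogonal complement of the
  earlier ones, which is nontrivial as long as an index is left.\<close>

lemma generalised_eigenvectors:
  fixes X Y :: "real^'n^'n" and K :: "'n set"
  assumes Y: "pos_def Y" and X: "transpose X = X"
  shows "\<exists>v l. \<forall>i\<in>K. X *v v i = l i *\<^sub>R (Y *v v i) \<and>
    (\<forall>j\<in>K. v i \<bullet> (Y *v v j) = (if i = j then 1 else 0))"
proof -
  have Ysym: "transpose Y = Y" using Y by (simp add: pos_def_def)
  have "finite K" by simp
  then show ?thesis
  proof (induction K)
    case (insert k K)
    then obtain v l where vX: "\<And>i. i \<in> K \<Longrightarrow> X *v v i = l i *\<^sub>R (Y *v v i)"
      and vY: "\<And>i j. i \<in> K \<Longrightarrow> j \<in> K \<Longrightarrow> v i \<bullet> (Y *v v j) = (if i = j then 1 else 0)"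
      by blast
    define W where "W = {w. \<forall>i\<in>K. v i \<bullet> (Y *v w) = 0}"
    have "subspace W"
      by (auto simp: W_def subspace_def matrix_vector_right_distrib matrix_vector_mult_scaleR inner_add_right)
    moreover
    have "dim ((\<lambda>i. Y *v v i) ` K) < DIM(real^'n)"
    proof -
      have "dim ((\<lambda>i. Y *v v i) ` K) \<le> card ((\<lambda>i. Y *v v i) ` K)"
        by (simp add: dim_le_card')
      also have "\<dots> \<le> card K" by (rule card_image_le) simp
      also have "\<dots> < CARD('n)" using insert(2) by (intro psubset_card_mono) auto
      finally show ?thesis by simp
    qed
    then obtain z where z: "z \<noteq> 0" "\<And>y. y \<in> span ((\<lambda>i. Y *v v i) ` K) \<Longrightarrow> orthogonal z y"
      using orthogonal_to_subspace_exists by blast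
    have "v i \<bullet> (Y *v z) = 0" if "i \<in> K" for i
    proof -
      have "orthogonal z (Y *v v i)" using that by (intro z(2) span_base) simp
      then show ?thesis by (simp add: orthogonal_def inner_symmetric_matrix[OF Ysym, of "v i"])
    qed
    then have "z \<in> W" by (simp add: W_def)
    ultimately obtain w \<mu> where w: "w \<in> W" "w \<bullet> (Y *v w) = 1"
      and weig: "\<And>u. u \<in> W \<Longrightarrow> u \<bullet> (X *v w) = \<mu> * (u \<bullet> (Y *v w))"
      using generalised_eigenvector_on_subspace[OF Y X] z(1) by blast
    have vw: "v i \<bullet> (Y *v w) = 0" "w \<bullet> (Y *v v i) = 0" if "i \<in> K" for i
      using w(1) that inner_symmetric_matrix[OF Ysym, of "v i" w] by (auto simp: W_def)
    have "X *v w = \<mu> *\<^sub>R (Y *v w)"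
    proof (rule vector_eq_rdot[THEN iffD1], rule allI)
      fix u
      \<comment> \<open>The component of \<open>u\<close> along the earlier eigenvectors pairs to \<open>0\<close> with both sides.\<close>
      define u' where "u' = u - (\<Sum>i\<in>K. (v i \<bullet> (Y *v u)) *\<^sub>R v i)"
      have "v j \<bullet> (Y *v u') = 0" if "j \<in> K" for j
      proof -
        have "v j \<bullet> (Y *v u') = v j \<bullet> (Y *v u) - (\<Sum>i\<in>K. (v i \<bullet> (Y *v u)) * (v j \<bullet> (Y *v v i)))"
          by (simp add: u'_def matrix_vector_mult_diff_distrib inner_diff_right inner_sum_right
              matrix_vector_mult_scaleR linear_sum[OF matrix_vector_mul_linear])
        also have "(\<Sum>i\<in>K. (v i \<bullet> (Y *v u)) * (v j \<bullet> (Y *v v i))) = (\<Sum>i\<in>K. if i = j then v j \<bullet> (Y *v u) else 0)"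
          using that by (intro sum.cong) (auto simp: vY)
        finally show ?thesis using that insert(1) by simp
      qed
      then have "u' \<in> W" by (simp add: W_def)
      then have "u' \<bullet> (X *v w) = \<mu> * (u' \<bullet> (Y *v w))" by (rule weig)
      moreover have "v i \<bullet> (X *v w) = 0" if "i \<in> K" for i
        using vX[OF that] vw[OF that] inner_symmetric_matrix[OF X, of "v i" w] by simp
      moreover have "u' \<bullet> z = u \<bullet> z - (\<Sum>i\<in>K. (v i \<bullet> (Y *v u)) * (v i \<bullet> z))" for z
        by (simp add: u'_def inner_diff_left inner_sum_left)
      ultimately have "u \<bullet> (X *v w) = \<mu> * (u \<bullet> (Y *v w))"
        by (simp add: vw)
      then show "(X *v w) \<bullet> u = (\<mu> *\<^sub>R (Y *v w)) \<bullet> u"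
        by (simp add: inner_commute)
    qed
    moreover have "i \<noteq> k" "k \<noteq> i" if "i \<in> K" for i using insert(2) that by auto
    ultimately show ?case
      by (intro exI[of _ "v(k := w)"] exI[of _ "l(k := \<mu>)"]) (simp add: vX vY vw w(2))
  qed simp
qed

definition diag :: "('n \<Rightarrow> real) \<Rightarrow> real^'n^'n" where
  "diag l = (\<chi> i j. if i = j then l i else 0)"

lemma congruence_entry:
  fixes A P :: "real^'n^'n"
  shows "(transpose P ** A ** P) $ i $ j = column i P \<bullet> (A *v column j P)"
proof -
  have "(transpose P ** (A ** P)) $ i $ j = (\<Sum>k\<in>UNIV. P $ k $ i * (A ** P) $ k $ j)"
    by (simp add: matrix_matrix_mult_def transpose_def)
  also have "\<dots> = column i P \<bullet> (A *v column j P)"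
    by (simp add: inner_vec_def column_def matrix_vector_mult_def matrix_matrix_mult_def)
  finally show ?thesis by (simp add: matrix_mul_assoc)
qed

lemma diag_mult: "diag a ** diag b = diag (\<lambda>i. a i * b i)"
proof -
  have "(\<Sum>k\<in>UNIV. (if i = k then a i else 0) * (if k = j then b k else 0))
      = (\<Sum>k\<in>UNIV. if k = i then (if i = j then a i * b i else 0) else 0)" for i j
    by (rule sum.cong) auto
  then show ?thesis by (simp add: diag_def matrix_matrix_mult_def vec_eq_iff)
qed

lemma diag_const_1: "diag (\<lambda>_. 1) = mat 1"
  by (simp add: diag_def mat_def)

lemma transpose_diag: "transpose (diag l) = diag l"
  by (simp add: diag_def transpose_def vec_eq_iff)

lemma trace_diag: "trace (diag l) = (\<Sum>i\<in>UNIV. l i)"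
  unfolding diag_def trace_def by simp

lemma det_diag: "det (diag l) = (\<Prod>i\<in>UNIV. l i)"
  using det_diagonal[of "diag l"] by (simp add: diag_def)

lemma matrix_inv_eqI:
  fixes A B :: "real^'n^'n"
  assumes "A ** B = mat 1"
  shows "matrix_inv A = B"
proof -
  have BA: "B ** A = mat 1" using assms matrix_left_right_inverse by blast
  then have "\<exists>A'. A ** A' = mat 1 \<and> A' ** A = mat 1" using assms by blast
  then have "matrix_inv A ** A = mat 1" unfolding matrix_inv_def by (rule someI2_ex) simp
  then have "matrix_inv A ** (A ** B) = B" by (simp add: matrix_mul_assoc)
  then show ?thesis by (simp add: assms)
qed

text \<open>All matrices of a pencil are congruent, through one and the same \<open>Z\<close>, to diagonal matrices. Sums, inverses,
  determinants and traces can then be read off the diagonals.\<close>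

definition congruent_diag :: "real^'n^'n \<Rightarrow> ('n \<Rightarrow> real) \<Rightarrow> real^'n^'n" where
  "congruent_diag Z a = transpose Z ** diag a ** Z"

lemma simultaneous_diagonalisation:
  fixes X Y :: "real^'n^'n"
  assumes "pos_def Y" and "transpose X = X"
  obtains P Z :: "real^'n^'n" and l where "P ** Z = mat 1"
    "Y = congruent_diag Z (\<lambda>_. 1)" "X = congruent_diag Z l"
proof -
  obtain v and l :: "'n \<Rightarrow> real" where vX: "\<And>i. X *v v i = l i *\<^sub>R (Y *v v i)"
    and vY: "\<And>i j. v i \<bullet> (Y *v v j) = (if i = j then 1 else 0)"
    using generalised_eigenvectors[OF assms, of UNIV] by (metis UNIV_I)
  define P :: "real^'n^'n" where "P = (\<chi> i j. v j $ i)"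
  define Z where "Z = transpose P ** Y"
  have col: "column j P = v j" for j by (simp add: P_def column_def vec_eq_iff)
  have PYP: "transpose P ** Y ** P = diag (\<lambda>_. 1)"
    by (simp only: vec_eq_iff congruence_entry col) (simp add: vY diag_def)
  have PXP: "transpose P ** X ** P = diag l"
    by (simp only: vec_eq_iff congruence_entry col) (simp add: vX vY diag_def)
  have "Z ** P = mat 1" using PYP by (simp add: Z_def diag_const_1)
  then have PZ: "P ** Z = mat 1" using matrix_left_right_inverse by blast
  then have ZP: "transpose Z ** transpose P = mat 1"
    by (metis matrix_transpose_mul transpose_mat)
  have "A = congruent_diag Z a" if "transpose P ** A ** P = diag a" for A a
  proof -
    have "congruent_diag Z a = (transpose Z ** transpose P) ** A ** (P ** Z)"
      unfolding congruent_diag_def that[symmetric] by (simp add: matrix_mul_assoc)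
    then show ?thesis by (simp add: PZ ZP)
  qed
  with PYP PXP PZ show thesis using that by blast
qed

section \<open>The contrast function in the generalised eigenvalues\<close>

lemma diag_vector_mult: "(diag a *v y) $ i = a i * y $ i"
proof -
  have "(\<Sum>j\<in>UNIV. (if i = j then a i else 0) * y $ j) = (\<Sum>j\<in>UNIV. if j = i then a i * y $ i else 0)"
    by (rule sum.cong) auto
  then show ?thesis by (simp add: matrix_vector_mult_def diag_def)
qed

lemma inner_transpose_matrix:
  fixes A :: "real^'n^'m"
  shows "x \<bullet> (transpose A *v y) = (A *v x) \<bullet> y"
  by (metis dot_lmul_matrix vector_transpose_matrix)

lemma congruent_diag_entry:
  "congruent_diag Z a $ i $ j = (\<Sum>k\<in>UNIV. a k * (Z $ k $ i * Z $ k $ j))"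
proof -
  have "(transpose Z ** diag a) $ i $ k = Z $ k $ i * a k" for k
  proof -
    have "(\<Sum>r\<in>UNIV. Z $ r $ i * (if r = k then a r else 0)) = (\<Sum>r\<in>UNIV. if r = k then Z $ r $ i * a r else 0)"
      by (rule sum.cong) auto
    then show ?thesis by (simp add: matrix_matrix_mult_def transpose_def diag_def)
  qed
  then show ?thesis
    by (simp add: congruent_diag_def matrix_matrix_mult_def[of "transpose Z ** diag a"] mult_ac)
qed

lemma congruent_diag_add:
  "congruent_diag Z a + congruent_diag Z b = congruent_diag Z (\<lambda>i. a i + b i)"
  by (simp add: vec_eq_iff congruent_diag_entry sum.distrib algebra_simps)

lemma congruent_diag_scaleR: "s *\<^sub>R congruent_diag Z a = congruent_diag Z (\<lambda>i. s * a i)"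
  by (simp add: vec_eq_iff congruent_diag_entry sum_distrib_left algebra_simps)

lemma congruent_diag_diff:
  "congruent_diag Z a - congruent_diag Z b = congruent_diag Z (\<lambda>i. a i - b i)"
  using congruent_diag_add[of Z "\<lambda>i. a i - b i" b] by (simp add: algebra_simps)

lemma transpose_congruent_diag: "transpose (congruent_diag Z a) = congruent_diag Z a"
  by (simp add: congruent_diag_def matrix_transpose_mul transpose_diag matrix_mul_assoc)

lemma det_congruent_diag: "det (congruent_diag Z a) = (det Z)\<^sup>2 * (\<Prod>i\<in>UNIV. a i)"
  by (simp add: congruent_diag_def det_mul det_diag power2_eq_square)

context
  fixes P Z :: "real^'n^'n"
  assumes PZ: "P ** Z = mat 1"
begin

lemma det_Z_nonzero: "det Z \<noteq> 0"
proof -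
  have "det P * det Z = 1" using PZ by (metis det_I det_mul)
  then show ?thesis by auto
qed

lemma congruence_inverse: "Z ** P = mat 1"
  using PZ matrix_left_right_inverse by blast

lemma transpose_Z_P: "transpose Z ** transpose P = mat 1" "transpose P ** transpose Z = mat 1"
  using PZ congruence_inverse by (metis matrix_transpose_mul transpose_mat)+

lemma congruent_diag_mult:
  "congruent_diag Z a ** (P ** diag b ** transpose P) = transpose Z ** diag (\<lambda>i. a i * b i) ** transpose P"
proof -
  have "congruent_diag Z a ** (P ** diag b ** transpose P)
      = transpose Z ** (diag a ** (Z ** P) ** diag b) ** transpose P"
    by (simp add: congruent_diag_def matrix_mul_assoc)
  then show ?thesis by (simp add: congruence_inverse diag_mult)
qed

lemma matrix_inv_congruent_diag:
  assumes "\<And>i. a i \<noteq> 0"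
  shows "matrix_inv (congruent_diag Z a) = P ** diag (\<lambda>i. 1 / a i) ** transpose P"
  by (rule matrix_inv_eqI)
     (simp add: congruent_diag_mult assms diag_const_1 transpose_Z_P)

lemma trace_transpose_Z_P: "trace (transpose Z ** diag a ** transpose P) = (\<Sum>i\<in>UNIV. a i)"
proof -
  have "trace (transpose Z ** diag a ** transpose P) = trace (transpose P ** (transpose Z ** diag a))"
    by (rule trace_mul_sym)
  then show ?thesis by (simp add: matrix_mul_assoc transpose_Z_P trace_diag)
qed

lemma pos_def_congruent_diag_iff: "pos_def (congruent_diag Z a) \<longleftrightarrow> (\<forall>i. 0 < a i)"
proof -
  have q: "x \<bullet> (congruent_diag Z a *v x) = (\<Sum>i\<in>UNIV. a i * ((Z *v x) $ i)\<^sup>2)" for x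
  proof -
    have "x \<bullet> (congruent_diag Z a *v x) = (Z *v x) \<bullet> (diag a *v (Z *v x))"
      unfolding congruent_diag_def matrix_vector_mul_assoc[symmetric] by (rule inner_transpose_matrix)
    also have "\<dots> = (\<Sum>i\<in>UNIV. a i * ((Z *v x) $ i)\<^sup>2)"
      by (simp add: inner_vec_def diag_vector_mult power2_eq_square mult_ac)
    finally show ?thesis .
  qed
  show ?thesis
  proof
    assume A: "pos_def (congruent_diag Z a)"
    show "\<forall>i. 0 < a i"
    proof
      fix i
      have Zx: "Z *v (P *v axis i 1) = axis i 1"
        by (simp add: matrix_vector_mul_assoc congruence_inverse)
      then have "P *v axis i 1 \<noteq> 0" by (metis axis_eq_0_iff matrix_vector_mult_0_right zero_neq_one)
      then have "0 < (P *v axis i 1) \<bullet> (congruent_diag Z a *v (P *v axis i 1))"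
        using A unfolding pos_def_def by blast
      also have "\<dots> = (\<Sum>j\<in>UNIV. a j * ((axis i 1 :: real^'n) $ j)\<^sup>2)"
        unfolding q Zx ..
      also have "(\<Sum>j\<in>UNIV. a j * ((axis i 1 :: real^'n) $ j)\<^sup>2) = (\<Sum>j\<in>UNIV. if j = i then a j else 0)"
        by (rule sum.cong) (auto simp: axis_def)
      finally show "0 < a i" by simp
    qed
  next
    assume a: "\<forall>i. 0 < a i"
    have "0 < x \<bullet> (congruent_diag Z a *v x)" if "x \<noteq> 0" for x
    proof -
      have "P *v (Z *v x) = x" by (simp add: matrix_vector_mul_assoc PZ)
      then have "Z *v x \<noteq> 0" using that by (metis matrix_vector_mult_0_right)
      then obtain i where "(Z *v x) $ i \<noteq> 0" by (metis vec_eq_iff zero_index)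
      then have "0 < a i * ((Z *v x) $ i)\<^sup>2" using a by simp
      also have "\<dots> \<le> (\<Sum>i\<in>UNIV. a i * ((Z *v x) $ i)\<^sup>2)"
        using a by (intro member_le_sum) (auto simp: less_imp_le)
      finally show ?thesis by (simp add: q)
    qed
    then show "pos_def (congruent_diag Z a)" by (simp add: pos_def_def transpose_congruent_diag)
  qed
qed

text \<open>\<open>F\<close> is a sum of values of the nonnegative function \<open>\<lambda>l. l - 1 - ln l\<close>, whose only zero is \<open>1\<close>.\<close>

lemma F_fun_congruent_diag:
  assumes "\<And>i. 0 < l i"
  shows "F_fun (congruent_diag Z l) (congruent_diag Z (\<lambda>_. 1)) = (\<Sum>i\<in>UNIV. l i - 1 - ln (l i))"
proof -
  have "l i \<noteq> 0" for i using assms[of i] by simp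
  then have "ln (\<Prod>i\<in>UNIV. l i) = (\<Sum>i\<in>UNIV. ln (l i))"
    by (intro ln_prod) simp_all
  then have "ln ((det Z)\<^sup>2 * (\<Prod>i\<in>UNIV. l i)) = ln ((det Z)\<^sup>2) + (\<Sum>i\<in>UNIV. ln (l i))"
    using det_Z_nonzero assms by (subst ln_mult_pos) (auto simp: prod_pos)
  moreover have "trace (matrix_inv (congruent_diag Z (\<lambda>_. 1)) ** congruent_diag Z l) = (\<Sum>i\<in>UNIV. l i)"
    by (subst trace_mul_sym)
       (simp add: matrix_inv_congruent_diag congruent_diag_mult trace_transpose_Z_P)
  ultimately show ?thesis
    by (simp add: F_fun_def det_congruent_diag sum_subtractf)
qed

end

lemma pos_def_pencil:
  fixes X Y :: "real^'n^'n"
  assumes "pos_def X" and "pos_def Y"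
  obtains P Z :: "real^'n^'n" and l where "P ** Z = mat 1" "\<And>i. 0 < l i"
    "X = congruent_diag Z l" "Y = congruent_diag Z (\<lambda>_. 1)"
proof -
  have "transpose X = X" using assms(1) by (simp add: pos_def_def)
  then obtain P Z :: "real^'n^'n" and l where *: "P ** Z = mat 1"
    "Y = congruent_diag Z (\<lambda>_. 1)" "X = congruent_diag Z l"
    using simultaneous_diagonalisation[OF assms(2)] by blast
  then have "\<forall>i. 0 < l i" using pos_def_congruent_diag_iff[OF *(1)] assms(1) by simp
  with * that show thesis by blast
qed

lemma pos_def_det_pos:
  assumes "pos_def X"
  shows "0 < det X"
  using assms
proof (rule pos_def_pencil[OF _ assms])
  fix P Z and l :: "'a \<Rightarrow> real"
  assume "P ** Z = mat 1" "\<And>i. 0 < l i" "X = congruent_diag Z l"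
  then show ?thesis by (simp add: det_congruent_diag det_Z_nonzero prod_pos)
qed

lemma pos_def_invertible: "pos_def X \<Longrightarrow> invertible X"
  using pos_def_det_pos[of X] by (auto simp: invertible_det_nz)

lemma ln_le_minus_one_pos: "0 < l \<Longrightarrow> 0 \<le> l - 1 - ln l" for l :: real
  using ln_le_minus_one[of l] by simp

lemma F_fun_nonneg:
  assumes "pos_def X" and "pos_def Y"
  shows "0 \<le> F_fun X Y"
  by (rule pos_def_pencil[OF assms])
     (simp only: F_fun_congruent_diag, intro sum_nonneg ln_le_minus_one_pos)

lemma F_fun_pos:
  assumes "pos_def X" and "pos_def Y" and "X \<noteq> Y"
  shows "0 < F_fun X Y"
proof (rule pos_def_pencil[OF assms(1,2)])
  fix P Z :: "real^'a^'a" and l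
  assume *: "P ** Z = mat 1" "\<And>i. 0 < l i" "X = congruent_diag Z l" "Y = congruent_diag Z (\<lambda>_. 1)"
  have "l \<noteq> (\<lambda>_. 1)" using * assms(3) by auto
  then obtain i where "l i \<noteq> 1" by auto
  then have "l i - 1 - ln (l i) \<noteq> 0" using ln_eq_minus_one[of "l i"] *(2)[of i] by auto
  then have "0 < l i - 1 - ln (l i)" using ln_le_minus_one_pos[OF *(2)[of i]] by simp
  also have "\<dots> \<le> (\<Sum>i\<in>UNIV. l i - 1 - ln (l i))"
    using *(2) by (intro member_le_sum ln_le_minus_one_pos) auto
  finally show ?thesis using * by (simp add: F_fun_congruent_diag)
qed

text \<open>Since \<open>ln (l / 2) \<le> l / 2 - 1\<close>, the contrast controls the trace from above. This is what makes the
  perturbation estimate below uniform in \<open>Y\<close>.\<close>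

lemma trace_le_F_fun:
  fixes X Y :: "real^'n^'n"
  assumes "pos_def X" and "pos_def Y"
  shows "trace (matrix_inv Y ** X) \<le> 2 * (F_fun X Y + real CARD('n) * ln 2)"
proof (rule pos_def_pencil[OF assms])
  fix P Z :: "real^'n^'n" and l
  assume *: "P ** Z = mat 1" "\<And>i. 0 < l i" "X = congruent_diag Z l" "Y = congruent_diag Z (\<lambda>_. 1)"
  have "trace (matrix_inv Y ** X) = (\<Sum>i\<in>UNIV. l i)"
    using * by (subst trace_mul_sym)
      (simp add: matrix_inv_congruent_diag congruent_diag_mult trace_transpose_Z_P)
  also have "\<dots> \<le> (\<Sum>i\<in>UNIV. 2 * (l i - 1 - ln (l i) + ln 2))"
  proof (rule sum_mono)
    fix i
    show "l i \<le> 2 * (l i - 1 - ln (l i) + ln 2)"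
      using ln_le_minus_one[of "l i / 2"] *(2)[of i] by (simp add: ln_div)
  qed
  also have "\<dots> = 2 * (F_fun X Y + real CARD('n) * ln 2)"
    unfolding sum_distrib_left[symmetric] sum.distrib using * by (simp add: F_fun_congruent_diag)
  finally show ?thesis .
qed

lemma trace_matrix_inv_mono:
  fixes A B Y :: "real^'n^'n"
  assumes "pos_def Y" and AB: "\<And>x. x \<bullet> (A *v x) \<le> x \<bullet> (B *v x)"
  shows "trace (matrix_inv Y ** A) \<le> trace (matrix_inv Y ** B)"
proof (rule pos_def_pencil[OF assms(1,1)])
  fix P Z :: "real^'n^'n" and l
  assume *: "P ** Z = mat 1" "Y = congruent_diag Z (\<lambda>_. 1)"
  have "trace (matrix_inv Y ** C) = (\<Sum>i\<in>UNIV. column i P \<bullet> (C *v column i P))" for C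
  proof -
    have "matrix_inv Y = P ** transpose P"
      using * by (simp add: matrix_inv_congruent_diag diag_const_1)
    then have "trace (matrix_inv Y ** C) = trace (P ** (transpose P ** C))"
      by (simp add: matrix_mul_assoc)
    also have "\<dots> = trace (transpose P ** C ** P)" by (rule trace_mul_sym)
    also have "\<dots> = (\<Sum>i\<in>UNIV. column i P \<bullet> (C *v column i P))"
      unfolding trace_def congruence_entry ..
    finally show ?thesis .
  qed
  then show ?thesis by (simp add: sum_mono AB)
qed

lemma one_plus_scaled_pos:
  fixes s \<mu> :: real
  assumes "0 \<le> s" "s \<le> 1" "-1 < \<mu>"
  shows "0 < 1 + s * \<mu>"
proof -
  have "1 + s * \<mu> = (1 - s) + s * (1 + \<mu>)" by (simp add: algebra_simps)
  also have "0 < (1 - s) + s * (1 + \<mu>)"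
  proof (cases "s = 1")
    case False
    then show ?thesis using assms by (intro add_pos_nonneg) auto
  qed (use assms in simp)
  finally show ?thesis .
qed

lemma unit_products:
  fixes s t :: real
  assumes "s \<in> {0..1}" "t \<in> {0..1}"
  shows "0 \<le> s * t" "s * t \<le> 1"
  using assms by (auto intro: mult_le_one)

lemma taylor_remainder_inner:
  fixes s \<mu> :: real
  assumes "-1 < \<mu>" "s \<in> {0..1}"
  shows "((\<lambda>r. s * (\<mu> / (1 + r * s * \<mu>))\<^sup>2) has_integral (\<mu> - \<mu> / (1 + s * \<mu>))) {0..1}"
proof -
  have "((\<lambda>r. s * (\<mu> / (1 + r * s * \<mu>))\<^sup>2) has_integral
      (- \<mu> / (1 + 1 * s * \<mu>)) - (- \<mu> / (1 + 0 * s * \<mu>))) {0..1}"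
  proof (rule fundamental_theorem_of_calculus)
    fix r :: real assume "r \<in> {0..1}"
    then have "1 + r * s * \<mu> \<noteq> 0"
      using one_plus_scaled_pos[OF unit_products assms(1)] assms(2) by force
    then show "((\<lambda>r. - \<mu> / (1 + r * s * \<mu>)) has_vector_derivative s * (\<mu> / (1 + r * s * \<mu>))\<^sup>2)
        (at r within {0..1})"
      unfolding has_real_derivative_iff_has_vector_derivative[symmetric]
      by (auto intro!: derivative_eq_intros simp: power2_eq_square)
  qed simp
  then show ?thesis by simp
qed

lemma taylor_remainder_outer:
  fixes \<mu> :: real
  assumes "-1 < \<mu>"
  shows "((\<lambda>s. \<mu> - \<mu> / (1 + s * \<mu>)) has_integral (\<mu> - ln (1 + \<mu>))) {0..1}"
proof -
  have "((\<lambda>s. \<mu> - \<mu> / (1 + s * \<mu>)) has_integral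
      (\<mu> * 1 - ln (1 + 1 * \<mu>)) - (\<mu> * 0 - ln (1 + 0 * \<mu>))) {0..1}"
  proof (rule fundamental_theorem_of_calculus)
    fix s :: real assume "s \<in> {0..1}"
    then have "0 < 1 + s * \<mu>" using one_plus_scaled_pos[of s \<mu>] assms by simp
    then show "((\<lambda>s. \<mu> * s - ln (1 + s * \<mu>)) has_vector_derivative \<mu> - \<mu> / (1 + s * \<mu>)) (at s within {0..1})"
      unfolding has_real_derivative_iff_has_vector_derivative[symmetric]
      by (auto intro!: derivative_eq_intros simp: field_simps)
  qed simp
  then show ?thesis by simp
qed

lemma kronecker_quadratic_form:
  fixes A B D :: "real^'n^'n"
  shows "vec_mat D \<bullet> (kronecker A B *v vec_mat D) = trace (transpose D ** B ** D ** transpose A)"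
proof -
  have rotate: "(\<Sum>j\<in>UNIV. \<Sum>k\<in>UNIV. \<Sum>l\<in>UNIV. f j k l) = (\<Sum>k\<in>UNIV. \<Sum>l\<in>UNIV. \<Sum>j\<in>UNIV. f j k l)"
    for f :: "'n \<Rightarrow> 'n \<Rightarrow> 'n \<Rightarrow> real"
    by (subst sum.swap, rule sum.cong[OF refl], rule sum.swap)
  have "vec_mat D \<bullet> (kronecker A B *v vec_mat D)
      = (\<Sum>p\<in>UNIV \<times> UNIV. \<Sum>q\<in>UNIV \<times> UNIV.
          D $ snd p $ fst p * (A $ fst p $ fst q * B $ snd p $ snd q * D $ snd q $ fst q))"
    by (simp add: inner_vec_def vec_mat_def kronecker_def matrix_vector_mult_def sum_distrib_left)
  also have "\<dots> = (\<Sum>i\<in>UNIV. \<Sum>j\<in>UNIV. \<Sum>k\<in>UNIV. \<Sum>l\<in>UNIV. D $ j $ i * (A $ i $ k * B $ j $ l * D $ l $ k))"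
    unfolding sum.cartesian_product' by simp
  also have "\<dots> = (\<Sum>i\<in>UNIV. \<Sum>k\<in>UNIV. \<Sum>l\<in>UNIV. \<Sum>j\<in>UNIV. D $ j $ i * B $ j $ l * D $ l $ k * A $ i $ k)"
    by (rule sum.cong[OF refl], subst rotate) (simp add: mult_ac)
  also have "\<dots> = trace (transpose D ** B ** D ** transpose A)"
    by (simp add: trace_def matrix_matrix_mult_def transpose_def sum_distrib_right)
  finally show ?thesis .
qed

lemma vech_diff:
  fixes X Y :: "real^'n^'n"
  assumes "transpose X = X" "transpose Y = Y"
  shows "vech X - vech Y = vech (X - Y)"
proof -
  have "transpose (X - Y) = X - Y"
    using assms by (simp add: vec_eq_iff transpose_def)
  then have "(vech X - vech Y) $ Upair i j = vech (X - Y) $ Upair i j" for i j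
    using assms by (simp add: vech_Upair)
  moreover have "\<exists>i j. u = Upair i j" for u :: "'n uprod" by (cases u) auto
  ultimately show ?thesis unfolding vec_eq_iff by metis
qed

text \<open>The Kronecker form is \<open>trace (D ** N ** D ** N)\<close>. Here \<open>D ** N\<close> is similar to a diagonal matrix, because the
  factors \<open>Z\<close> and \<open>P\<close> between the diagonals cancel.\<close>

lemma pencil_quadratic_form:
  fixes P Z :: "real^'n^'n" and l c :: "'n \<Rightarrow> real"
  assumes PZ: "P ** Z = mat 1"
  defines "D \<equiv> congruent_diag Z (\<lambda>i. l i - 1)" and "N \<equiv> P ** diag c ** transpose P"
  shows "vec_mat D \<bullet> (kronecker N N *v vec_mat D) = (\<Sum>i\<in>UNIV. ((l i - 1) * c i)\<^sup>2)"
proof -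
  define m where "m = (\<lambda>i. (l i - 1) * c i)"
  have "transpose N = N"
    by (simp add: N_def matrix_transpose_mul transpose_diag matrix_mul_assoc)
  moreover have "transpose D = D" by (simp add: D_def transpose_congruent_diag)
  ultimately have *: "transpose D ** N ** D ** transpose N = (D ** N) ** (D ** N)"
    by (simp add: matrix_mul_assoc)
  have DN: "D ** N = transpose Z ** diag m ** transpose P"
    unfolding D_def N_def m_def by (rule congruent_diag_mult[OF PZ])
  have "vec_mat D \<bullet> (kronecker N N *v vec_mat D) = trace ((D ** N) ** (D ** N))"
    unfolding kronecker_quadratic_form * ..
  also have "(D ** N) ** (D ** N) = transpose Z ** (diag m ** (transpose P ** transpose Z) ** diag m) ** transpose P"
    by (simp add: DN matrix_mul_assoc)
  also have "\<dots> = transpose Z ** diag (\<lambda>i. m i * m i) ** transpose P"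
    by (simp add: transpose_Z_P[OF PZ] diag_mult)
  also have "trace \<dots> = (\<Sum>i\<in>UNIV. m i * m i)" by (rule trace_transpose_Z_P[OF PZ])
  finally show ?thesis by (simp add: m_def power2_eq_square)
qed

lemma P_diag_P_entry:
  fixes P :: "real^'n^'n"
  shows "(P ** diag c ** transpose P) $ i $ j = (\<Sum>k\<in>UNIV. c k * (P $ i $ k * P $ j $ k))"
proof -
  have "P ** diag c ** transpose P = congruent_diag (transpose P) c"
    by (simp add: congruent_diag_def)
  then show ?thesis by (simp only: congruent_diag_entry) (simp add: transpose_def)
qed

text \<open>With \<open>\<mu> i = l i - 1\<close>, the integrand of the quadratic form at \<open>Y + s (X - Y)\<close> is
  \<open>\<Sum>i. (\<mu> i / (1 + s * \<mu> i))\<^sup>2\<close>, the second derivative in \<open>s\<close> of \<open>\<Sum>i. s * \<mu> i - ln (1 + s * \<mu> i)\<close>.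
  The double integral is the integral form of the remainder in Taylor's formula of order one, and in each
  eigenvalue it evaluates to \<open>\<mu> i - ln (1 + \<mu> i)\<close>.\<close>

lemma contrast_eq_F_fun:
  fixes X Y :: "real^'n^'n"
  assumes X: "pos_def X" and Y: "pos_def Y"
  shows "contrast X Y = F_fun X Y"
proof (rule pos_def_pencil[OF X Y])
  fix P Z :: "real^'n^'n" and l
  assume PZ: "P ** Z = mat 1" and l: "\<And>i. 0 < l i"
    and XZ: "X = congruent_diag Z l" and YZ: "Y = congruent_diag Z (\<lambda>_. 1)"
  define D where "D = congruent_diag Z (\<lambda>i. l i - 1)"
  define v where "v = vec_mat D"
  have D: "X - Y = D" by (simp add: XZ YZ D_def congruent_diag_diff)
  have Dsym: "transpose D = D" by (simp add: D_def transpose_congruent_diag)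
  have pos: "0 < 1 + s * (l i - 1)" if "0 \<le> s" "s \<le> 1" for s i
    using one_plus_scaled_pos[OF that, of "l i - 1"] l[of i] by simp
  define N where "N s = P ** diag (\<lambda>i. 1 / (1 + s * (l i - 1))) ** transpose P" for s :: real
  have inv: "matrix_inv (Y + s *\<^sub>R (X - Y)) = N s" if "0 \<le> s" "s \<le> 1" for s
  proof -
    have "Y + s *\<^sub>R (X - Y) = congruent_diag Z (\<lambda>i. 1 + s * (l i - 1))"
      by (simp add: D) (simp add: YZ D_def congruent_diag_scaleR congruent_diag_add)
    moreover have "1 + s * (l i - 1) \<noteq> 0" for i using pos[OF that, of i] by simp
    ultimately show ?thesis using matrix_inv_congruent_diag[OF PZ] by (simp add: N_def)
  qed
  define g where "g s r = s *\<^sub>R kronecker (N (r * s)) (N (r * s))" for s r :: real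
  have cont: "continuous_on ({0..1} \<times> {0..1}) (\<lambda>(s, r). g s r)"
  proof -
    have "1 + r * s * (l i - 1) \<noteq> 0" if "s \<in> {0..1}" "r \<in> {0..1}" for r s i
      using pos[OF unit_products[OF that(2,1)], of i] by simp
    then show ?thesis
      unfolding g_def kronecker_def N_def P_diag_P_entry case_prod_beta
      by (intro continuous_intros) auto
  qed
  have V: "V_fun X Y = transpose duplication_matrix ** integral {0..1} (\<lambda>s. integral {0..1} (g s)) ** duplication_matrix"
  proof -
    have "integral {0..1} (\<lambda>s. integral {0..1} (\<lambda>r. s *\<^sub>R kronecker (matrix_inv (Y + (r * s) *\<^sub>R (X - Y)))
        (matrix_inv (Y + (r * s) *\<^sub>R (X - Y))))) = integral {0..1} (\<lambda>s. integral {0..1} (g s))"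
      by (intro integral_cong) (simp add: inv unit_products g_def)
    then show ?thesis unfolding V_fun_def by simp
  qed
  define \<phi> where "\<phi> K = v \<bullet> (K *v v)" for K :: "real^('n \<times> 'n)^('n \<times> 'n)"
  have \<phi>: "bounded_linear \<phi>"
    unfolding linear_conv_bounded_linear[symmetric] \<phi>_def
    by (rule linearI) (simp_all add: matrix_vector_mult_add_rdistrib inner_add_right
        scaleR_matrix_vector_assoc[symmetric])
  have gcont: "continuous_on {0..1} (g s)" if "s \<in> {0..1}" for s
    using continuous_on_compose2[OF cont, of "{0..1}" "\<lambda>r. (s, r)"] that
    by (force intro!: continuous_intros)
  have gint: "g s integrable_on {0..1}" if "s \<in> {0..1}" for s
    using gcont[OF that] by (rule integrable_continuous_real)
  have Gint: "(\<lambda>s. integral {0..1} (g s)) integrable_on {0..1}"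
    using integral_continuous_on_param[of "{0..1}" 0 1 g] cont
    by (intro integrable_continuous_real) simp
  have \<phi>g: "\<phi> (g s r) = (\<Sum>i\<in>UNIV. s * ((l i - 1) / (1 + r * s * (l i - 1)))\<^sup>2)" for s r
  proof -
    have "\<phi> (g s r) = s * (v \<bullet> (kronecker (N (r * s)) (N (r * s)) *v v))"
      by (simp add: \<phi>_def g_def scaleR_matrix_vector_assoc[symmetric])
    then show ?thesis
      unfolding v_def D_def N_def pencil_quadratic_form[OF PZ] by (simp add: sum_distrib_left)
  qed
  have inner: "\<phi> (integral {0..1} (g s)) = (\<Sum>i\<in>UNIV. (l i - 1) - (l i - 1) / (1 + s * (l i - 1)))"
    if "s \<in> {0..1}" for s
  proof -
    have "\<phi> (integral {0..1} (g s)) = integral {0..1} (\<lambda>r. \<phi> (g s r))"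
      using integral_linear[OF gint[OF that] \<phi>] by (simp add: o_def)
    also have "\<dots> = (\<Sum>i\<in>UNIV. (l i - 1) - (l i - 1) / (1 + s * (l i - 1)))"
      unfolding \<phi>g using l that
      by (intro integral_unique has_integral_sum taylor_remainder_inner) auto
    finally show ?thesis .
  qed
  have "\<phi> (integral {0..1} (\<lambda>s. integral {0..1} (g s))) = integral {0..1} (\<lambda>s. \<phi> (integral {0..1} (g s)))"
    using integral_linear[OF Gint \<phi>] by (simp add: o_def)
  also have "\<dots> = integral {0..1} (\<lambda>s. \<Sum>i\<in>UNIV. (l i - 1) - (l i - 1) / (1 + s * (l i - 1)))"
    by (intro integral_cong) (simp add: inner)
  also have "\<dots> = (\<Sum>i\<in>UNIV. (l i - 1) - ln (1 + (l i - 1)))"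
    using l by (intro integral_unique has_integral_sum taylor_remainder_outer) auto
  also have "\<dots> = F_fun X Y"
    unfolding XZ YZ F_fun_congruent_diag[OF PZ l] by simp
  finally have *: "\<phi> (integral {0..1} (\<lambda>s. integral {0..1} (g s))) = F_fun X Y" .
  have "vech X - vech Y = vech D"
    using X Y by (simp add: vech_diff D pos_def_def)
  moreover have "duplication_matrix *v vech D = v"
    by (simp add: v_def vec_mat_duplication[OF Dsym])
  moreover have "x \<bullet> ((transpose A ** K ** A) *v x) = (A *v x) \<bullet> (K *v (A *v x))"
    for x and A :: "real^'n uprod^('n \<times> 'n)" and K
    unfolding matrix_vector_mul_assoc[symmetric] by (rule inner_transpose_matrix)
  ultimately show ?thesis
    using pos_def_invertible[OF X] *
    by (simp add: contrast_def V_tilde_def V \<phi>_def del: transpose_matrix_vector)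
qed

section \<open>Stability under perturbation of the first argument\<close>

lemma continuous_det: "isCont (det :: real^'n^'n \<Rightarrow> real) A"
  unfolding det_def by (intro continuous_intros)

lemma eventually_quadratic_form_ge:
  fixes X :: "real^'n^'n"
  assumes X: "pos_def X" and d: "0 < d"
  shows "\<forall>\<^sub>F Q in nhds X. \<forall>x. (1 - d) * (x \<bullet> (X *v x)) \<le> x \<bullet> (Q *v x)"
proof -
  obtain c where c: "0 < c" "\<And>x. c * (x \<bullet> x) \<le> x \<bullet> (X *v x)"
    using pos_def_coercive[OF X] by blast
  have "((\<lambda>Q. \<Sum>i\<in>UNIV. \<Sum>j\<in>UNIV. \<bar>(Q - X) $ i $ j\<bar>) \<longlongrightarrow> (\<Sum>i\<in>UNIV. \<Sum>j\<in>UNIV. \<bar>(X - X) $ i $ j\<bar>)) (nhds X)"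
    by (intro tendsto_intros filterlim_ident)
  then have "((\<lambda>Q. \<Sum>i\<in>UNIV. \<Sum>j\<in>UNIV. \<bar>(Q - X) $ i $ j\<bar>) \<longlongrightarrow> 0) (nhds X)"
    by simp
  then have "\<forall>\<^sub>F Q in nhds X. (\<Sum>i\<in>UNIV. \<Sum>j\<in>UNIV. \<bar>(Q - X) $ i $ j\<bar>) < d * c"
    by (rule order_tendstoD) (use c d in simp)
  then show ?thesis
  proof eventually_elim
    case (elim Q)
    show ?case
    proof
      fix x
      have "norm ((Q - X) *v x) \<le> onorm ((*v) (Q - X)) * norm x"
        by (rule onorm) simp
      also have "\<dots> \<le> d * c * norm x"
        using onorm_le_matrix_component_sum[of "Q - X"] elim by (intro mult_right_mono) auto
      finally have "norm ((Q - X) *v x) \<le> d * c * norm x" .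
      then have "norm x * norm ((Q - X) *v x) \<le> norm x * (d * c * norm x)"
        by (rule mult_left_mono) simp
      also have "\<dots> = d * (c * (x \<bullet> x))" by (simp add: dot_square_norm power2_eq_square)
      finally have "\<bar>x \<bullet> ((Q - X) *v x)\<bar> \<le> d * (c * (x \<bullet> x))"
        using Cauchy_Schwarz_ineq2[of x "(Q - X) *v x"] by linarith
      also have "\<dots> \<le> d * (x \<bullet> (X *v x))" using c(2)[of x] d by simp
      finally show "(1 - d) * (x \<bullet> (X *v x)) \<le> x \<bullet> (Q *v x)"
        by (simp add: matrix_vector_mult_diff_rdistrib inner_diff_right algebra_simps)
    qed
  qed
qed

text \<open>If \<open>Q\<close> dominates \<open>(1 - d) X\<close>, then replacing \<open>X\<close> by \<open>Q\<close> lowers the contrast by at most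
  \<open>d * trace (matrix_inv Y ** X)\<close> plus a difference of logarithms that does not involve \<open>Y\<close>. Because the trace
  is itself controlled by the contrast, one neighbourhood of \<open>X\<close> serves all \<open>Y\<close>.\<close>

lemma F_fun_lower_bound_stable:
  fixes X :: "real^'n^'n"
  assumes X: "pos_def X" and u: "0 < u"
  shows "\<forall>\<^sub>F Q in nhds X. transpose Q = Q \<longrightarrow>
    pos_def Q \<and> (\<forall>Y. pos_def Y \<longrightarrow> u \<le> F_fun X Y \<longrightarrow> u / 4 \<le> F_fun Q Y)"
proof -
  define k where "k = real CARD('n) * ln 2"
  \<comment> \<open>Chosen so that \<open>(1 - 2 * d) * u - 2 * d * k = u / 2\<close>, which leaves \<open>u / 4\<close> for the logarithms.\<close>
  define d where "d = u / (4 * (u + k))"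
  have k: "0 \<le> k" by (simp add: k_def)
  have d: "0 < d" "d < 1 / 2" "2 * d * (u + k) = u / 2"
    using u k by (auto simp: d_def field_simps)
  have detX: "0 < det X" by (rule pos_def_det_pos[OF X])
  have "((\<lambda>Q. ln (det Q)) \<longlongrightarrow> ln (det X)) (nhds X)"
    using detX continuous_det[of X] by (intro tendsto_ln) (auto simp: isCont_def tendsto_at_iff_tendsto_nhds)
  then have "\<forall>\<^sub>F Q in nhds X. ln (det Q) < ln (det X) + u / 4"
    by (rule order_tendstoD) (use u in simp)
  moreover note eventually_quadratic_form_ge[OF X d(1)]
  ultimately show ?thesis
  proof eventually_elim
    case (elim Q)
    show ?case
    proof (intro impI conjI allI)
      assume Qsym: "transpose Q = Q"
      show "pos_def Q"
        unfolding pos_def_def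
      proof (intro conjI allI impI Qsym)
        fix x :: "real^'n" assume "x \<noteq> 0"
        then have "0 < (1 - d) * (x \<bullet> (X *v x))" using X d by (simp add: pos_def_def)
        also have "\<dots> \<le> x \<bullet> (Q *v x)" using elim by blast
        finally show "0 < x \<bullet> (Q *v x)" .
      qed
      fix Y assume Y: "pos_def Y" and uF: "u \<le> F_fun X Y"
      let ?t = "trace (matrix_inv Y ** X)"
      have "(1 - d) * ?t = trace (matrix_inv Y ** ((1 - d) *\<^sub>R X))"
        by (simp add: trace_def matrix_matrix_mult_def sum_distrib_left mult_ac)
      also have "\<dots> \<le> trace (matrix_inv Y ** Q)"
        using elim by (intro trace_matrix_inv_mono[OF Y]) (simp add: scaleR_matrix_vector_assoc[symmetric])
      finally have "F_fun X Y - d * ?t - u / 4 \<le> F_fun Q Y"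
        using elim by (simp add: F_fun_def algebra_simps)
      moreover have "d * ?t \<le> d * (2 * (F_fun X Y + k))"
        using trace_le_F_fun[OF X Y] d by (simp add: k_def)
      moreover have "(1 - 2 * d) * u \<le> (1 - 2 * d) * F_fun X Y"
        using uF d by (intro mult_left_mono) auto
      ultimately show "u / 4 \<le> F_fun Q Y"
        using d(3) by (simp add: algebra_simps)
    qed
  qed
qed

section \<open>The covariance structure as a Gram matrix\<close>

lemma sum_UNIV_sum:
  fixes f :: "'a::finite + 'b::finite \<Rightarrow> real"
  shows "(\<Sum>x\<in>UNIV. f x) = (\<Sum>a\<in>UNIV. f (Inl a)) + (\<Sum>b\<in>UNIV. f (Inr b))"
  unfolding UNIV_Plus_UNIV[symmetric] by (simp add: sum.Plus del: UNIV_Plus_UNIV)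

lemma join_vec_nth [simp]:
  "join_vec x y $ Inl a = x $ a" "join_vec x y $ Inr b = y $ b"
  by (simp_all add: join_vec_def)

lemma join_vec_eq_iff: "z = join_vec x y \<longleftrightarrow> (\<forall>a. z $ Inl a = x $ a) \<and> (\<forall>b. z $ Inr b = y $ b)"
  by (auto simp: vec_eq_iff) (metis join_vec_nth sum.exhaust)

lemma join_vec_cases:
  obtains x y where "z = join_vec x y"
  using that[of "\<chi> a. z $ Inl a" "\<chi> b. z $ Inr b"] by (simp add: join_vec_eq_iff)

lemma join_vec_add: "join_vec x y + join_vec x' y' = join_vec (x + x') (y + y')"
  for x :: "real^'a" and y :: "real^'b"
  by (simp add: join_vec_eq_iff)

lemma inner_join_vec: "join_vec x y \<bullet> join_vec x' y' = x \<bullet> x' + y \<bullet> y'"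
  for x :: "real^'a" and y :: "real^'b"
  by (simp add: inner_vec_def sum_UNIV_sum)

definition append_columns :: "real^'a^'m \<Rightarrow> real^'b^'m \<Rightarrow> real^('a + 'b)^'m" where
  "append_columns A B = (\<chi> i. join_vec (A $ i) (B $ i))"

lemma append_columns_vector:
  "append_columns A B *v join_vec x y = A *v x + B *v y"
  by (simp add: vec_eq_iff append_columns_def matrix_vector_mult_def sum_UNIV_sum)

lemma append_columns_gram:
  "append_columns A B ** transpose (append_columns C D) = A ** transpose C + B ** transpose D"
  by (simp add: vec_eq_iff append_columns_def matrix_matrix_mult_def transpose_def sum_UNIV_sum)

lemma block_matrix_nth [simp]:
  "block_matrix A B C D $ Inl a = join_vec (A $ a) (B $ a)"
  "block_matrix A B C D $ Inr b = join_vec (C $ b) (D $ b)"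
  by (simp_all add: block_matrix_def)

lemma block_matrix_vector:
  "block_matrix A B C D *v join_vec x y = join_vec (A *v x + B *v y) (C *v x + D *v y)"
  by (simp add: join_vec_eq_iff matrix_vector_mult_def sum_UNIV_sum)

lemma block_matrix_gram:
  "block_matrix A B C D ** transpose (block_matrix A B C D) =
   block_matrix (A ** transpose A + B ** transpose B) (A ** transpose C + B ** transpose D)
     (C ** transpose A + D ** transpose B) (C ** transpose C + D ** transpose D)"
proof -
  have entry: "(M ** transpose M) $ i $ j = (\<Sum>k\<in>UNIV. M $ i $ k * M $ j $ k)" for M :: "real^('a+'b)^('c+'d)" and i j
    by (simp add: matrix_matrix_mult_def transpose_def)
  have "(block_matrix A B C D ** transpose (block_matrix A B C D)) $ i $ j =
    block_matrix (A ** transpose A + B ** transpose B) (A ** transpose C + B ** transpose D)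
     (C ** transpose A + D ** transpose B) (C ** transpose C + D ** transpose D) $ i $ j" for i j
    unfolding entry
    by (cases i; cases j) (simp_all add: sum_UNIV_sum matrix_matrix_mult_def transpose_def)
  then show ?thesis by (simp add: vec_eq_iff)
qed

lemma matrix_add_rdistrib: "(A + B) ** C = A ** C + B ** (C :: real^'c^'b)"
  for A B :: "real^'b^'a"
  by (simp add: vec_eq_iff matrix_matrix_mult_def sum.distrib algebra_simps)

lemma transpose_0: "transpose (0 :: real^'b^'a) = 0"
  by (simp add: vec_eq_iff transpose_def)

text \<open>The columns belong to the four driving Wiener processes, so that \<open>noise_matrix m \<theta>\<close> times the stacked
  Wiener process is the martingale part of the observation.\<close>

definition noise_matrix where
  "noise_matrix m \<theta> =
    (let K = Lx2 m \<theta> ** matrix_inv (Psi m \<theta>) in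
     block_matrix
       (append_columns (Lx1 m \<theta> ** S1 m \<theta>) (S2 m \<theta>)) (append_columns 0 0)
       (append_columns (K ** Gamma_mat m \<theta> ** S1 m \<theta>) 0) (append_columns (S3 m \<theta>) (K ** S4 m \<theta>)))"

lemma noise_matrix_vector:
  "noise_matrix m \<theta> *v join_vec (join_vec w1 w2) (join_vec w3 w4) =
    join_vec (Lx1 m \<theta> *v (S1 m \<theta> *v w1) + S2 m \<theta> *v w2)
      (Lx2 m \<theta> *v (matrix_inv (Psi m \<theta>) *v (Gamma_mat m \<theta> *v (S1 m \<theta> *v w1) + S4 m \<theta> *v w4))
       + S3 m \<theta> *v w3)"
  by (simp add: noise_matrix_def Let_def block_matrix_vector append_columns_vector
      matrix_vector_mul_assoc[symmetric] matrix_vector_right_distrib add_ac)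

lemma Sigma_cov_eq_gram:
  assumes "is_sem m" and "\<theta> \<in> Theta m"
  shows "Sigma_cov m \<theta> = noise_matrix m \<theta> ** transpose (noise_matrix m \<theta>)"
proof -
  have S: "Sigma_xi m \<theta> = S1 m \<theta> ** transpose (S1 m \<theta>)"
    "Sigma_delta m \<theta> = S2 m \<theta> ** transpose (S2 m \<theta>)"
    "Sigma_eps m \<theta> = S3 m \<theta> ** transpose (S3 m \<theta>)"
    "Sigma_zeta m \<theta> = S4 m \<theta> ** transpose (S4 m \<theta>)"
    using assms by (auto simp: is_sem_def)
  show ?thesis
    unfolding Sigma_cov_def Sigma_11_def Sigma_12_def Sigma_22_def S noise_matrix_def Let_def
      block_matrix_gram append_columns_gram
    by (simp add: matrix_transpose_mul transpose_0 matrix_mul_assoc matrix_add_ldistrib matrix_add_rdistrib add_ac)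
qed

lemma pos_def_Sigma_cov:
  assumes m: "is_sem m" "regular_sem m" and \<theta>: "\<theta> \<in> Theta m"
  shows "pos_def (Sigma_cov m \<theta>)"
proof -
  let ?G = "noise_matrix m \<theta>"
  have gram: "Sigma_cov m \<theta> = ?G ** transpose ?G" by (rule Sigma_cov_eq_gram[OF m(1) \<theta>])
  have S: "Sigma_delta m \<theta> = S2 m \<theta> ** transpose (S2 m \<theta>)" "pos_def (Sigma_delta m \<theta>)"
    "Sigma_eps m \<theta> = S3 m \<theta> ** transpose (S3 m \<theta>)" "pos_def (Sigma_eps m \<theta>)"
    using assms by (auto simp: is_sem_def regular_sem_def)
  have q: "x \<bullet> (Sigma_cov m \<theta> *v x) = (x v* ?G) \<bullet> (x v* ?G)" for x
    unfolding gram by (simp add: matrix_vector_mul_assoc[symmetric] dot_lmul_matrix)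
  have "x = 0" if "x \<bullet> (Sigma_cov m \<theta> *v x) = 0" for x
  proof -
    obtain x1 x2 where x: "x = join_vec x1 x2" by (rule join_vec_cases)
    have "x v* ?G = 0" using that by (simp add: q)
    \<comment> \<open>Probing with noise in \<open>\<delta>\<close> only and in \<open>\<epsilon>\<close> only reduces to the two measurement error covariances.\<close>
    then have orth: "x \<bullet> (?G *v w) = 0" for w by (metis dot_lmul_matrix inner_zero_left)
    have "x1 \<bullet> (Sigma_delta m \<theta> *v x1) = 0"
      using orth[of "join_vec (join_vec 0 (transpose (S2 m \<theta>) *v x1)) (join_vec 0 0)"]
      by (simp add: x noise_matrix_vector inner_join_vec S(1) matrix_vector_mul_assoc[symmetric])
    moreover have "x2 \<bullet> (Sigma_eps m \<theta> *v x2) = 0"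
      using orth[of "join_vec (join_vec 0 0) (join_vec (transpose (S3 m \<theta>) *v x2) 0)"]
      by (simp add: x noise_matrix_vector inner_join_vec S(3) matrix_vector_mul_assoc[symmetric])
    ultimately have "x1 = 0" "x2 = 0"
      using S(2,4) unfolding pos_def_def by (metis less_irrefl)+
    then show "x = 0" by (simp add: x vec_eq_iff join_vec_def split: sum.split)
  qed
  moreover have "0 \<le> x \<bullet> (Sigma_cov m \<theta> *v x)" for x by (simp add: q)
  ultimately have "0 < x \<bullet> (Sigma_cov m \<theta> *v x)" if "x \<noteq> 0" for x
    using that by (metis order_le_less)
  moreover have "transpose (Sigma_cov m \<theta>) = Sigma_cov m \<theta>"
    by (simp add: gram matrix_transpose_mul)
  ultimately show ?thesis by (simp add: pos_def_def)
qed

section \<open>Convergence in probability to a constant\<close>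

definition tendsto_in_prob :: "'w measure \<Rightarrow> (nat \<Rightarrow> 'w \<Rightarrow> 'a::metric_space) \<Rightarrow> 'a \<Rightarrow> bool" where
  "tendsto_in_prob M X c \<longleftrightarrow> (\<forall>e>0. (\<lambda>n. measure M {\<omega> \<in> space M. e \<le> dist (X n \<omega>) c}) \<longlonglongrightarrow> 0)"

context prob_space
begin

lemma tendsto_in_probI:
  assumes "\<And>e. 0 < e \<Longrightarrow> \<exists>f. f \<longlonglongrightarrow> 0 \<and> (\<forall>\<^sub>F n in sequentially. measure M {\<omega> \<in> space M. e \<le> dist (X n \<omega>) c} \<le> f n)"
  shows "tendsto_in_prob M X c"
  unfolding tendsto_in_prob_def
proof (intro allI impI)
  fix e :: real assume "0 < e"
  then obtain f where "f \<longlonglongrightarrow> 0" "\<forall>\<^sub>F n in sequentially. measure M {\<omega> \<in> space M. e \<le> dist (X n \<omega>) c} \<le> f n"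
    using assms by blast
  then show "(\<lambda>n. measure M {\<omega> \<in> space M. e \<le> dist (X n \<omega>) c}) \<longlonglongrightarrow> 0"
    by - (rule tendsto_sandwich[where f = "\<lambda>_. 0" and h = f]; simp)
qed

lemma tendsto_in_probD:
  "tendsto_in_prob M X c \<Longrightarrow> 0 < e \<Longrightarrow> (\<lambda>n. measure M {\<omega> \<in> space M. e \<le> dist (X n \<omega>) c}) \<longlonglongrightarrow> 0"
  by (simp add: tendsto_in_prob_def)

lemma tendsto_in_prob_continuous:
  fixes X :: "nat \<Rightarrow> 'a \<Rightarrow> 'b::{metric_space, second_countable_topology}" and f :: "'b \<Rightarrow> 'c::metric_space"
  assumes X: "tendsto_in_prob M X c" and [measurable]: "\<And>n. X n \<in> borel_measurable M"
    and f: "isCont f c"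
  shows "tendsto_in_prob M (\<lambda>n \<omega>. f (X n \<omega>)) (f c)"
proof (rule tendsto_in_probI)
  fix e :: real assume "0 < e"
  then obtain d where d: "0 < d" "\<And>x. dist x c < d \<Longrightarrow> dist (f x) (f c) < e"
    using f unfolding continuous_at_eps_delta by blast
  have "measure M {\<omega> \<in> space M. e \<le> dist (f (X n \<omega>)) (f c)} \<le> measure M {\<omega> \<in> space M. d \<le> dist (X n \<omega>) c}" for n
    using d(2) by (intro finite_measure_mono) (auto simp: not_less[symmetric])
  moreover have "(\<lambda>n. measure M {\<omega> \<in> space M. d \<le> dist (X n \<omega>) c}) \<longlonglongrightarrow> 0"
    using X d(1) by (simp add: tendsto_in_prob_def)
  ultimately show "\<exists>g. g \<longlonglongrightarrow> 0 \<and>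
      (\<forall>\<^sub>F n in sequentially. measure M {\<omega> \<in> space M. e \<le> dist (f (X n \<omega>)) (f c)} \<le> g n)"
    by (intro exI[of _ "\<lambda>n. measure M {\<omega> \<in> space M. d \<le> dist (X n \<omega>) c}"]) simp
qed

lemma tendsto_in_prob_add:
  fixes X Y :: "nat \<Rightarrow> 'a \<Rightarrow> 'b::{real_normed_vector, second_countable_topology}"
  assumes X: "tendsto_in_prob M X c" and Y: "tendsto_in_prob M Y d"
    and [measurable]: "\<And>n. X n \<in> borel_measurable M" "\<And>n. Y n \<in> borel_measurable M"
  shows "tendsto_in_prob M (\<lambda>n \<omega>. X n \<omega> + Y n \<omega>) (c + d)"
proof (rule tendsto_in_probI)
  fix e :: real assume "0 < e"
  let ?A = "\<lambda>n. {\<omega> \<in> space M. e / 2 \<le> dist (X n \<omega>) c}"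
  let ?B = "\<lambda>n. {\<omega> \<in> space M. e / 2 \<le> dist (Y n \<omega>) d}"
  have "measure M {\<omega> \<in> space M. e \<le> dist (X n \<omega> + Y n \<omega>) (c + d)} \<le> measure M (?A n) + measure M (?B n)" for n
  proof -
    have "e / 2 \<le> dist x c \<or> e / 2 \<le> dist y d" if "e \<le> dist (x + y) (c + d)" for x y :: 'b
      using dist_triangle_add[of x y c d] that by linarith
    then have "measure M {\<omega> \<in> space M. e \<le> dist (X n \<omega> + Y n \<omega>) (c + d)} \<le> measure M (?A n \<union> ?B n)"
      by (intro finite_measure_mono) auto
    also have "\<dots> \<le> measure M (?A n) + measure M (?B n)"
      by (rule measure_Un_le) auto
    finally show ?thesis .
  qed
  moreover have "(\<lambda>n. measure M (?A n) + measure M (?B n)) \<longlonglongrightarrow> 0 + 0"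
    using \<open>0 < e\<close> by (intro tendsto_add tendsto_in_probD[OF X] tendsto_in_probD[OF Y]) simp_all
  ultimately show "\<exists>g. g \<longlonglongrightarrow> 0 \<and>
      (\<forall>\<^sub>F n in sequentially. measure M {\<omega> \<in> space M. e \<le> dist (X n \<omega> + Y n \<omega>) (c + d)} \<le> g n)"
    by (intro exI[of _ "\<lambda>n. measure M (?A n) + measure M (?B n)"]) simp
qed

lemma tendsto_in_prob_vec:
  fixes X :: "nat \<Rightarrow> 'a \<Rightarrow> 'b::{metric_space, second_countable_topology}^'n"
  assumes X: "\<And>i. tendsto_in_prob M (\<lambda>n \<omega>. X n \<omega> $ i) (c $ i)"
    and [measurable]: "\<And>n i. (\<lambda>\<omega>. X n \<omega> $ i) \<in> borel_measurable M"
  shows "tendsto_in_prob M X c"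
proof (rule tendsto_in_probI)
  fix e :: real assume "0 < e"
  define d where "d = e / (2 * real CARD('n))"
  have d: "0 < d" using \<open>0 < e\<close> by (simp add: d_def)
  let ?A = "\<lambda>n i. {\<omega> \<in> space M. d \<le> dist (X n \<omega> $ i) (c $ i)}"
  have "measure M {\<omega> \<in> space M. e \<le> dist (X n \<omega>) c} \<le> (\<Sum>i\<in>UNIV. measure M (?A n i))" for n
  proof -
    have "\<exists>i. d \<le> dist (x $ i) (c $ i)" if "e \<le> dist x c" for x
    proof (rule ccontr)
      assume "\<nexists>i. d \<le> dist (x $ i) (c $ i)"
      then have "(\<Sum>i\<in>UNIV. dist (x $ i) (c $ i)) \<le> (\<Sum>i\<in>(UNIV::'n set). d)"
        by (intro sum_mono) (auto simp: not_le intro: less_imp_le)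
      moreover have "dist x c \<le> (\<Sum>i\<in>UNIV. dist (x $ i) (c $ i))"
        unfolding dist_vec_def by (intro L2_set_le_sum) simp
      ultimately have "e \<le> real CARD('n) * d" using that by simp
      then show False using \<open>0 < e\<close> by (simp add: d_def)
    qed
    then have "measure M {\<omega> \<in> space M. e \<le> dist (X n \<omega>) c} \<le> measure M (\<Union>i\<in>UNIV. ?A n i)"
      by (intro finite_measure_mono) auto
    also have "\<dots> \<le> (\<Sum>i\<in>UNIV. measure M (?A n i))"
      by (rule finite_measure_subadditive_finite) auto
    finally show ?thesis .
  qed
  moreover have "(\<lambda>n. \<Sum>i\<in>UNIV. measure M (?A n i)) \<longlonglongrightarrow> (\<Sum>i\<in>(UNIV::'n set). 0)"
    using X d by (intro tendsto_sum) (auto simp: tendsto_in_prob_def)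
  ultimately show "\<exists>g. g \<longlonglongrightarrow> 0 \<and> (\<forall>\<^sub>F n in sequentially. measure M {\<omega> \<in> space M. e \<le> dist (X n \<omega>) c} \<le> g n)"
    by (intro exI[of _ "\<lambda>n. \<Sum>i\<in>UNIV. measure M (?A n i)"]) simp
qed

lemma tendsto_in_prob_AE:
  fixes X :: "nat \<Rightarrow> 'a \<Rightarrow> 'b::{metric_space, second_countable_topology}"
  assumes X: "AE \<omega> in M. (\<lambda>n. X n \<omega>) \<longlonglongrightarrow> c"
    and [measurable]: "\<And>n. X n \<in> borel_measurable M"
  shows "tendsto_in_prob M X c"
  unfolding tendsto_in_prob_def
proof (intro allI impI)
  fix e :: real assume "0 < e"
  let ?A = "\<lambda>n. {\<omega> \<in> space M. e \<le> dist (X n \<omega>) c}"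
  have "(\<lambda>n. integral\<^sup>L M (indicator (?A n) :: 'a \<Rightarrow> real)) \<longlonglongrightarrow> integral\<^sup>L M (\<lambda>_. 0 :: real)"
  proof (rule integral_dominated_convergence[where w = "\<lambda>_. 1"])
    show "AE \<omega> in M. (\<lambda>n. indicator (?A n) \<omega> :: real) \<longlonglongrightarrow> 0"
      using X
    proof eventually_elim
      case (elim \<omega>)
      then have "\<forall>\<^sub>F n in sequentially. dist (X n \<omega>) c < e" using \<open>0 < e\<close> by (rule tendstoD)
      then have "\<forall>\<^sub>F n in sequentially. indicator (?A n) \<omega> = (0::real)"
        by eventually_elim (auto simp: indicator_def)
      then show ?case by (rule tendsto_eventually)
    qed
  qed (auto simp: indicator_def)
  then show "(\<lambda>n. measure M (?A n)) \<longlonglongrightarrow> 0" by simp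
qed

text \<open>Chebyshev's inequality: by orthogonality the second moment of the sum grows only linearly in \<open>n\<close>.\<close>

lemma prob_sum_orthogonal_le:
  fixes Z :: "nat \<Rightarrow> 'a \<Rightarrow> real"
  assumes Z [measurable]: "\<And>i. i < n \<Longrightarrow> Z i \<in> borel_measurable M"
    and int: "\<And>i j. i < n \<Longrightarrow> j < n \<Longrightarrow> integrable M (\<lambda>\<omega>. Z i \<omega> * Z j \<omega>)"
    and orth: "\<And>i j. i < n \<Longrightarrow> j < n \<Longrightarrow> i \<noteq> j \<Longrightarrow> expectation (\<lambda>\<omega>. Z i \<omega> * Z j \<omega>) = 0"
    and var: "\<And>i. i < n \<Longrightarrow> expectation (\<lambda>\<omega>. Z i \<omega> * Z i \<omega>) \<le> v"
    and e: "0 < e"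
  shows "measure M {\<omega> \<in> space M. e \<le> \<bar>\<Sum>i<n. Z i \<omega>\<bar>} \<le> real n * v / e\<^sup>2"
proof -
  have sq: "(\<Sum>i<n. Z i \<omega>)\<^sup>2 = (\<Sum>i<n. \<Sum>j<n. Z i \<omega> * Z j \<omega>)" for \<omega>
    by (simp add: power2_eq_square sum_product)
  have "measure M {\<omega> \<in> space M. e \<le> \<bar>\<Sum>i<n. Z i \<omega>\<bar>} \<le> expectation (\<lambda>\<omega>. (\<Sum>i<n. Z i \<omega>)\<^sup>2) / e\<^sup>2"
  proof (rule second_moment_method)
    show "integrable M (\<lambda>\<omega>. (\<Sum>i<n. Z i \<omega>)\<^sup>2)"
      unfolding sq by (intro Bochner_Integration.integrable_sum int) auto
  qed (use e in auto)
  also have "expectation (\<lambda>\<omega>. (\<Sum>i<n. Z i \<omega>)\<^sup>2) = (\<Sum>i<n. \<Sum>j<n. expectation (\<lambda>\<omega>. Z i \<omega> * Z j \<omega>))"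
  proof -
    have "expectation (\<lambda>\<omega>. \<Sum>j<n. Z i \<omega> * Z j \<omega>) = (\<Sum>j<n. expectation (\<lambda>\<omega>. Z i \<omega> * Z j \<omega>))"
      if "i < n" for i
      using that by (intro Bochner_Integration.integral_sum int) auto
    moreover have "expectation (\<lambda>\<omega>. \<Sum>i<n. \<Sum>j<n. Z i \<omega> * Z j \<omega>)
        = (\<Sum>i<n. expectation (\<lambda>\<omega>. \<Sum>j<n. Z i \<omega> * Z j \<omega>))"
      by (intro Bochner_Integration.integral_sum Bochner_Integration.integrable_sum int) auto
    ultimately show ?thesis by (simp add: sq)
  qed
  also have "\<dots> = (\<Sum>i<n. \<Sum>j<n. if j = i then expectation (\<lambda>\<omega>. Z i \<omega> * Z i \<omega>) else 0)"
    using orth by (intro sum.cong) auto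
  also have "\<dots> \<le> (\<Sum>i<n. v)"
    using var by (intro sum_mono) simp
  finally show ?thesis by (simp add: divide_right_mono)
qed

end

section \<open>Realised covariation\<close>

definition grid :: "real \<Rightarrow> nat \<Rightarrow> nat \<Rightarrow> real" where
  "grid T n k = real k * (T / real n)"

definition cross_variation :: "real \<Rightarrow> nat \<Rightarrow> (real \<Rightarrow> real) \<Rightarrow> (real \<Rightarrow> real) \<Rightarrow> real" where
  "cross_variation T n f g =
    (1 / T) * (\<Sum>k<n. (f (grid T n (Suc k)) - f (grid T n k)) * (g (grid T n (Suc k)) - g (grid T n k)))"

lemma realized_cov_nth:
  "realized_cov T n x $ a $ b = cross_variation T n (\<lambda>t. x t $ a) (\<lambda>t. x t $ b)"
proof -
  have "{1..n} = Suc ` {..<n}" by (auto simp: image_Suc_lessThan)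
  then show ?thesis
    by (simp add: realized_cov_def cross_variation_def Let_def outer_product_def sum.reindex grid_def)
qed

lemma cross_variation_commute: "cross_variation T n f g = cross_variation T n g f"
  by (simp add: cross_variation_def mult.commute)

lemma grid_in: "0 < T \<Longrightarrow> k \<le> n \<Longrightarrow> grid T n k \<in> {0..T}"
  by (cases "n = 0") (auto simp: grid_def field_simps)

lemma grid_Suc: "grid T n (Suc k) - grid T n k = T / real n"
  by (simp add: grid_def algebra_simps add_divide_distrib)

lemma cross_variation_cong:
  assumes "0 < T" and "\<And>t. t \<in> {0..T} \<Longrightarrow> f t = f' t" and "\<And>t. t \<in> {0..T} \<Longrightarrow> g t = g' t"
  shows "cross_variation T n f g = cross_variation T n f' g'"
  unfolding cross_variation_def using assms grid_in[of T]
  by (intro arg_cong2[where f = "(*)"] sum.cong refl) (auto simp: Suc_le_eq)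

lemma realized_cov_cong:
  assumes "0 < T" and "\<And>t. t \<in> {0..T} \<Longrightarrow> x t = y t"
  shows "realized_cov T n x = realized_cov T n y"
  unfolding vec_eq_iff realized_cov_nth using assms by (auto intro!: cross_variation_cong)

lemma transpose_realized_cov: "transpose (realized_cov T n x) = realized_cov T n x"
  by (simp add: vec_eq_iff transpose_def realized_cov_nth cross_variation_commute)

lemma inner_outer_product: "z \<bullet> (outer_product x x *v z) = (x \<bullet> z)\<^sup>2"
proof -
  have "outer_product x x *v z = (x \<bullet> z) *\<^sub>R x"
    by (simp add: vec_eq_iff outer_product_def matrix_vector_mult_def inner_vec_def sum_distrib_left mult_ac)
  then show ?thesis by (simp add: power2_eq_square inner_commute)
qed

lemma outer_product_linear_image:
  "outer_product (G *v x) (G *v x) = G ** outer_product x x ** transpose G"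
proof -
  have "(G *v x) $ i * (G *v x) $ j = (\<Sum>l\<in>UNIV. (\<Sum>k\<in>UNIV. G $ i $ k * (x $ k * x $ l)) * G $ j $ l)" for i j
  proof -
    have "(G *v x) $ i * (G *v x) $ j = (\<Sum>l\<in>UNIV. (G *v x) $ i * (G $ j $ l * x $ l))"
      by (simp add: matrix_vector_mult_def[of G] sum_distrib_left[symmetric])
    also have "\<dots> = (\<Sum>l\<in>UNIV. (\<Sum>k\<in>UNIV. G $ i $ k * (x $ k * x $ l)) * G $ j $ l)"
      by (rule sum.cong) (simp_all add: matrix_vector_mult_def sum_distrib_left sum_distrib_right mult_ac)
    finally show ?thesis .
  qed
  then show ?thesis
    by (simp add: vec_eq_iff outer_product_def matrix_matrix_mult_def transpose_def)
qed

lemma linear_congruence: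
  fixes G :: "real^'a^'b"
  shows "linear (\<lambda>A. G ** A ** transpose G)"
  by (rule linearI) (simp_all add: vec_eq_iff matrix_matrix_mult_def sum.distrib sum_distrib_left
      sum_distrib_right algebra_simps)

lemma realized_cov_linear_image:
  fixes G :: "real^'a^'b"
  shows "realized_cov T n (\<lambda>t. G *v x t) = G ** realized_cov T n x ** transpose G"
  by (simp add: realized_cov_def Let_def matrix_vector_mult_diff_distrib[symmetric]
      outer_product_linear_image linear_scale[OF linear_congruence] linear_sum[OF linear_congruence])

text \<open>A realised covariance is a Gram matrix, so it can fail to be positive definite only by being singular.\<close>

lemma pos_def_realized_cov:
  fixes x :: "real \<Rightarrow> real^'n"
  assumes T: "0 < T" and inv: "invertible (realized_cov T n x)"
  shows "pos_def (realized_cov T n x)"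
proof -
  define d where "d k = x (real k * (T / real n)) - x (real (k - 1) * (T / real n))" for k
  have Q: "realized_cov T n x = (1 / T) *\<^sub>R (\<Sum>k=1..n. outer_product (d k) (d k))"
    by (simp add: realized_cov_def Let_def d_def)
  have mult: "realized_cov T n x *v z = (1 / T) *\<^sub>R (\<Sum>k=1..n. outer_product (d k) (d k) *v z)" for z
  proof -
    have "linear (\<lambda>A :: real^'n^'n. A *v z)"
      by (rule linearI) (simp_all add: matrix_vector_mult_add_rdistrib scaleR_matrix_vector_assoc)
    then have "(\<Sum>k=1..n. outer_product (d k) (d k)) *v z = (\<Sum>k=1..n. outer_product (d k) (d k) *v z)"
      by (rule linear_sum)
    then show ?thesis unfolding Q by (simp add: scaleR_matrix_vector_assoc[symmetric])
  qed
  have q: "z \<bullet> (realized_cov T n x *v z) = (1 / T) * (\<Sum>k=1..n. (d k \<bullet> z)\<^sup>2)" for z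
    by (simp add: mult inner_sum_right inner_outer_product)
  have "z = 0" if "z \<bullet> (realized_cov T n x *v z) = 0" for z
  proof -
    have "\<forall>k\<in>{1..n}. (d k \<bullet> z)\<^sup>2 = 0"
      using that T by (subst sum_nonneg_eq_0_iff[symmetric]) (auto simp: q)
    moreover have "outer_product (d k) (d k) *v z = (d k \<bullet> z) *\<^sub>R d k" for k
      by (simp add: vec_eq_iff outer_product_def matrix_vector_mult_def inner_vec_def sum_distrib_left mult_ac)
    ultimately have "realized_cov T n x *v z = 0" by (simp add: mult)
    then show "z = 0"
      using inv by (metis invertible_def matrix_vector_mul_assoc matrix_vector_mul_lid matrix_vector_mult_0_right)
  qed
  moreover have "0 \<le> z \<bullet> (realized_cov T n x *v z)" for z
    using T by (simp add: q sum_nonneg)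
  ultimately show ?thesis
    by (auto simp: pos_def_def transpose_realized_cov order_less_le)
qed

text \<open>A Lipschitz path has increments of order \<open>1 / n\<close>, those of a continuous path tend to \<open>0\<close> uniformly;
  hence the products of \<open>n\<close> pairs of increments with at least one Lipschitz factor are negligible.\<close>

lemma realized_cov_add_lipschitz:
  fixes a w :: "real \<Rightarrow> real^'n"
  assumes T: "0 < T" and a: "K-lipschitz_on {0..T} a" and w: "continuous_on {0..T} w"
  shows "(\<lambda>n. realized_cov T n (\<lambda>t. a t + w t) - realized_cov T n w) \<longlonglongrightarrow> 0"
proof (intro vec_tendstoI)
  fix i j
  let ?d = "\<lambda>n. realized_cov T n (\<lambda>t. a t + w t) - realized_cov T n w"
  have K: "0 \<le> K" using a by (rule lipschitz_on_nonneg)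
  have "\<exists>N. \<forall>n\<ge>N. \<bar>?d n $ i $ j\<bar> < r" if r: "0 < r" for r
  proof -
    define e where "e = r / (4 * (K + 1))"
    have "0 < r * 4 + K * (r * 2)" using K r by (simp add: add_pos_nonneg)
    then have e: "0 < e" "K * (2 * e) < r" using K r by (auto simp: e_def field_simps)
    have "uniformly_continuous_on {0..T} w"
      using w compact_Icc by (rule compact_uniformly_continuous)
    then obtain s where s: "0 < s"
      and ws: "\<And>t t'. t \<in> {0..T} \<Longrightarrow> t' \<in> {0..T} \<Longrightarrow> dist t' t < s \<Longrightarrow> dist (w t') (w t) < e"
      using e(1) unfolding uniformly_continuous_on_def by metis
    have lim: "(\<lambda>n. T / real n) \<longlonglongrightarrow> 0" by (rule lim_const_over_n)
    have "(\<lambda>n. K * (K * (T / real n) + 2 * e)) \<longlonglongrightarrow> K * (K * 0 + 2 * e)"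
      by (intro tendsto_intros lim)
    then have "\<forall>\<^sub>F n in sequentially. K * (K * (T / real n) + 2 * e) < r"
      by (rule order_tendstoD) (use e(2) in simp)
    moreover have "\<forall>\<^sub>F n in sequentially. T / real n < s"
      using lim s by (rule order_tendstoD)
    moreover have "\<forall>\<^sub>F n in sequentially. 0 < n" by (rule eventually_gt_at_top)
    ultimately have "\<forall>\<^sub>F n in sequentially. \<bar>?d n $ i $ j\<bar> < r"
    proof eventually_elim
      case (elim n)
      define h where "h = T / real n"
      have h: "0 < h" "real n * h = T" using elim T by (auto simp: h_def)
      define \<Delta>a where "\<Delta>a k = a (grid T n (Suc k)) - a (grid T n k)" for k
      define \<Delta>w where "\<Delta>w k = w (grid T n (Suc k)) - w (grid T n k)" for k
      have step: "dist (grid T n (Suc k)) (grid T n k) = h" for k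
        using h T grid_Suc[of T n k] by (simp add: dist_real_def h_def)
      have \<Delta>a: "norm (\<Delta>a k) \<le> K * h" and \<Delta>w: "norm (\<Delta>w k) \<le> e" if "k < n" for k
      proof -
        have "grid T n k \<in> {0..T}" "grid T n (Suc k) \<in> {0..T}"
          using grid_in[OF T, of _ n] that by simp_all
        then have "dist (a (grid T n (Suc k))) (a (grid T n k)) \<le> K * h"
          "dist (w (grid T n (Suc k))) (w (grid T n k)) < e"
          using lipschitz_onD[OF a, of "grid T n (Suc k)" "grid T n k"]
            ws[of "grid T n k" "grid T n (Suc k)"] elim(2) by (simp_all only: step h_def)
        then show "norm (\<Delta>a k) \<le> K * h" "norm (\<Delta>w k) \<le> e"
          by (simp_all add: \<Delta>a_def \<Delta>w_def dist_norm)
      qed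
      have comp: "\<bar>v $ l\<bar> \<le> b" if "norm v \<le> b" for v :: "real^'n" and l b
        using component_le_norm_cart[of v l] that by linarith
      have "\<bar>?d n $ i $ j\<bar> = (1 / T) * \<bar>\<Sum>k<n. \<Delta>a k $ i * \<Delta>a k $ j + \<Delta>a k $ i * \<Delta>w k $ j + \<Delta>w k $ i * \<Delta>a k $ j\<bar>"
      proof -
        have "realized_cov T n (\<lambda>t. a t + w t) $ i $ j
            = (1 / T) * (\<Sum>k<n. (\<Delta>a k $ i + \<Delta>w k $ i) * (\<Delta>a k $ j + \<Delta>w k $ j))"
          unfolding realized_cov_nth cross_variation_def
          by (intro arg_cong2[where f = "(*)"] refl sum.cong) (simp_all add: \<Delta>a_def \<Delta>w_def)
        moreover have "realized_cov T n w $ i $ j = (1 / T) * (\<Sum>k<n. \<Delta>w k $ i * \<Delta>w k $ j)"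
          by (simp add: realized_cov_nth cross_variation_def \<Delta>w_def)
        ultimately have "?d n $ i $ j
            = (1 / T) * (\<Sum>k<n. (\<Delta>a k $ i + \<Delta>w k $ i) * (\<Delta>a k $ j + \<Delta>w k $ j) - \<Delta>w k $ i * \<Delta>w k $ j)"
          by (simp only: vector_minus_component sum_subtractf right_diff_distrib)
        then show ?thesis using T by (simp add: abs_mult algebra_simps)
      qed
      also have "\<dots> \<le> (1 / T) * (\<Sum>k<n. K * h * (K * h) + K * h * e + e * (K * h))"
      proof (intro mult_left_mono order_trans[OF sum_abs] sum_mono)
        fix k assume "k \<in> {..<n}"
        then have *: "\<bar>\<Delta>a k $ l\<bar> \<le> K * h" "\<bar>\<Delta>w k $ l\<bar> \<le> e" for l
          using comp[OF \<Delta>a] comp[OF \<Delta>w] by auto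
        have "\<bar>\<Delta>a k $ i * \<Delta>a k $ j\<bar> \<le> K * h * (K * h)" "\<bar>\<Delta>a k $ i * \<Delta>w k $ j\<bar> \<le> K * h * e"
          "\<bar>\<Delta>w k $ i * \<Delta>a k $ j\<bar> \<le> e * (K * h)"
          unfolding abs_mult using * K h e by (intro mult_mono; simp)+
        then show "\<bar>\<Delta>a k $ i * \<Delta>a k $ j + \<Delta>a k $ i * \<Delta>w k $ j + \<Delta>w k $ i * \<Delta>a k $ j\<bar>
            \<le> K * h * (K * h) + K * h * e + e * (K * h)" by linarith
      qed (use T in simp)
      also have "\<dots> = (real n * h / T) * (K * (K * h + 2 * e))"
        by (simp add: algebra_simps)
      also have "\<dots> < r" using elim T h by (simp add: h_def)
      finally show ?case .
    qed
    then show ?thesis by (simp add: eventually_sequentially)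
  qed
  then show "(\<lambda>n. ?d n $ i $ j) \<longlonglongrightarrow> 0 $ i $ j"
    unfolding LIMSEQ_iff by simp
qed

section \<open>Moments of Gaussian increments\<close>

lemma nn_integral_lborel_cart_prod:
  fixes \<phi> :: "'n::finite \<Rightarrow> real \<Rightarrow> ennreal"
  assumes [measurable]: "\<And>i. \<phi> i \<in> borel_measurable borel"
  shows "(\<integral>\<^sup>+x. (\<Prod>i\<in>UNIV. \<phi> i (x $ i)) \<partial>(lborel :: (real^'n) measure)) = (\<Prod>i\<in>UNIV. \<integral>\<^sup>+y. \<phi> i y \<partial>lborel)"
proof -
  define e where "e = (\<lambda>i::'n. axis i (1::real))"
  have inj: "inj e" by (auto simp: e_def inj_on_def axis_eq_axis)
  have Basis: "Basis = range e" by (auto simp: Basis_vec_def e_def)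
  define f where "f b = \<phi> (inv e b)" for b
  have f: "f (e i) = \<phi> i" for i by (simp add: f_def inv_f_f[OF inj])
  have "(\<integral>\<^sup>+x. (\<Prod>b\<in>Basis. f b (x \<bullet> b)) \<partial>(lborel :: (real^'n) measure)) = (\<Prod>b\<in>Basis. \<integral>\<^sup>+y. f b y \<partial>lborel)"
    by (rule nn_integral_lborel_prod) (auto simp: f_def)
  then show ?thesis
    by (simp add: Basis prod.reindex[OF inj] f) (simp add: e_def inner_axis)
qed

lemma borel_measurable_coordinate:
  fixes X :: "'w \<Rightarrow> real^'n"
  assumes "X \<in> borel_measurable M"
  shows "(\<lambda>\<omega>. X \<omega> $ a) \<in> borel_measurable M"
proof -
  have "(\<lambda>x :: real^'n. x $ a) \<in> borel_measurable borel" by measurable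
  then show ?thesis by (rule measurable_compose[OF assms])
qed

context prob_space
begin

text \<open>The density of \<open>D\<close> is that of the centred normal distribution with covariance \<open>\<sigma>\<^sup>2\<close> times the identity.
  As it is a product, the coordinates are independent one-dimensional normal variables, and all moments needed
  below reduce to those.\<close>

context
  fixes D :: "'a \<Rightarrow> real^'n" and \<sigma> :: real
  assumes \<sigma>: "0 < \<sigma>"
    and D: "distributed M lborel D (\<lambda>x. ennreal (\<Prod>i\<in>UNIV. normal_density 0 \<sigma> (x $ i)))"
begin

lemma D_measurable [measurable]: "D \<in> borel_measurable M"
  using distributed_measurable[OF D] by simp

lemma coordinate_measurable [simp]: "(\<lambda>\<omega>. D \<omega> $ a) \<in> borel_measurable M"
  by (rule borel_measurable_coordinate) measurable

lemma emeasure_rectangle: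
  assumes [measurable]: "\<And>i. A i \<in> sets borel"
  shows "emeasure M {\<omega> \<in> space M. \<forall>i. D \<omega> $ i \<in> A i}
    = (\<Prod>i\<in>UNIV. \<integral>\<^sup>+y. ennreal (normal_density 0 \<sigma> y) * indicator (A i) y \<partial>lborel)"
proof -
  let ?R = "{x :: real^'n. \<forall>i. x $ i \<in> A i}"
  have ind: "indicator ?R x = (\<Prod>i\<in>UNIV. indicator (A i) (x $ i) :: ennreal)" for x
  proof (cases "x \<in> ?R")
    case False
    then have "\<exists>i. indicator (A i) (x $ i) = (0::ennreal)" by (auto simp: indicator_def)
    then show ?thesis using False by (subst prod_zero) auto
  qed simp
  have "?R \<in> sets borel" by measurable
  then have "emeasure M (D -` ?R \<inter> space M)
      = (\<integral>\<^sup>+x. ennreal (\<Prod>i\<in>UNIV. normal_density 0 \<sigma> (x $ i)) * indicator ?R x \<partial>lborel)"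
    by (intro distributed_emeasure[OF D]) simp
  also have "\<dots> = (\<integral>\<^sup>+x. (\<Prod>i\<in>UNIV. ennreal (normal_density 0 \<sigma> (x $ i)) * indicator (A i) (x $ i)) \<partial>lborel)"
    by (simp add: ind prod_ennreal[symmetric] prod.distrib)
  also have "\<dots> = (\<Prod>i\<in>UNIV. \<integral>\<^sup>+y. ennreal (normal_density 0 \<sigma> y) * indicator (A i) y \<partial>lborel)"
    by (rule nn_integral_lborel_cart_prod) measurable
  also have "D -` ?R \<inter> space M = {\<omega> \<in> space M. \<forall>i. D \<omega> $ i \<in> A i}" by auto
  finally show ?thesis .
qed

lemma emeasure_two_coordinates:
  assumes [measurable]: "A \<in> sets borel" "B \<in> sets borel" and ab: "a \<noteq> b"
  shows "emeasure M {\<omega> \<in> space M. D \<omega> $ a \<in> A \<and> D \<omega> $ b \<in> B}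
    = (\<integral>\<^sup>+y. ennreal (normal_density 0 \<sigma> y) * indicator A y \<partial>lborel)
    * (\<integral>\<^sup>+y. ennreal (normal_density 0 \<sigma> y) * indicator B y \<partial>lborel)" (is "_ = ?p A * ?p B")
proof -
  have total: "?p UNIV = 1"
    using \<sigma> by (simp add: nn_integral_eq_integral)
  let ?C = "\<lambda>i. if i = a then A else if i = b then B else UNIV"
  have "(\<forall>i. D \<omega> $ i \<in> ?C i) \<longleftrightarrow> D \<omega> $ a \<in> A \<and> D \<omega> $ b \<in> B" for \<omega>
    using ab by auto
  then have "emeasure M {\<omega> \<in> space M. D \<omega> $ a \<in> A \<and> D \<omega> $ b \<in> B} = (\<Prod>i\<in>UNIV. ?p (?C i))"
    using emeasure_rectangle[of ?C] by simp
  also have "\<dots> = (\<Prod>i\<in>UNIV. (if i = a then ?p A else 1) * (if i = b then ?p B else 1))"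
    using ab total by (intro prod.cong) auto
  also have "\<dots> = ?p A * ?p B" by (simp add: prod.distrib)
  finally show ?thesis .
qed

lemma emeasure_coordinate:
  assumes [measurable]: "A \<in> sets borel"
  shows "emeasure M {\<omega> \<in> space M. D \<omega> $ a \<in> A}
    = (\<integral>\<^sup>+y. ennreal (normal_density 0 \<sigma> y) * indicator A y \<partial>lborel)" (is "_ = ?p A")
proof -
  have total: "?p UNIV = 1"
    using \<sigma> by (simp add: nn_integral_eq_integral)
  let ?C = "\<lambda>i. if i = a then A else UNIV"
  have "(\<forall>i. D \<omega> $ i \<in> ?C i) \<longleftrightarrow> D \<omega> $ a \<in> A" for \<omega> by auto
  then have "emeasure M {\<omega> \<in> space M. D \<omega> $ a \<in> A} = (\<Prod>i\<in>UNIV. ?p (?C i))"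
    using emeasure_rectangle[of ?C] by simp
  also have "\<dots> = (\<Prod>i\<in>UNIV. if i = a then ?p A else 1)"
    using total by (intro prod.cong) auto
  finally show ?thesis by simp
qed

lemma coordinate_distributed:
  "distributed M lborel (\<lambda>\<omega>. D \<omega> $ a) (\<lambda>y. ennreal (normal_density 0 \<sigma> y))"
  unfolding distributed_def
proof (intro conjI)
  show "distr M lborel (\<lambda>\<omega>. D \<omega> $ a) = density lborel (\<lambda>y. ennreal (normal_density 0 \<sigma> y))"
  proof (rule measure_eqI)
    fix A assume "A \<in> sets (distr M lborel (\<lambda>\<omega>. D \<omega> $ a))"
    then have [measurable]: "A \<in> sets borel" by simp
    have "emeasure (distr M lborel (\<lambda>\<omega>. D \<omega> $ a)) A = emeasure M ((\<lambda>\<omega>. D \<omega> $ a) -` A \<inter> space M)"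
      by (rule emeasure_distr) simp_all
    also have "(\<lambda>\<omega>. D \<omega> $ a) -` A \<inter> space M = {\<omega> \<in> space M. D \<omega> $ a \<in> A}" by auto
    also have "emeasure M \<dots> = emeasure (density lborel (\<lambda>y. ennreal (normal_density 0 \<sigma> y))) A"
      by (simp add: emeasure_coordinate emeasure_density)
    finally show "emeasure (distr M lborel (\<lambda>\<omega>. D \<omega> $ a)) A
        = emeasure (density lborel (\<lambda>y. ennreal (normal_density 0 \<sigma> y))) A" .
  qed simp
qed simp_all

lemma coordinates_indep:
  assumes "a \<noteq> b"
  shows "indep_var borel (\<lambda>\<omega>. D \<omega> $ a) borel (\<lambda>\<omega>. D \<omega> $ b)"
proof -
  let ?E = "\<lambda>a. {(\<lambda>\<omega>. D \<omega> $ a) -` A \<inter> space M | A. A \<in> sets borel}"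
  have stable: "Int_stable (?E c)" for c
  proof (rule Int_stableI)
    fix u v assume "u \<in> ?E c" "v \<in> ?E c"
    then obtain A B where "A \<in> sets borel" "B \<in> sets borel"
      "u = (\<lambda>\<omega>. D \<omega> $ c) -` A \<inter> space M" "v = (\<lambda>\<omega>. D \<omega> $ c) -` B \<inter> space M" by auto
    then show "u \<inter> v \<in> ?E c"
      by (intro CollectI exI[of _ "A \<inter> B"]) auto
  qed
  have "indep_set (?E a) (?E b)"
  proof (rule indep_setI)
    fix u v assume "u \<in> ?E a" "v \<in> ?E b"
    then obtain A B where AB: "A \<in> sets borel" "B \<in> sets borel"
      and u: "u = {\<omega> \<in> space M. D \<omega> $ a \<in> A}" and v: "v = {\<omega> \<in> space M. D \<omega> $ b \<in> B}" by auto
    have "u \<inter> v = {\<omega> \<in> space M. D \<omega> $ a \<in> A \<and> D \<omega> $ b \<in> B}" by (auto simp: u v)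
    then have "emeasure M (u \<inter> v) = emeasure M u * emeasure M v"
      using AB assms by (simp add: u v emeasure_two_coordinates emeasure_coordinate)
    then show "prob (u \<inter> v) = prob u * prob v"
      by (simp add: measure_def enn2real_mult)
  qed (auto intro!: measurable_sets[of _ M borel])
  then show ?thesis
    unfolding indep_var_eq by (intro conjI indep_set_sigma_sets stable coordinate_measurable)
qed

lemma coordinate_moments:
  shows "integrable M (\<lambda>\<omega>. (D \<omega> $ a) ^ k)"
    and "expectation (\<lambda>\<omega>. D \<omega> $ a) = 0"
    and "expectation (\<lambda>\<omega>. (D \<omega> $ a)\<^sup>2) = \<sigma>\<^sup>2"
    and "expectation (\<lambda>\<omega>. (D \<omega> $ a) ^ 4) = 3 * \<sigma> ^ 4"
proof -
  note dist = coordinate_distributed[of a]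
  have E: "expectation (\<lambda>\<omega>. (D \<omega> $ a) ^ j) = (\<integral>y. normal_density 0 \<sigma> y * y ^ j \<partial>lborel)" for j
    by (rule distributed_integral[OF dist, symmetric]) auto
  show "integrable M (\<lambda>\<omega>. (D \<omega> $ a) ^ k)"
    using distributed_integrable[OF dist, of "\<lambda>y. y ^ k"] integrable_normal_moment[OF \<sigma>, of 0 k] by simp
  show "expectation (\<lambda>\<omega>. D \<omega> $ a) = 0"
    using E[of 1] integral_normal_moment_nz_1[OF \<sigma>, of 0] by simp
  show "expectation (\<lambda>\<omega>. (D \<omega> $ a)\<^sup>2) = \<sigma>\<^sup>2"
    using E[of 2] integral_normal_moment_even[OF \<sigma>, of 0 1] by simp
  show "expectation (\<lambda>\<omega>. (D \<omega> $ a) ^ 4) = 3 * \<sigma> ^ 4"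
    using E[of 4] integral_normal_moment_even[OF \<sigma>, of 0 2] \<sigma>
    by (simp add: fact_numeral field_simps power_divide)
qed

lemma centred_product_moments:
  fixes a b :: 'n
  defines "Z \<equiv> \<lambda>\<omega>. D \<omega> $ a * D \<omega> $ b - (if a = b then 1 else 0) * \<sigma>\<^sup>2"
  shows "integrable M Z" and "expectation Z = 0"
    and "integrable M (\<lambda>\<omega>. Z \<omega> * Z \<omega>)" and "expectation (\<lambda>\<omega>. Z \<omega> * Z \<omega>) \<le> 2 * (\<sigma>\<^sup>2)\<^sup>2"
proof -
  note int = coordinate_moments(1)
  have "integrable M Z \<and> expectation Z = 0 \<and>
    integrable M (\<lambda>\<omega>. Z \<omega> * Z \<omega>) \<and> expectation (\<lambda>\<omega>. Z \<omega> * Z \<omega>) \<le> 2 * (\<sigma>\<^sup>2)\<^sup>2"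
  proof (cases "a = b")
    case True
    have Z: "Z = (\<lambda>\<omega>. (D \<omega> $ b)\<^sup>2 - \<sigma>\<^sup>2)"
      by (simp add: Z_def True power2_eq_square)
    have ZZ: "(\<lambda>\<omega>. Z \<omega> * Z \<omega>) = (\<lambda>\<omega>. (D \<omega> $ b) ^ 4 - 2 * \<sigma>\<^sup>2 * (D \<omega> $ b)\<^sup>2 + \<sigma> ^ 4)"
      by (simp add: Z fun_eq_iff power2_eq_square power4_eq_xxxx algebra_simps)
    have "expectation (\<lambda>\<omega>. Z \<omega> * Z \<omega>) = 3 * \<sigma> ^ 4 - 2 * \<sigma>\<^sup>2 * \<sigma>\<^sup>2 + \<sigma> ^ 4"
      unfolding ZZ using int[of b] by (simp add: coordinate_moments prob_space)
    moreover have "integrable M (\<lambda>\<omega>. Z \<omega> * Z \<omega>)" unfolding ZZ using int[of b] by simp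
    moreover have "integrable M Z" "expectation Z = 0"
      unfolding Z using int[of b] by (simp_all add: coordinate_moments prob_space)
    ultimately show ?thesis by (simp add: power2_eq_square power4_eq_xxxx)
  next
    case False
    have Z: "Z = (\<lambda>\<omega>. D \<omega> $ a * D \<omega> $ b)" by (simp add: Z_def False)
    have ZZ: "(\<lambda>\<omega>. Z \<omega> * Z \<omega>) = (\<lambda>\<omega>. (D \<omega> $ a)\<^sup>2 * (D \<omega> $ b)\<^sup>2)"
      by (simp add: Z power2_eq_square mult_ac)
    note indep = coordinates_indep[OF False]
    have indep2: "indep_var borel (\<lambda>\<omega>. (D \<omega> $ a)\<^sup>2) borel (\<lambda>\<omega>. (D \<omega> $ b)\<^sup>2)"
      using indep_var_compose[OF indep, of "\<lambda>x. x\<^sup>2" borel "\<lambda>x. x\<^sup>2" borel] by (simp add: o_def)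
    have int1: "integrable M (\<lambda>\<omega>. D \<omega> $ c)" and int2: "integrable M (\<lambda>\<omega>. (D \<omega> $ c)\<^sup>2)" for c
      using int[of c 1] int[of c 2] by simp_all
    show ?thesis
      unfolding ZZ unfolding Z
      using indep_var_integrable[OF indep int1 int1] indep_var_integrable[OF indep2 int2 int2]
        indep_var_lebesgue_integral[OF indep int1 int1] indep_var_lebesgue_integral[OF indep2 int2 int2]
      by (simp add: coordinate_moments)
  qed
  then show "integrable M Z" "expectation Z = 0"
    "integrable M (\<lambda>\<omega>. Z \<omega> * Z \<omega>)" "expectation (\<lambda>\<omega>. Z \<omega> * Z \<omega>) \<le> 2 * (\<sigma>\<^sup>2)\<^sup>2" by auto
qed

end

end

section \<open>Quadratic variation of independent Wiener processes\<close>

context prob_space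
begin

lemma wiener_increments:
  fixes W :: "real \<Rightarrow> 'a \<Rightarrow> real^'r"
  assumes W: "wiener_process M T W" and T: "0 < T" and n: "0 < n"
  defines "D \<equiv> \<lambda>k \<omega>. W (grid T n (Suc k)) \<omega> - W (grid T n k) \<omega>"
  shows "indep_vars (\<lambda>_. borel) D {..<n}"
    and "k < n \<Longrightarrow> distributed M lborel (D k) (\<lambda>x. ennreal (\<Prod>i\<in>UNIV. normal_density 0 (sqrt (T / real n)) (x $ i)))"
proof -
  have "mono_on {..n} (grid T n)"
    using T by (auto simp: mono_on_def grid_def intro!: divide_right_mono mult_right_mono)
  moreover have "grid T n ` {..n} \<subseteq> {0..T}"
    using grid_in[OF T] by auto
  ultimately show "indep_vars (\<lambda>_. borel) D {..<n}"
    using W unfolding wiener_process_def D_def by blast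
  assume "k < n"
  then have "0 \<le> grid T n k" "grid T n (Suc k) \<le> T"
    using grid_in[OF T, of k n] grid_in[OF T, of "Suc k" n] by auto
  moreover have "grid T n k < grid T n (Suc k)"
    using grid_Suc[of T n k] T n by (simp add: algebra_simps)
  ultimately have "distributed M lborel (D k)
      (\<lambda>x. ennreal (\<Prod>i\<in>UNIV. normal_density 0 (sqrt (grid T n (Suc k) - grid T n k)) (x $ i)))"
    using W unfolding wiener_process_def D_def by blast
  then show "distributed M lborel (D k) (\<lambda>x. ennreal (\<Prod>i\<in>UNIV. normal_density 0 (sqrt (T / real n)) (x $ i)))"
    by (simp only: grid_Suc)
qed

lemma indep_vars_pair_expectation:
  fixes Z :: "'i \<Rightarrow> 'a \<Rightarrow> real"
  assumes ind: "indep_vars (\<lambda>_. borel) Z I" and ij: "i \<in> I" "j \<in> I" "i \<noteq> j"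
    and int: "integrable M (Z i)" "integrable M (Z j)"
  shows "integrable M (\<lambda>\<omega>. Z i \<omega> * Z j \<omega>)"
    and "expectation (\<lambda>\<omega>. Z i \<omega> * Z j \<omega>) = expectation (Z i) * expectation (Z j)"
proof -
  have "indep_vars (\<lambda>_. borel) Z {i, j}"
    using ind ij by (intro indep_vars_subset[OF ind]) auto
  moreover have "\<And>k. k \<in> {i, j} \<Longrightarrow> integrable M (Z k)" using int by auto
  ultimately show "integrable M (\<lambda>\<omega>. Z i \<omega> * Z j \<omega>)"
    "expectation (\<lambda>\<omega>. Z i \<omega> * Z j \<omega>) = expectation (Z i) * expectation (Z j)"
    using indep_vars_integrable[of "{i, j}" Z] indep_vars_lebesgue_integral[of "{i, j}" Z] ij(3)
    by simp_all
qed

text \<open>There are \<open>n\<close> centred products of increments, each with variance of order \<open>1 / n\<^sup>2\<close>. If they are orthogonal, the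
  variance of their sum is of order \<open>1 / n\<close>.\<close>

lemma cross_variation_tendsto_in_prob:
  fixes f g :: "real \<Rightarrow> 'a \<Rightarrow> real" and d :: real
  assumes T: "0 < T"
  defines "Z \<equiv> \<lambda>n k \<omega>. (f (grid T n (Suc k)) \<omega> - f (grid T n k) \<omega>)
    * (g (grid T n (Suc k)) \<omega> - g (grid T n k) \<omega>) - d * (T / real n)"
  assumes meas: "\<And>n k. k < n \<Longrightarrow> Z n k \<in> borel_measurable M"
    and int: "\<And>n i j. i < n \<Longrightarrow> j < n \<Longrightarrow> integrable M (\<lambda>\<omega>. Z n i \<omega> * Z n j \<omega>)"
    and orth: "\<And>n i j. i < n \<Longrightarrow> j < n \<Longrightarrow> i \<noteq> j \<Longrightarrow> expectation (\<lambda>\<omega>. Z n i \<omega> * Z n j \<omega>) = 0"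
    and var: "\<And>n i. i < n \<Longrightarrow> expectation (\<lambda>\<omega>. Z n i \<omega> * Z n i \<omega>) \<le> 2 * (T / real n)\<^sup>2"
  shows "tendsto_in_prob M (\<lambda>n \<omega>. cross_variation T n (\<lambda>t. f t \<omega>) (\<lambda>t. g t \<omega>)) d"
proof (rule tendsto_in_probI)
  fix e :: real assume e: "0 < e"
  let ?C = "\<lambda>n \<omega>. cross_variation T n (\<lambda>t. f t \<omega>) (\<lambda>t. g t \<omega>)"
  have "\<forall>\<^sub>F n in sequentially. measure M {\<omega> \<in> space M. e \<le> dist (?C n \<omega>) d} \<le> 2 / e\<^sup>2 / real n"
    using eventually_gt_at_top[of "0::nat"]
  proof eventually_elim
    case (elim n)
    have "(\<Sum>k<n. Z n k \<omega>) = T * (?C n \<omega> - d)" for \<omega>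
    proof -
      have "(\<Sum>k<n. Z n k \<omega>) = (\<Sum>k<n. (f (grid T n (Suc k)) \<omega> - f (grid T n k) \<omega>)
          * (g (grid T n (Suc k)) \<omega> - g (grid T n k) \<omega>)) - real n * (d * (T / real n))"
        unfolding Z_def sum_subtractf by simp
      also have "\<dots> = T * ?C n \<omega> - T * d"
        using T elim by (simp add: cross_variation_def)
      finally show ?thesis by (simp add: right_diff_distrib)
    qed
    then have "e \<le> dist (?C n \<omega>) d \<longleftrightarrow> T * e \<le> \<bar>\<Sum>k<n. Z n k \<omega>\<bar>" for \<omega>
      using T by (simp add: dist_real_def abs_mult)
    then have "measure M {\<omega> \<in> space M. e \<le> dist (?C n \<omega>) d} = measure M {\<omega> \<in> space M. T * e \<le> \<bar>\<Sum>k<n. Z n k \<omega>\<bar>}"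
      by simp
    also have "\<dots> \<le> real n * (2 * (T / real n)\<^sup>2) / (T * e)\<^sup>2"
      using T e by (intro prob_sum_orthogonal_le meas int orth var) auto
    also have "\<dots> = 2 / e\<^sup>2 / real n"
      using T e elim by (simp add: power2_eq_square field_simps)
    finally show ?case .
  qed
  moreover have "(\<lambda>n. 2 / e\<^sup>2 / real n) \<longlonglongrightarrow> 0" by (rule lim_const_over_n)
  ultimately show "\<exists>h. h \<longlonglongrightarrow> 0 \<and>
      (\<forall>\<^sub>F n in sequentially. measure M {\<omega> \<in> space M. e \<le> dist (?C n \<omega>) d} \<le> h n)"
    by blast
qed

lemma wiener_variation:
  fixes W :: "real \<Rightarrow> 'a \<Rightarrow> real^'r"
  assumes W: "wiener_process M T W" and T: "0 < T"
  shows "tendsto_in_prob M (\<lambda>n \<omega>. cross_variation T n (\<lambda>t. W t \<omega> $ a) (\<lambda>t. W t \<omega> $ b)) (if a = b then 1 else 0)"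
proof (rule cross_variation_tendsto_in_prob[OF T])
  fix n k :: nat
  define D where "D k \<omega> = W (grid T n (Suc k)) \<omega> - W (grid T n k) \<omega>" for k \<omega>
  define \<phi> where "\<phi> x = x $ a * x $ b - (if a = b then 1 else 0) * (T / real n)" for x :: "real^'r"
  let ?Z = "\<lambda>k \<omega>. (W (grid T n (Suc k)) \<omega> $ a - W (grid T n k) \<omega> $ a)
    * (W (grid T n (Suc k)) \<omega> $ b - W (grid T n k) \<omega> $ b) - (if a = b then 1 else 0) * (T / real n)"
  have Z: "?Z k = (\<lambda>\<omega>. \<phi> (D k \<omega>))" for k by (simp add: \<phi>_def D_def)
  have [measurable]: "\<phi> \<in> borel_measurable borel" unfolding \<phi>_def by measurable
  have mom: "integrable M (?Z k)" "expectation (?Z k) = 0" "integrable M (\<lambda>\<omega>. ?Z k \<omega> * ?Z k \<omega>)"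
    "expectation (\<lambda>\<omega>. ?Z k \<omega> * ?Z k \<omega>) \<le> 2 * (T / real n)\<^sup>2" if "k < n" for k
  proof -
    have "0 < n" using that by simp
    have "0 < sqrt (T / real n)" using T that by simp
    note * = centred_product_moments[OF this wiener_increments(2)[OF W T \<open>0 < n\<close> that], of a b]
    have "(sqrt (T / real n))\<^sup>2 = T / real n" using T by simp
    with * show "integrable M (?Z k)" "expectation (?Z k) = 0" "integrable M (\<lambda>\<omega>. ?Z k \<omega> * ?Z k \<omega>)"
      "expectation (\<lambda>\<omega>. ?Z k \<omega> * ?Z k \<omega>) \<le> 2 * (T / real n)\<^sup>2" by simp_all
  qed
  show "?Z k \<in> borel_measurable M" if "k < n" using mom(1)[OF that] by (rule borel_measurable_integrable)
  have ind: "indep_vars (\<lambda>_. borel) ?Z {..<n}" if "0 < n"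
    unfolding Z using indep_vars_compose2[OF wiener_increments(1)[OF W T that], of "\<lambda>_. \<phi>" "\<lambda>_. borel"]
    by (simp add: D_def)
  fix i j
  assume ij: "i < n" "j < n"
  have pair: "integrable M (\<lambda>\<omega>. ?Z i \<omega> * ?Z j \<omega>)" "expectation (\<lambda>\<omega>. ?Z i \<omega> * ?Z j \<omega>) = 0" if "i \<noteq> j"
    using indep_vars_pair_expectation[OF ind, of i j] ij that mom by auto
  show "integrable M (\<lambda>\<omega>. ?Z i \<omega> * ?Z j \<omega>)" using pair(1) mom(3)[OF ij(1)] by (cases "i = j") auto
  show "i \<noteq> j \<Longrightarrow> expectation (\<lambda>\<omega>. ?Z i \<omega> * ?Z j \<omega>) = 0" by (rule pair(2))
next
  fix n i :: nat assume "i < n"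
  have "0 < sqrt (T / real n)" using T \<open>i < n\<close> by simp
  moreover have "0 < n" using \<open>i < n\<close> by simp
  ultimately show "expectation (\<lambda>\<omega>. ((W (grid T n (Suc i)) \<omega> $ a - W (grid T n i) \<omega> $ a)
    * (W (grid T n (Suc i)) \<omega> $ b - W (grid T n i) \<omega> $ b) - (if a = b then 1 else 0) * (T / real n))
    * ((W (grid T n (Suc i)) \<omega> $ a - W (grid T n i) \<omega> $ a)
    * (W (grid T n (Suc i)) \<omega> $ b - W (grid T n i) \<omega> $ b) - (if a = b then 1 else 0) * (T / real n)))
    \<le> 2 * (T / real n)\<^sup>2"
    using centred_product_moments(4)[OF _ wiener_increments(2)[OF W T _ \<open>i < n\<close>], of a b] T by simp
qed

lemma wiener_increment_products:
  fixes W :: "real \<Rightarrow> 'a \<Rightarrow> real^'r" and a :: 'r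
  assumes W: "wiener_process M T W" and T: "0 < T" and ij: "i < n" "j < n"
  defines "D \<equiv> \<lambda>k \<omega>. W (grid T n (Suc k)) \<omega> $ a - W (grid T n k) \<omega> $ a"
  shows "integrable M (\<lambda>\<omega>. D i \<omega> * D j \<omega>)"
    and "expectation (\<lambda>\<omega>. D i \<omega> * D j \<omega>) = (if i = j then T / real n else 0)"
proof -
  have n: "0 < n" using ij by simp
  have s: "0 < sqrt (T / real n)" "(sqrt (T / real n))\<^sup>2 = T / real n" using T n by simp_all
  have mom: "integrable M (\<lambda>\<omega>. D k \<omega> ^ p)" "expectation (D k) = 0" "expectation (\<lambda>\<omega>. (D k \<omega>)\<^sup>2) = T / real n"
    if "k < n" for k p
    using coordinate_moments(1-3)[OF s(1) wiener_increments(2)[OF W T n that], of a] s(2)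
    by (simp_all add: D_def)
  have ind: "indep_vars (\<lambda>_. borel) D {..<n}"
    using indep_vars_compose2[OF wiener_increments(1)[OF W T n], of "\<lambda>_ x. x $ a" "\<lambda>_. borel"]
    by (simp add: D_def)
  have int: "integrable M (D k)" if "k < n" for k using mom(1)[OF that, of 1] by simp
  have "integrable M (\<lambda>\<omega>. D i \<omega> * D j \<omega>) \<and>
    expectation (\<lambda>\<omega>. D i \<omega> * D j \<omega>) = (if i = j then T / real n else 0)"
  proof (cases "i = j")
    case True
    then show ?thesis using mom(1)[OF ij(1), of 2] mom(3)[OF ij(1)] by (simp add: power2_eq_square)
  next
    case False
    then show ?thesis
      using indep_vars_pair_expectation[OF ind _ _ False int int] ij mom(2)[OF ij(1)] by simp
  qed
  then show "integrable M (\<lambda>\<omega>. D i \<omega> * D j \<omega>)"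
    "expectation (\<lambda>\<omega>. D i \<omega> * D j \<omega>) = (if i = j then T / real n else 0)" by auto
qed

lemma indep_var_of_indep_sigma:
  fixes f g :: "'a \<Rightarrow> real"
  assumes ind: "indep_set (sets F) (sets G)"
    and F: "space F = space M" "f \<in> borel_measurable F"
    and G: "space G = space M" "g \<in> borel_measurable G"
  shows "indep_var borel f borel g"
proof -
  have sub: "{h -` A \<inter> space M | A. A \<in> sets borel} \<subseteq> sets H"
    if "space H = space M" "h \<in> borel_measurable H" for h :: "'a \<Rightarrow> real" and H :: "'a measure"
    using measurable_sets[OF that(2)] that(1) by auto
  have rv: "h \<in> borel_measurable M"
    if "space H = space M" "h \<in> borel_measurable H" "sets H \<subseteq> events" for h :: "'a \<Rightarrow> real" and H :: "'a measure"
  proof (rule measurableI)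
    fix A :: "real set" assume "A \<in> sets borel"
    from measurable_sets[OF that(2) this] show "h -` A \<inter> space M \<in> events"
      using that(1,3) by auto
  qed simp
  have sig: "sigma_sets (space M) {h -` A \<inter> space M | A. A \<in> sets borel} \<subseteq> sets H"
    if "space H = space M" "h \<in> borel_measurable H" for h :: "'a \<Rightarrow> real" and H :: "'a measure"
    using sets.sigma_sets_subset[OF sub[OF that]] that(1) by simp
  have sub_events: "sets F \<subseteq> events" "sets G \<subseteq> events"
    using ind by (auto simp: indep_sets2_eq)
  have "f \<in> borel_measurable M" by (rule rv[OF F sub_events(1)])
  moreover have "g \<in> borel_measurable M" by (rule rv[OF G sub_events(2)])
  moreover have "indep_set (sigma_sets (space M) {f -` A \<inter> space M | A. A \<in> sets borel})
      (sigma_sets (space M) {g -` A \<inter> space M | A. A \<in> sets borel})"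
  proof (rule indep_setI)
    fix u v assume "u \<in> sigma_sets (space M) {f -` A \<inter> space M | A. A \<in> sets borel}"
      "v \<in> sigma_sets (space M) {g -` A \<inter> space M | A. A \<in> sets borel}"
    then have "u \<in> sets F" "v \<in> sets G" using sig[OF F] sig[OF G] by blast+
    then show "prob (u \<inter> v) = prob u * prob v" by (rule indep_setD[OF ind])
  qed (rule order_trans[OF sig[OF F] sub_events(1)] order_trans[OF sig[OF G] sub_events(2)])+
  ultimately show ?thesis unfolding indep_var_eq by (intro conjI)
qed

text \<open>The \<open>\<sigma>\<close>-algebra generated by the process, as a measure space in which measurability of functions of the
  path can be stated.\<close>

definition process_algebra :: "real \<Rightarrow> (real \<Rightarrow> 'a \<Rightarrow> 'b::topological_space) \<Rightarrow> 'a measure" where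
  "process_algebra T W =
    sigma (space M) {W t -` A \<inter> space M | t A. t \<in> {0..T} \<and> A \<in> sets borel}"

lemma process_algebra:
  "space (process_algebra T W) = space M" "sets (process_algebra T W) = process_events M T W"
proof -
  have "{W t -` A \<inter> space M | t A. t \<in> {0..T} \<and> A \<in> sets borel} \<subseteq> Pow (space M)" by auto
  then show "space (process_algebra T W) = space M" "sets (process_algebra T W) = process_events M T W"
    unfolding process_algebra_def process_events_def by (rule space_measure_of sets_measure_of)+
qed

lemma process_algebra_coordinate_measurable:
  fixes W :: "real \<Rightarrow> 'a \<Rightarrow> real^'r"
  assumes "t \<in> {0..T}"
  shows "(\<lambda>\<omega>. W t \<omega> $ a) \<in> borel_measurable (process_algebra T W)"
proof (intro borel_measurable_coordinate measurableI)
  fix A assume "A \<in> sets (borel :: (real^'r) measure)"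
  then show "W t -` A \<inter> space (process_algebra T W) \<in> sets (process_algebra T W)"
    unfolding process_algebra process_events_def using assms by (intro sigma_sets.Basic) blast
qed simp

text \<open>The expectation of a product of four increments, two from each process, factorises over the processes, and
  in each factor increments over different intervals are orthogonal.\<close>

lemma independent_wiener_variation:
  fixes W :: "real \<Rightarrow> 'a \<Rightarrow> real^'r" and W' :: "real \<Rightarrow> 'a \<Rightarrow> real^'s"
  assumes W: "wiener_process M T W" and W': "wiener_process M T W'" and T: "0 < T"
    and ind: "indep_set (process_events M T W) (process_events M T W')"
  shows "tendsto_in_prob M (\<lambda>n \<omega>. cross_variation T n (\<lambda>t. W t \<omega> $ a) (\<lambda>t. W' t \<omega> $ b)) 0"
proof (rule cross_variation_tendsto_in_prob[OF T])
  fix n :: nat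
  define D where "D k \<omega> = W (grid T n (Suc k)) \<omega> $ a - W (grid T n k) \<omega> $ a" for k \<omega>
  define D' where "D' k \<omega> = W' (grid T n (Suc k)) \<omega> $ b - W' (grid T n k) \<omega> $ b" for k \<omega>
  let ?Z = "\<lambda>k \<omega>. (W (grid T n (Suc k)) \<omega> $ a - W (grid T n k) \<omega> $ a)
    * (W' (grid T n (Suc k)) \<omega> $ b - W' (grid T n k) \<omega> $ b) - 0 * (T / real n)"
  have ZZ: "?Z i \<omega> * ?Z j \<omega> = (D i \<omega> * D j \<omega>) * (D' i \<omega> * D' j \<omega>)" for i j \<omega>
    by (simp add: D_def D'_def)
  have meas: "D k \<in> borel_measurable (process_algebra T W)" "D' k \<in> borel_measurable (process_algebra T W')"
    if "k < n" for k
  proof -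
    have "grid T n k \<in> {0..T}" "grid T n (Suc k) \<in> {0..T}" using grid_in[OF T] that by auto
    then show "D k \<in> borel_measurable (process_algebra T W)" "D' k \<in> borel_measurable (process_algebra T W')"
      unfolding D_def D'_def
      by (auto intro!: borel_measurable_diff process_algebra_coordinate_measurable)
  qed
  have mom: "integrable M (\<lambda>\<omega>. ?Z i \<omega> * ?Z j \<omega>)"
    "expectation (\<lambda>\<omega>. ?Z i \<omega> * ?Z j \<omega>) = (if i = j then (T / real n)\<^sup>2 else 0)" if ij: "i < n" "j < n" for i j
  proof -
    have indep: "indep_var borel (\<lambda>\<omega>. D i \<omega> * D j \<omega>) borel (\<lambda>\<omega>. D' i \<omega> * D' j \<omega>)"
      using ind meas[OF ij(1)] meas[OF ij(2)]
      by (intro indep_var_of_indep_sigma[of "process_algebra T W" "process_algebra T W'"])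
         (auto simp: process_algebra)
    note m = wiener_increment_products[OF W T ij, of a, folded D_def]
    note m' = wiener_increment_products[OF W' T ij, of b, folded D'_def]
    show "integrable M (\<lambda>\<omega>. ?Z i \<omega> * ?Z j \<omega>)"
      unfolding ZZ by (rule indep_var_integrable[OF indep m(1) m'(1)])
    show "expectation (\<lambda>\<omega>. ?Z i \<omega> * ?Z j \<omega>) = (if i = j then (T / real n)\<^sup>2 else 0)"
      unfolding ZZ indep_var_lebesgue_integral[OF indep m(1) m'(1)] m(2) m'(2)
      by (simp add: power2_eq_square)
  qed
  show "?Z k \<in> borel_measurable M" if "k < n" for k
  proof -
    have "W t \<in> borel_measurable M" "W' t \<in> borel_measurable M" if "t \<in> {0..T}" for t
      using W W' that by (auto simp: wiener_process_def)
    moreover have "grid T n k \<in> {0..T}" "grid T n (Suc k) \<in> {0..T}" using grid_in[OF T] that by auto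
    ultimately show ?thesis
      by (intro borel_measurable_diff borel_measurable_times borel_measurable_coordinate borel_measurable_const) auto
  qed
  fix i j assume ij: "i < n" "j < n"
  show "integrable M (\<lambda>\<omega>. ?Z i \<omega> * ?Z j \<omega>)" by (rule mom(1)[OF ij])
  show "i \<noteq> j \<Longrightarrow> expectation (\<lambda>\<omega>. ?Z i \<omega> * ?Z j \<omega>) = 0" using mom(2)[OF ij] by simp
  show "expectation (\<lambda>\<omega>. ?Z i \<omega> * ?Z i \<omega>) \<le> 2 * (T / real n)\<^sup>2" using mom(2)[OF ij(1,1)] by simp
qed

end

section \<open>Consistency of the realised covariance\<close>

lemma borel_measurable_vecI:
  fixes f :: "'w \<Rightarrow> 'b::euclidean_space^'n"
  assumes "\<And>i. (\<lambda>\<omega>. f \<omega> $ i) \<in> borel_measurable M"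
  shows "f \<in> borel_measurable M"
proof (rule borel_measurable_euclidean_space[THEN iffD2], rule ballI)
  fix e :: "'b^'n" assume "e \<in> Basis"
  then obtain i u where "e = axis i u" by (auto simp: Basis_vec_def)
  then have "(\<lambda>\<omega>. f \<omega> \<bullet> e) = (\<lambda>\<omega>. f \<omega> $ i \<bullet> u)" by (simp add: inner_axis)
  then show "(\<lambda>\<omega>. f \<omega> \<bullet> e) \<in> borel_measurable M"
    using assms[of i] by simp
qed

lemma realized_cov_measurable:
  fixes X :: "real \<Rightarrow> 'w \<Rightarrow> real^'n"
  assumes T: "0 < T" and X: "\<And>t. t \<in> {0..T} \<Longrightarrow> X t \<in> borel_measurable M"
  shows "(\<lambda>\<omega>. realized_cov T n (\<lambda>t. X t \<omega>)) \<in> borel_measurable M"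
proof (intro borel_measurable_vecI)
  fix i j
  have "(\<lambda>\<omega>. X (grid T n k) \<omega> $ l) \<in> borel_measurable M" if "k \<le> n" for k l
    by (intro borel_measurable_coordinate X grid_in T that)
  then show "(\<lambda>\<omega>. realized_cov T n (\<lambda>t. X t \<omega>) $ i $ j) \<in> borel_measurable M"
    unfolding realized_cov_nth cross_variation_def
    by (intro borel_measurable_times borel_measurable_sum borel_measurable_diff borel_measurable_const) auto
qed

context prob_space
begin

lemma indep_sets_pair:
  assumes ind: "indep_sets E I" and ij: "i \<in> I" "j \<in> I" "i \<noteq> j"
  shows "indep_set (E i) (E j)"
proof (rule indep_setI)
  show "E i \<subseteq> events" "E j \<subseteq> events" using ind ij by (auto simp: indep_sets_def)
  fix u v assume "u \<in> E i" "v \<in> E j"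
  then show "prob (u \<inter> v) = prob u * prob v"
    using indep_setsD[OF ind, of "{i, j}" "\<lambda>k. if k = i then u else v"] ij by (simp add: Int_commute)
qed

lemma stacked_wiener_variation:
  fixes W1 :: "real \<Rightarrow> 'a \<Rightarrow> real^'r1" and W2 :: "real \<Rightarrow> 'a \<Rightarrow> real^'r2"
    and W3 :: "real \<Rightarrow> 'a \<Rightarrow> real^'r3" and W4 :: "real \<Rightarrow> 'a \<Rightarrow> real^'r4"
  assumes T: "0 < T"
    and W: "wiener_process M T W1" "wiener_process M T W2" "wiener_process M T W3" "wiener_process M T W4"
    and ind: "indep_sets ((!) [process_events M T W1, process_events M T W2,
                 process_events M T W3, process_events M T W4]) {..<4}"
  shows "tendsto_in_prob M (\<lambda>n \<omega>. realized_cov T n (\<lambda>t. join_vec (join_vec (W1 t \<omega>) (W2 t \<omega>)) (join_vec (W3 t \<omega>) (W4 t \<omega>))))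
    (mat 1)"
proof -
  let ?w = "\<lambda>t \<omega>. join_vec (join_vec (W1 t \<omega>) (W2 t \<omega>)) (join_vec (W3 t \<omega>) (W4 t \<omega>))"
  have meas: "?w t \<in> borel_measurable M" if "t \<in> {0..T}" for t
  proof (rule borel_measurable_vecI)
    fix i
    have "W1 t \<in> borel_measurable M" "W2 t \<in> borel_measurable M" "W3 t \<in> borel_measurable M" "W4 t \<in> borel_measurable M"
      using W that by (auto simp: wiener_process_def)
    then have "\<forall>i. (\<lambda>\<omega>. ?w t \<omega> $ i) \<in> borel_measurable M"
      by (simp add: split_sum_all borel_measurable_coordinate)
    then show "(\<lambda>\<omega>. ?w t \<omega> $ i) \<in> borel_measurable M" ..
  qed
  note pair = indep_sets_pair[OF ind]
  have i12: "indep_set (process_events M T W1) (process_events M T W2)" using pair[of 0 1] by simp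
  have i13: "indep_set (process_events M T W1) (process_events M T W3)" using pair[of 0 2] by simp
  have i14: "indep_set (process_events M T W1) (process_events M T W4)" using pair[of 0 3] by simp
  have i23: "indep_set (process_events M T W2) (process_events M T W3)" using pair[of 1 2] by simp
  have i24: "indep_set (process_events M T W2) (process_events M T W4)" using pair[of 1 3] by simp
  have i34: "indep_set (process_events M T W3) (process_events M T W4)" using pair[of 2 3] by simp
  note cross = independent_wiener_variation[OF W(1) W(2) T i12] independent_wiener_variation[OF W(1) W(3) T i13]
    independent_wiener_variation[OF W(1) W(4) T i14] independent_wiener_variation[OF W(2) W(3) T i23]
    independent_wiener_variation[OF W(2) W(4) T i24] independent_wiener_variation[OF W(3) W(4) T i34]
  have swap: "tendsto_in_prob M (\<lambda>n \<omega>. cross_variation T n (\<lambda>t. g t \<omega>) (\<lambda>t. f t \<omega>)) c"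
    if "tendsto_in_prob M (\<lambda>n \<omega>. cross_variation T n (\<lambda>t. f t \<omega>) (\<lambda>t. g t \<omega>)) c" for f g c
    unfolding cross_variation_commute[of T _ "\<lambda>t. g t \<omega>" for \<omega>] by (rule that)
  note same = W[THEN wiener_variation[OF _ T]]
  have entries: "\<forall>i j. tendsto_in_prob M (\<lambda>n \<omega>. realized_cov T n (\<lambda>t. ?w t \<omega>) $ i $ j) (mat 1 $ i $ j)"
    unfolding split_sum_all realized_cov_nth join_vec_nth
    by (intro conjI allI; simp only: mat_def vec_lambda_beta sum.inject sum.distinct if_False;
      rule same cross cross[THEN swap])
  have mQ: "(\<lambda>\<omega>. realized_cov T n (\<lambda>t. ?w t \<omega>)) \<in> borel_measurable M" for n
    by (rule realized_cov_measurable[OF T meas])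
  have row: "(\<lambda>x :: real^(('r1+'r2)+('r3+'r4))^(('r1+'r2)+('r3+'r4)). x $ i) \<in> borel_measurable borel" for i
    by (intro borel_measurable_continuous_onI continuous_intros)
  have mrow: "(\<lambda>\<omega>. realized_cov T n (\<lambda>t. ?w t \<omega>) $ i) \<in> borel_measurable M" for n i
    by (rule measurable_compose[OF mQ row])
  show ?thesis
    by (intro tendsto_in_prob_vec borel_measurable_coordinate mrow entries[rule_format])
qed

end

text \<open>Since the diffusion coefficient is constant, \<open>Y - S W\<close> is the integral of the path of \<open>b \<circ> Y\<close>, which is
  continuous and so bounded on \<open>[0, T]\<close>, by a bound that depends on \<open>\<omega>\<close>.\<close>

lemma drift_part_lipschitz:
  assumes sde: "solves_sde M T b S W y0 Y" and b: "L-lipschitz_on UNIV b"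
  shows "AE \<omega> in M. \<exists>K. K-lipschitz_on {0..T} (\<lambda>t. Y t \<omega> - S *v W t \<omega>)"
proof -
  have "AE \<omega> in M. continuous_on {0..T} (\<lambda>t. Y t \<omega>) \<and>
        (\<forall>t\<in>{0..T}. Y t \<omega> = y0 + integral {0..t} (\<lambda>s. b (Y s \<omega>)) + S *v W t \<omega>)"
    using sde by (simp add: solves_sde_def)
  then show ?thesis
  proof eventually_elim
    case (elim \<omega>)
    let ?f = "\<lambda>s. b (Y s \<omega>)"
    have f: "continuous_on {0..T} ?f"
      using elim lipschitz_on_continuous_on[OF b] by (auto intro: continuous_on_compose2)
    then have "bounded (?f ` {0..T})"
      by (intro compact_imp_bounded compact_continuous_image) auto
    then obtain K where K: "\<And>s. s \<in> {0..T} \<Longrightarrow> norm (?f s) \<le> K"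
      unfolding bounded_iff by blast
    have int: "norm (integral {0..t} ?f - integral {0..s} ?f) \<le> K * (t - s)" if "0 \<le> s" "s \<le> t" "t \<le> T" for s t
    proof -
      have "?f integrable_on {0..t}"
        using that by (intro integrable_continuous_real continuous_on_subset[OF f]) auto
      then have "integral {0..s} ?f + integral {s..t} ?f = integral {0..t} ?f"
        using that by (intro Henstock_Kurzweil_Integration.integral_combine)
      moreover have "norm (integral {s..t} ?f) \<le> K * (t - s)"
        using that K by (intro integral_bound continuous_on_subset[OF f]) auto
      ultimately show ?thesis by (metis add_diff_cancel_left')
    qed
    have "\<bar>K\<bar>-lipschitz_on {0..T} (\<lambda>t. Y t \<omega> - S *v W t \<omega>)"
    proof (rule lipschitz_onI)
      fix s t assume st: "s \<in> {0..T}" "t \<in> {0..T}"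
      have "norm (integral {0..s} ?f - integral {0..t} ?f) \<le> \<bar>K\<bar> * \<bar>s - t\<bar>"
      proof (cases "s \<le> t")
        case True
        have "norm (integral {0..s} ?f - integral {0..t} ?f) \<le> K * (t - s)"
          using int[of s t] st True by (simp add: norm_minus_commute)
        also have "\<dots> \<le> \<bar>K\<bar> * \<bar>s - t\<bar>" using True by (intro mult_mono) auto
        finally show ?thesis .
      next
        case False
        then have "norm (integral {0..s} ?f - integral {0..t} ?f) \<le> K * (s - t)"
          using int[of t s] st by simp
        also have "\<dots> \<le> \<bar>K\<bar> * \<bar>s - t\<bar>" using False by (intro mult_mono) auto
        finally show ?thesis .
      qed
      moreover have "Y r \<omega> - S *v W r \<omega> = y0 + integral {0..r} ?f" if "r \<in> {0..T}" for r
        using elim that by (metis add_diff_cancel_right')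
      ultimately show "dist (Y s \<omega> - S *v W s \<omega>) (Y t \<omega> - S *v W t \<omega>) \<le> \<bar>K\<bar> * dist s t"
        using st by (simp add: dist_norm)
    qed simp
    then show ?case by blast
  qed
qed

lemma matrix_vector_lipschitz:
  fixes A :: "real^'n^'m"
  assumes "\<exists>K. K-lipschitz_on U f"
  shows "\<exists>K. K-lipschitz_on U (\<lambda>t. A *v f t)"
proof -
  obtain K where K: "K-lipschitz_on U f" using assms by blast
  have "(onorm ((*v) A) * K)-lipschitz_on U (\<lambda>t. A *v f t)"
  proof (rule lipschitz_onI)
    fix s t assume "s \<in> U" "t \<in> U"
    then have "dist (f s) (f t) \<le> K * dist s t" by (rule lipschitz_onD[OF K])
    then have "onorm ((*v) A) * dist (f s) (f t) \<le> onorm ((*v) A) * (K * dist s t)"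
      by (intro mult_left_mono onorm_pos_le) simp_all
    moreover have "dist (A *v f s) (A *v f t) \<le> onorm ((*v) A) * dist (f s) (f t)"
      using onorm[of "(*v) A" "f s - f t"] by (simp add: dist_norm matrix_vector_mult_diff_distrib)
    ultimately show "dist (A *v f s) (A *v f t) \<le> onorm ((*v) A) * K * dist s t"
      by (simp add: mult.assoc)
  qed (use lipschitz_on_nonneg[OF K] in \<open>simp add: onorm_pos_le\<close>)
  then show ?thesis by blast
qed

lemma add_lipschitz:
  fixes f g :: "'a::metric_space \<Rightarrow> 'b::real_normed_vector"
  assumes "\<exists>K. K-lipschitz_on U f" "\<exists>K. K-lipschitz_on U g"
  shows "\<exists>K. K-lipschitz_on U (\<lambda>t. f t + g t)"
  using assms lipschitz_on_add by blast

lemma norm_join_vec_le: "norm (join_vec x y) \<le> norm x + norm y"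
  for x :: "real^'a" and y :: "real^'b"
proof -
  have "(norm (join_vec x y))\<^sup>2 = (norm x)\<^sup>2 + (norm y)\<^sup>2"
    by (simp add: dot_square_norm[symmetric] inner_join_vec)
  also have "\<dots> \<le> (norm x + norm y)\<^sup>2" by (simp add: power2_sum)
  finally show ?thesis by (rule power2_le_imp_le) simp
qed

lemma join_vec_lipschitz:
  fixes f :: "'t::metric_space \<Rightarrow> real^'a" and g :: "'t \<Rightarrow> real^'b"
  assumes "\<exists>K. K-lipschitz_on U f" "\<exists>K. K-lipschitz_on U g"
  shows "\<exists>K. K-lipschitz_on U (\<lambda>t. join_vec (f t) (g t))"
proof -
  obtain K L where K: "K-lipschitz_on U f" and L: "L-lipschitz_on U g" using assms by blast
  have "(K + L)-lipschitz_on U (\<lambda>t. join_vec (f t) (g t))"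
  proof (rule lipschitz_onI)
    fix s t assume st: "s \<in> U" "t \<in> U"
    have "join_vec (f s) (g s) - join_vec (f t) (g t) = join_vec (f s - f t) (g s - g t)"
      by (simp add: join_vec_eq_iff)
    then have "dist (join_vec (f s) (g s)) (join_vec (f t) (g t)) \<le> dist (f s) (f t) + dist (g s) (g t)"
      using norm_join_vec_le[of "f s - f t" "g s - g t"] by (simp add: dist_norm)
    also have "\<dots> \<le> K * dist s t + L * dist s t"
      using st by (intro add_mono lipschitz_onD[OF K] lipschitz_onD[OF L])
    finally show "dist (join_vec (f s) (g s)) (join_vec (f t) (g t)) \<le> (K + L) * dist s t"
      by (simp add: algebra_simps)
  qed (use lipschitz_on_nonneg[OF K] lipschitz_on_nonneg[OF L] in simp)
  then show ?thesis by blast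
qed

lemma join_vec_continuous:
  fixes f :: "'t::topological_space \<Rightarrow> real^'a" and g :: "'t \<Rightarrow> real^'b"
  assumes "continuous_on U f" "continuous_on U g"
  shows "continuous_on U (\<lambda>t. join_vec (f t) (g t))"
  unfolding join_vec_def
proof (rule continuous_on_vec_lambda)
  fix i :: "'a + 'b"
  show "continuous_on U (\<lambda>t. case i of Inl a \<Rightarrow> f t $ a | Inr b \<Rightarrow> g t $ b)"
    using assms by (cases i) (auto intro: continuous_on_component)
qed

text \<open>The observation is a Lipschitz path plus \<open>noise_matrix m \<theta>\<close> times the stacked Wiener process. The Lipschitz
  part changes the realised covariance by a term that tends to \<open>0\<close> for almost every \<open>\<omega>\<close>; the covariance of the
  Wiener part tends in probability to the Gram matrix of the noise matrix.\<close>

lemma (in prob_space) realized_cov_consistent: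
  fixes m :: "('p1::finite, 'p2::finite, 'k1::finite, 'k2::finite, 'q::finite,
               'r1::finite, 'r2::finite, 'r3::finite, 'r4::finite) sem"
    and W1 :: "real \<Rightarrow> 'a \<Rightarrow> real^'r1" and W2 :: "real \<Rightarrow> 'a \<Rightarrow> real^'r2"
    and W3 :: "real \<Rightarrow> 'a \<Rightarrow> real^'r3" and W4 :: "real \<Rightarrow> 'a \<Rightarrow> real^'r4"
    and \<xi> :: "real \<Rightarrow> 'a \<Rightarrow> real^'k1" and \<delta> :: "real \<Rightarrow> 'a \<Rightarrow> real^'p1"
    and \<epsilon> :: "real \<Rightarrow> 'a \<Rightarrow> real^'p2" and \<zeta> \<eta> :: "real \<Rightarrow> 'a \<Rightarrow> real^'k2"
    and X :: "real \<Rightarrow> 'a \<Rightarrow> real^('p1 + 'p2)"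
  assumes T: "0 < T" and m: "is_sem m" "regular_sem m" "\<theta> \<in> Theta m"
    and W: "wiener_process M T W1" "wiener_process M T W2" "wiener_process M T W3" "wiener_process M T W4"
    and ind: "indep_sets ((!) [process_events M T W1, process_events M T W2,
                 process_events M T W3, process_events M T W4]) {..<4}"
    and sde: "solves_sde M T B1 (S1 m \<theta>) W1 \<xi>0 \<xi>" "solves_sde M T B2 (S2 m \<theta>) W2 \<delta>0 \<delta>"
        "solves_sde M T B3 (S3 m \<theta>) W3 \<epsilon>0 \<epsilon>" "solves_sde M T B4 (S4 m \<theta>) W4 \<zeta>0 \<zeta>"
    and lip: "\<exists>L. L-lipschitz_on UNIV B1" "\<exists>L. L-lipschitz_on UNIV B2"
        "\<exists>L. L-lipschitz_on UNIV B3" "\<exists>L. L-lipschitz_on UNIV B4"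
    and \<eta>: "\<And>t \<omega>. t \<in> {0..T} \<Longrightarrow> \<omega> \<in> space M \<Longrightarrow>
           \<eta> t \<omega> = B0 m \<theta> *v \<eta> t \<omega> + Gamma_mat m \<theta> *v \<xi> t \<omega> + \<zeta> t \<omega>"
    and X: "\<And>t \<omega>. t \<in> {0..T} \<Longrightarrow> \<omega> \<in> space M \<Longrightarrow>
           X t \<omega> = join_vec (Lx1 m \<theta> *v \<xi> t \<omega> + \<delta> t \<omega>) (Lx2 m \<theta> *v \<eta> t \<omega> + \<epsilon> t \<omega>)"
  shows "\<And>t. t \<in> {0..T} \<Longrightarrow> X t \<in> borel_measurable M"
    and "tendsto_in_prob M (\<lambda>n \<omega>. realized_cov T n (\<lambda>t. X t \<omega>)) (Sigma_cov m \<theta>)"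
proof -
  define G where "G = noise_matrix m \<theta>"
  define w where "w t \<omega> = join_vec (join_vec (W1 t \<omega>) (W2 t \<omega>)) (join_vec (W3 t \<omega>) (W4 t \<omega>))" for t \<omega>
  define K where "K = matrix_inv (Psi m \<theta>)"
  have inv: "invertible (Psi m \<theta>)" using m by (simp add: regular_sem_def)
  have \<eta>_eq: "\<eta> t \<omega> = K *v (Gamma_mat m \<theta> *v \<xi> t \<omega> + \<zeta> t \<omega>)" if "t \<in> {0..T}" "\<omega> \<in> space M" for t \<omega>
  proof -
    have "Psi m \<theta> *v \<eta> t \<omega> = Gamma_mat m \<theta> *v \<xi> t \<omega> + \<zeta> t \<omega>"
      using \<eta>[OF that] by (simp add: B0_def matrix_vector_mult_diff_rdistrib algebra_simps)
    moreover have "K ** Psi m \<theta> = mat 1"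
      using inv unfolding K_def by (metis invertible_def matrix_inv_eqI)
    ultimately show ?thesis by (metis matrix_vector_mul_assoc matrix_vector_mul_lid)
  qed
  \<comment> \<open>\<open>A\<close> maps the four latent vectors to the observation. It is linear, so it can be applied separately to the
    drift parts and to the noise parts of the latent processes.\<close>
  define A where "A a b c d = join_vec (Lx1 m \<theta> *v a + b) (Lx2 m \<theta> *v (K *v (Gamma_mat m \<theta> *v a + d)) + c)"
    for a b c d
  define r where "r t \<omega> = A (\<xi> t \<omega> - S1 m \<theta> *v W1 t \<omega>) (\<delta> t \<omega> - S2 m \<theta> *v W2 t \<omega>)
      (\<epsilon> t \<omega> - S3 m \<theta> *v W3 t \<omega>) (\<zeta> t \<omega> - S4 m \<theta> *v W4 t \<omega>)" for t \<omega>
  have X_A: "X t \<omega> = A (\<xi> t \<omega>) (\<delta> t \<omega>) (\<epsilon> t \<omega>) (\<zeta> t \<omega>)" if "t \<in> {0..T}" "\<omega> \<in> space M" for t \<omega>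
    using X[OF that] \<eta>_eq[OF that] by (simp add: A_def)
  have decomposition: "X t \<omega> = r t \<omega> + G *v w t \<omega>" if "t \<in> {0..T}" "\<omega> \<in> space M" for t \<omega>
    unfolding X_A[OF that] r_def A_def G_def w_def noise_matrix_vector join_vec_add K_def
    by (simp add: matrix_vector_right_distrib matrix_vector_mult_diff_distrib algebra_simps)

  have vec: "(\<lambda>\<omega>. f \<omega> + C *v g \<omega>) \<in> borel_measurable M"
    if "f \<in> borel_measurable M" "g \<in> borel_measurable M"
    for f :: "'a \<Rightarrow> real^'x" and C :: "real^'y^'x" and g :: "'a \<Rightarrow> real^'y"
  proof -
    have "(\<lambda>x. C *v x) \<in> borel_measurable borel"
      by (intro borel_measurable_continuous_onI continuous_intros)
    then show ?thesis using that by (intro borel_measurable_add measurable_compose[OF that(2)])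
  qed
  show X_meas: "X t \<in> borel_measurable M" if t: "t \<in> {0..T}" for t
  proof -
    have Y: "\<xi> t \<in> borel_measurable M" "\<delta> t \<in> borel_measurable M" "\<epsilon> t \<in> borel_measurable M" "\<zeta> t \<in> borel_measurable M"
      using sde t by (auto simp: solves_sde_def)
    have "(\<lambda>\<omega>. A (\<xi> t \<omega>) (\<delta> t \<omega>) (\<epsilon> t \<omega>) (\<zeta> t \<omega>)) \<in> borel_measurable M"
    proof (rule borel_measurable_vecI)
      fix i
      have "(\<lambda>\<omega>. \<delta> t \<omega> + Lx1 m \<theta> *v \<xi> t \<omega>) \<in> borel_measurable M"
        "(\<lambda>\<omega>. \<epsilon> t \<omega> + (Lx2 m \<theta> ** K) *v (\<zeta> t \<omega> + Gamma_mat m \<theta> *v \<xi> t \<omega>)) \<in> borel_measurable M"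
        by (intro vec Y)+
      then have "(\<lambda>\<omega>. Lx1 m \<theta> *v \<xi> t \<omega> + \<delta> t \<omega>) \<in> borel_measurable M"
        "(\<lambda>\<omega>. Lx2 m \<theta> *v (K *v (Gamma_mat m \<theta> *v \<xi> t \<omega> + \<zeta> t \<omega>)) + \<epsilon> t \<omega>) \<in> borel_measurable M"
        by (simp_all add: add.commute matrix_vector_mul_assoc[symmetric])
      from this[THEN borel_measurable_coordinate]
      show "(\<lambda>\<omega>. A (\<xi> t \<omega>) (\<delta> t \<omega>) (\<epsilon> t \<omega>) (\<zeta> t \<omega>) $ i) \<in> borel_measurable M"
        by (cases i) (simp_all add: A_def)
    qed
    then show ?thesis using X_A[OF t] by (subst measurable_cong) auto
  qed

  have w_meas: "w t \<in> borel_measurable M" if "t \<in> {0..T}" for t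
  proof (rule borel_measurable_vecI)
    fix i
    have "W1 t \<in> borel_measurable M" "W2 t \<in> borel_measurable M" "W3 t \<in> borel_measurable M" "W4 t \<in> borel_measurable M"
      using W that by (auto simp: wiener_process_def)
    then have "\<forall>i. (\<lambda>\<omega>. w t \<omega> $ i) \<in> borel_measurable M"
      by (simp add: w_def split_sum_all borel_measurable_coordinate)
    then show "(\<lambda>\<omega>. w t \<omega> $ i) \<in> borel_measurable M" ..
  qed
  define Q where "Q n \<omega> = realized_cov T n (\<lambda>t. X t \<omega>)" for n \<omega>
  define R where "R n \<omega> = realized_cov T n (\<lambda>t. w t \<omega>)" for n \<omega>
  have Q_meas: "Q n \<in> borel_measurable M" for n
    unfolding Q_def by (rule realized_cov_measurable[OF T X_meas])
  have R_meas: "R n \<in> borel_measurable M" for n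
    unfolding R_def by (rule realized_cov_measurable[OF T w_meas])
  have cong: "isCont (\<lambda>A. G ** A ** transpose G) B" for B
    by (intro linear_continuous_at linear_conv_bounded_linear[THEN iffD1] linear_congruence)
  have "tendsto_in_prob M R (mat 1)"
    unfolding R_def w_def by (rule stacked_wiener_variation[OF T W ind])
  from tendsto_in_prob_continuous[OF this R_meas cong]
  have noise: "tendsto_in_prob M (\<lambda>n \<omega>. G ** R n \<omega> ** transpose G) (Sigma_cov m \<theta>)"
    by (simp add: Sigma_cov_eq_gram[OF m(1,3)] G_def)
  have noise_meas: "(\<lambda>\<omega>. G ** R n \<omega> ** transpose G) \<in> borel_measurable M" for n
    by (rule measurable_compose[OF R_meas borel_measurable_continuous_onI])
       (simp add: continuous_at_imp_continuous_on cong)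

  have "AE \<omega> in M. (\<lambda>n. Q n \<omega> - G ** R n \<omega> ** transpose G) \<longlonglongrightarrow> 0"
  proof -
    have cont: "AE \<omega> in M. continuous_on {0..T} (\<lambda>t. W t \<omega>)" if "wiener_process M T W"
      for W :: "real \<Rightarrow> 'a \<Rightarrow> real^'x"
      using that by (simp add: wiener_process_def)
    have drift: "AE \<omega> in M. \<exists>K. K-lipschitz_on {0..T} (\<lambda>t. Y t \<omega> - S *v W t \<omega>)"
      if "solves_sde M T b S W y0 Y" "\<exists>L. L-lipschitz_on UNIV b"
      for Y :: "real \<Rightarrow> 'a \<Rightarrow> real^'x" and S :: "real^'y^'x" and W b y0
      using that drift_part_lipschitz by blast
    show ?thesis
      using cont[OF W(1)] cont[OF W(2)] cont[OF W(3)] cont[OF W(4)]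
        drift[OF sde(1) lip(1)] drift[OF sde(2) lip(2)] drift[OF sde(3) lip(3)] drift[OF sde(4) lip(4)]
        AE_space
    proof eventually_elim
      case (elim \<omega>)
      have "\<exists>K. K-lipschitz_on {0..T} (\<lambda>t. r t \<omega>)"
        unfolding r_def A_def
        by (intro join_vec_lipschitz add_lipschitz matrix_vector_lipschitz elim)
      then obtain C where r: "C-lipschitz_on {0..T} (\<lambda>t. r t \<omega>)" by blast
      have "continuous_on {0..T} (\<lambda>t. w t \<omega>)"
        unfolding w_def by (intro join_vec_continuous elim)
      then have "continuous_on {0..T} (\<lambda>t. G *v w t \<omega>)"
        by (intro continuous_on_compose2[OF matrix_vector_mult_linear_continuous_on[of UNIV]]) auto
      note realized_cov_add_lipschitz[OF T r this]
      moreover have "Q n \<omega> = realized_cov T n (\<lambda>t. r t \<omega> + G *v w t \<omega>)" for n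
        unfolding Q_def using decomposition elim by (intro realized_cov_cong[OF T]) auto
      ultimately show ?case
        by (simp add: R_def realized_cov_linear_image)
    qed
  qed
  then have "tendsto_in_prob M (\<lambda>n \<omega>. Q n \<omega> - G ** R n \<omega> ** transpose G) 0"
    by (rule tendsto_in_prob_AE) (intro borel_measurable_diff Q_meas noise_meas)
  from tendsto_in_prob_add[OF this noise borel_measurable_diff[OF Q_meas noise_meas] noise_meas]
  show "tendsto_in_prob M (\<lambda>n \<omega>. realized_cov T n (\<lambda>t. X t \<omega>)) (Sigma_cov m \<theta>)"
    by (simp add: Q_def)
qed

section \<open>Measurability of the minimal contrast\<close>

lemma continuous_on_F_fun:
  fixes Y :: "real^'n^'n"
  shows "continuous_on {A. 0 < det A} (\<lambda>A. F_fun A Y)"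
proof -
  have "continuous_on {A :: real^'n^'n. 0 < det A} det"
    by (simp add: continuous_at_imp_continuous_on continuous_det)
  moreover have "continuous_on S (\<lambda>A :: real^'n^'n. trace (matrix_inv Y ** A))" for S
    unfolding trace_def matrix_matrix_mult_def by (simp, intro continuous_intros)
  ultimately show ?thesis
    unfolding F_fun_def by (intro continuous_intros) auto
qed

lemma contrast_singular:
  "\<not> invertible Q \<Longrightarrow> contrast Q S = (vech Q - vech S) \<bullet> (vech Q - vech S)"
  by (simp add: contrast_def V_tilde_def)

text \<open>The minimal contrast is below \<open>d\<close> exactly on the preimage of a union of open sets, one for each candidate
  \<open>\<theta>\<close>. A union of open sets is open however many candidates there are, so the minimum is measurable even if the
  minimiser is not.\<close>

lemma minimal_contrast_measurable:
  fixes Q :: "'w \<Rightarrow> real^'n^'n" and Y :: "'t \<Rightarrow> real^'n^'n"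
  assumes Q: "Q \<in> borel_measurable M"
    and sym: "\<And>\<omega>. \<omega> \<in> space M \<Longrightarrow> transpose (Q \<omega>) = Q \<omega>"
    and pd: "\<And>\<omega>. \<omega> \<in> space M \<Longrightarrow> invertible (Q \<omega>) \<Longrightarrow> pos_def (Q \<omega>)"
    and Y: "\<And>\<theta>. \<theta> \<in> \<Theta> \<Longrightarrow> pos_def (Y \<theta>)"
    and attained: "\<And>\<omega>. \<omega> \<in> space M \<Longrightarrow> \<exists>\<theta>\<in>\<Theta>. f \<omega> = contrast (Q \<omega>) (Y \<theta>)"
    and minimal: "\<And>\<omega> \<theta>. \<omega> \<in> space M \<Longrightarrow> \<theta> \<in> \<Theta> \<Longrightarrow> f \<omega> \<le> contrast (Q \<omega>) (Y \<theta>)"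
  shows "f \<in> borel_measurable M"
proof (rule borel_measurable_iff_less[THEN iffD2], rule allI)
  fix d :: real
  let ?U = "{A :: real^'n^'n. 0 < det A}"
  define O1 where "O1 = (\<Union>\<theta>\<in>\<Theta>. ?U \<inter> (\<lambda>A. F_fun A (Y \<theta>)) -` {..<d})"
  define O2 where "O2 = (\<Union>\<theta>\<in>\<Theta>. {x. (x - vech (Y \<theta>)) \<bullet> (x - vech (Y \<theta>)) < d})"
  have det: "continuous_on UNIV (det :: real^'n^'n \<Rightarrow> real)"
    by (simp add: continuous_at_imp_continuous_on continuous_det)
  have "open ?U" using det by (intro open_Collect_less continuous_intros)
  then have "open O1"
    unfolding O1_def by (intro open_UN ballI continuous_open_preimage continuous_on_F_fun) auto
  then have m1: "{\<omega> \<in> space M. Q \<omega> \<in> O1} \<in> sets M"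
    using measurable_sets[OF Q, of O1] by (simp add: vimage_def Int_def conj_commute)
  have "open O2"
    unfolding O2_def by (intro open_UN ballI open_Collect_less continuous_intros)
  have vech_meas: "(\<lambda>\<omega>. vech (Q \<omega>)) \<in> borel_measurable M"
  proof (rule borel_measurable_vecI)
    fix u :: "'n uprod"
    obtain i j where u: "u = Upair i j" by (cases u) auto
    have row: "(\<lambda>A :: real^'n^'n. A $ i) \<in> borel_measurable borel"
      by (intro borel_measurable_continuous_onI continuous_intros)
    have "(\<lambda>\<omega>. Q \<omega> $ i $ j) \<in> borel_measurable M"
      by (rule borel_measurable_coordinate[OF measurable_compose[OF Q row]])
    moreover have "vech (Q \<omega>) $ u = Q \<omega> $ i $ j" if "\<omega> \<in> space M" for \<omega>
      using sym[OF that] by (simp add: u vech_Upair)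
    ultimately show "(\<lambda>\<omega>. vech (Q \<omega>) $ u) \<in> borel_measurable M"
      by (subst measurable_cong) auto
  qed
  have m2: "{\<omega> \<in> space M. vech (Q \<omega>) \<in> O2} \<in> sets M"
    using measurable_sets[OF vech_meas, of O2] \<open>open O2\<close> by (simp add: vimage_def Int_def conj_commute)
  have m3: "{\<omega> \<in> space M. det (Q \<omega>) = 0} \<in> sets M"
  proof -
    have "closed {A :: real^'n^'n. det A = 0}" using det by (intro closed_Collect_eq continuous_intros)
    then show ?thesis
      using measurable_sets[OF Q, of "{A. det A = 0}"] by (simp add: vimage_def Int_def conj_commute)
  qed
  have "f \<omega> < d \<longleftrightarrow> Q \<omega> \<in> O1 \<or> det (Q \<omega>) = 0 \<and> vech (Q \<omega>) \<in> O2" if \<omega>: "\<omega> \<in> space M" for \<omega>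
  proof -
    have less: "f \<omega> < d \<longleftrightarrow> (\<exists>\<theta>\<in>\<Theta>. contrast (Q \<omega>) (Y \<theta>) < d)"
      using attained[OF \<omega>] minimal[OF \<omega>] by (metis order_le_less_trans)
    show ?thesis
    proof (cases "invertible (Q \<omega>)")
      case True
      have "0 < det (Q \<omega>)" using pd[OF \<omega> True] by (rule pos_def_det_pos)
      moreover have "contrast (Q \<omega>) (Y \<theta>) = F_fun (Q \<omega>) (Y \<theta>)" if "\<theta> \<in> \<Theta>" for \<theta>
        by (rule contrast_eq_F_fun[OF pd[OF \<omega> True] Y[OF that]])
      ultimately show ?thesis unfolding less O1_def by auto
    next
      case False
      then have "det (Q \<omega>) = 0" by (simp add: invertible_det_nz)
      then show ?thesis unfolding less O1_def O2_def by (simp add: contrast_singular[OF False])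
    qed
  qed
  then have "{\<omega> \<in> space M. f \<omega> < d} =
      {\<omega> \<in> space M. Q \<omega> \<in> O1} \<union> ({\<omega> \<in> space M. det (Q \<omega>) = 0} \<inter> {\<omega> \<in> space M. vech (Q \<omega>) \<in> O2})"
    by auto
  then show "{\<omega> \<in> space M. f \<omega> < d} \<in> sets M" using m1 m2 m3 by auto
qed

lemma contrast_nonneg:
  assumes "invertible Q \<Longrightarrow> pos_def Q" and "pos_def S"
  shows "0 \<le> contrast Q S"
proof (cases "invertible Q")
  case True
  then show ?thesis using assms by (simp add: contrast_eq_F_fun F_fun_nonneg)
qed (simp add: contrast_singular)

section \<open>Consistency of the test\<close>

theorem theorem8:
  fixes m :: "('p1::finite, 'p2::finite, 'k1::finite, 'k2::finite, 'q::finite,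
               'r1::finite, 'r2::finite, 'r3::finite, 'r4::finite) sem"
    and mstar :: "('p1, 'p2, 'l1::finite, 'l2::finite, 'qs::finite,
                   's1::finite, 's2::finite, 's3::finite, 's4::finite) sem"
    and \<theta>0 :: "real^'q" and \<theta>bar :: "real^'qs"
    and M :: "'w measure" and T \<alpha> :: real
    and W1 :: "real \<Rightarrow> 'w \<Rightarrow> real^'r1" and W2 :: "real \<Rightarrow> 'w \<Rightarrow> real^'r2"
    and W3 :: "real \<Rightarrow> 'w \<Rightarrow> real^'r3" and W4 :: "real \<Rightarrow> 'w \<Rightarrow> real^'r4"
    and B1 :: "real^'k1 \<Rightarrow> real^'k1" and B2 :: "real^'p1 \<Rightarrow> real^'p1"
    and B3 :: "real^'p2 \<Rightarrow> real^'p2" and B4 :: "real^'k2 \<Rightarrow> real^'k2"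
    and \<xi>0 :: "real^'k1" and \<delta>0 :: "real^'p1" and \<epsilon>0 :: "real^'p2" and \<zeta>0 :: "real^'k2"
    and \<xi> :: "real \<Rightarrow> 'w \<Rightarrow> real^'k1" and \<delta> :: "real \<Rightarrow> 'w \<Rightarrow> real^'p1"
    and \<epsilon> :: "real \<Rightarrow> 'w \<Rightarrow> real^'p2" and \<zeta> \<eta> :: "real \<Rightarrow> 'w \<Rightarrow> real^'k2"
    and X :: "real \<Rightarrow> 'w \<Rightarrow> real^('p1 + 'p2)"
    and \<theta>hat :: "nat \<Rightarrow> 'w \<Rightarrow> real^'qs"
  defines "Q \<equiv> \<lambda>n \<omega>. realized_cov T n (\<lambda>t. X t \<omega>)"
  defines "Fn \<equiv> \<lambda>n \<omega> \<theta>. contrast (Q n \<omega>) (Sigma_cov mstar \<theta>)"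
  defines "Tn \<equiv> \<lambda>n \<omega>. real n * Fn n \<omega> (\<theta>hat n \<omega>)"
  defines "U \<equiv> \<lambda>\<theta>. F_fun (Sigma_cov m \<theta>0) (Sigma_cov mstar \<theta>)"
  defines "pbar \<equiv> (CARD('p1) + CARD('p2)) * (CARD('p1) + CARD('p2) + 1) div 2"
  assumes "0 < \<alpha>" "\<alpha> < 1" and "0 < T"
    and "is_sem m" "is_sem mstar" and "\<theta>0 \<in> Theta m"
    and "prob_space M"
    and "wiener_process M T W1" "wiener_process M T W2"
        "wiener_process M T W3" "wiener_process M T W4"
    and "prob_space.indep_sets M
           ((!) [process_events M T W1, process_events M T W2,
                 process_events M T W3, process_events M T W4]) {..<4}"
    and "solves_sde M T B1 (S1 m \<theta>0) W1 \<xi>0 \<xi>" "solves_sde M T B2 (S2 m \<theta>0) W2 \<delta>0 \<delta>"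
        "solves_sde M T B3 (S3 m \<theta>0) W3 \<epsilon>0 \<epsilon>" "solves_sde M T B4 (S4 m \<theta>0) W4 \<zeta>0 \<zeta>"
    and "\<And>t \<omega>. t \<in> {0..T} \<Longrightarrow> \<omega> \<in> space M \<Longrightarrow>
           \<eta> t \<omega> = B0 m \<theta>0 *v \<eta> t \<omega> + Gamma_mat m \<theta>0 *v \<xi> t \<omega> + \<zeta> t \<omega>"
    and "\<And>t \<omega>. t \<in> {0..T} \<Longrightarrow> \<omega> \<in> space M \<Longrightarrow>
           X t \<omega> = join_vec (Lx1 m \<theta>0 *v \<xi> t \<omega> + \<delta> t \<omega>) (Lx2 m \<theta>0 *v \<eta> t \<omega> + \<epsilon> t \<omega>)"
    and "\<And>n \<omega>. 1 \<le> n \<Longrightarrow> \<omega> \<in> space M \<Longrightarrow>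
           \<theta>hat n \<omega> \<in> Theta mstar \<and> Fn n \<omega> (\<theta>hat n \<omega>) = (INF \<theta>\<in>Theta mstar. Fn n \<omega> \<theta>)"
    and "\<theta>bar \<in> Theta mstar" and "U \<theta>bar = (INF \<theta>\<in>Theta mstar. U \<theta>)"
    and a_lipschitz: "\<exists>L. L-lipschitz_on UNIV B1" "\<exists>L. L-lipschitz_on UNIV B2"
        "\<exists>L. L-lipschitz_on UNIV B3" "\<exists>L. L-lipschitz_on UNIV B4"
    and a_smooth: "C_up 4 B1" "C_up 4 B2" "C_up 4 B3" "C_up 4 B4"
    and a_moments: "bounded_moments M T \<xi>" "bounded_moments M T \<delta>"
        "bounded_moments M T \<epsilon>" "bounded_moments M T \<zeta>"
    and b: "regular_sem m" "regular_sem mstar"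
    and c: "\<And>\<theta>. \<theta> \<in> Theta mstar \<Longrightarrow> U \<theta> = U \<theta>bar \<Longrightarrow> \<theta> = \<theta>bar"
    and d: "\<And>\<theta>. \<theta> \<in> Theta mstar \<Longrightarrow> Sigma_cov m \<theta>0 \<noteq> Sigma_cov mstar \<theta>"
  shows "(\<lambda>n. measure M {\<omega> \<in> space M. Tn n \<omega> > chi_squared_upper (pbar - CARD('qs)) \<alpha>})
           \<longlonglongrightarrow> 1"
proof -
  interpret prob_space M by fact
  define c where "c = chi_squared_upper (pbar - CARD('qs)) \<alpha>"
  have S: "pos_def (Sigma_cov m \<theta>0)" by (rule pos_def_Sigma_cov) fact+
  have Y: "pos_def (Sigma_cov mstar \<theta>)" if "\<theta> \<in> Theta mstar" for \<theta>
    by (rule pos_def_Sigma_cov[OF \<open>is_sem mstar\<close> b(2) that])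

  \<comment> \<open>The minimum over the candidate parameters is attained at \<open>\<theta>bar\<close>. Under the alternative it is therefore
    positive, and it separates the true covariance from all candidates at once.\<close>
  define u where "u = U \<theta>bar"
  have u: "0 < u"
    unfolding u_def U_def using \<open>\<theta>bar \<in> Theta mstar\<close> by (intro F_fun_pos S Y d)
  have gap: "u \<le> F_fun (Sigma_cov m \<theta>0) (Sigma_cov mstar \<theta>)" if "\<theta> \<in> Theta mstar" for \<theta>
  proof -
    have "bdd_below (U ` Theta mstar)"
      by (intro bdd_belowI2[where m = 0]) (simp add: U_def F_fun_nonneg S Y)
    then have "(INF \<theta>\<in>Theta mstar. U \<theta>) \<le> U \<theta>" using that by (rule cINF_lower)
    then show ?thesis
      using \<open>U \<theta>bar = (INF \<theta>\<in>Theta mstar. U \<theta>)\<close> by (simp add: u_def U_def)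
  qed
  obtain r where r: "0 < r" and near: "\<And>A. dist A (Sigma_cov m \<theta>0) < r \<Longrightarrow> transpose A = A \<Longrightarrow>
      pos_def A \<and> (\<forall>B. pos_def B \<longrightarrow> u \<le> F_fun (Sigma_cov m \<theta>0) B \<longrightarrow> u / 4 \<le> F_fun A B)"
    using F_fun_lower_bound_stable[OF S u] unfolding eventually_nhds_metric by blast

  note consistency = realized_cov_consistent[OF assms(8,9) b(1) assms(11,13-21) a_lipschitz assms(22,23)]
  have Q_meas: "Q n \<in> borel_measurable M" for n
    unfolding Q_def by (rule realized_cov_measurable[OF \<open>0 < T\<close> consistency(1)])
  have Q_sym: "transpose (Q n \<omega>) = Q n \<omega>" for n \<omega>
    by (simp add: Q_def transpose_realized_cov)
  have Q_pd: "pos_def (Q n \<omega>)" if "invertible (Q n \<omega>)" for n \<omega>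
    using pos_def_realized_cov[OF \<open>0 < T\<close>] that by (simp add: Q_def)
  have hat: "\<theta>hat n \<omega> \<in> Theta mstar" if "1 \<le> n" "\<omega> \<in> space M" for n \<omega>
    using assms(24)[OF that] by blast

  \<comment> \<open>\<open>measure\<close> is \<open>0\<close> on sets that are not measurable, so the rejection event has to be shown to be an event.\<close>
  have Tn_meas: "Tn n \<in> borel_measurable M" if n: "1 \<le> n" for n
  proof -
    have "(\<lambda>\<omega>. Fn n \<omega> (\<theta>hat n \<omega>)) \<in> borel_measurable M"
    proof (rule minimal_contrast_measurable[where Q = "Q n" and Y = "Sigma_cov mstar" and \<Theta> = "Theta mstar"])
      fix \<omega> assume \<omega>: "\<omega> \<in> space M"
      show "\<exists>\<theta>\<in>Theta mstar. Fn n \<omega> (\<theta>hat n \<omega>) = contrast (Q n \<omega>) (Sigma_cov mstar \<theta>)"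
        using hat[OF n \<omega>] by (auto simp: Fn_def)
      fix \<theta> assume \<theta>: "\<theta> \<in> Theta mstar"
      have "bdd_below (Fn n \<omega> ` Theta mstar)"
        by (intro bdd_belowI2[where m = 0]) (simp add: Fn_def contrast_nonneg Q_pd Y)
      then have "(INF \<theta>\<in>Theta mstar. Fn n \<omega> \<theta>) \<le> Fn n \<omega> \<theta>" using \<theta> by (rule cINF_lower)
      then show "Fn n \<omega> (\<theta>hat n \<omega>) \<le> contrast (Q n \<omega>) (Sigma_cov mstar \<theta>)"
        using assms(24)[OF n \<omega>] by (simp add: Fn_def)
    qed (use Q_meas Q_sym Q_pd Y in auto)
    then show ?thesis unfolding Tn_def by (intro borel_measurable_times borel_measurable_const)
  qed

  have large: "real n * (u / 4) \<le> Tn n \<omega>"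
    if "1 \<le> n" "\<omega> \<in> space M" "dist (Q n \<omega>) (Sigma_cov m \<theta>0) < r" for n \<omega>
  proof -
    have Y': "pos_def (Sigma_cov mstar (\<theta>hat n \<omega>))" by (rule Y[OF hat[OF that(1,2)]])
    have "pos_def (Q n \<omega>)" "u / 4 \<le> F_fun (Q n \<omega>) (Sigma_cov mstar (\<theta>hat n \<omega>))"
      using near[OF that(3) Q_sym] Y' gap[OF hat[OF that(1,2)]] by blast+
    then have "real n * (u / 4) \<le> real n * contrast (Q n \<omega>) (Sigma_cov mstar (\<theta>hat n \<omega>))"
      by (intro mult_left_mono) (simp_all add: contrast_eq_F_fun Y')
    then show ?thesis by (simp only: Tn_def Fn_def)
  qed
  let ?bad = "\<lambda>n. {\<omega> \<in> space M. r \<le> dist (Q n \<omega>) (Sigma_cov m \<theta>0)}"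
  have bad_meas: "?bad n \<in> sets M" for n using Q_meas[of n] by measurable
  have "\<forall>\<^sub>F n in sequentially. c / (u / 4) < real n"
    by (rule filterlim_real_sequentially[unfolded filterlim_at_top_dense, rule_format])
  moreover have "\<forall>\<^sub>F n in sequentially. (1::nat) \<le> n" by (rule eventually_ge_at_top)
  ultimately have lower: "\<forall>\<^sub>F n in sequentially. 1 - prob (?bad n) \<le> prob {\<omega> \<in> space M. c < Tn n \<omega>}"
  proof eventually_elim
    case (elim n)
    have "c < real n * (u / 4)" using elim u by (simp add: field_simps)
    then have "space M - ?bad n \<subseteq> {\<omega> \<in> space M. c < Tn n \<omega>}"
      using large[OF elim(2)] by force
    moreover have "{\<omega> \<in> space M. c < Tn n \<omega>} \<in> sets M"
      using Tn_meas[OF elim(2)] by measurable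
    ultimately have "prob (space M - ?bad n) \<le> prob {\<omega> \<in> space M. c < Tn n \<omega>}"
      by (rule finite_measure_mono)
    then show ?case by (simp add: prob_compl[OF bad_meas])
  qed
  have "(\<lambda>n. 1 - prob (?bad n)) \<longlonglongrightarrow> 1 - 0"
    using consistency(2) r unfolding Q_def by (intro tendsto_diff tendsto_const tendsto_in_probD)
  then have "(\<lambda>n. prob {\<omega> \<in> space M. c < Tn n \<omega>}) \<longlonglongrightarrow> 1"
    by (intro tendsto_sandwich[OF lower _ _ tendsto_const]) simp_all
  then show ?thesis by (simp add: c_def)
qed

end
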